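(* For every $n\in\mathbb N$ and every multiplication rule $C$ there is an isomorphism of graded rings $$H^n\otimes_{\mathbb Z}\mathbb Z/2\mathbb Z\simeq OH^n_C\otimes_{\mathbb Z}\mathbb Z/2\mathbb Z .$$
   Context: **Diagrams.** $B^n$ is the set of crossingless matchings of the $2n$ points $\{1,\dots,2n\}$ on a line: partitions of the points into $n$ pairs (arcs) which can be drawn as $n$ pairwise disjoint half-circles on one side of the line (arcs may be nested). $W$ denotes reflection in the line. For $a,b\in B^n$, $W(b)a$ is the collection of disjoint circles in the plane obtained by gluing the reflection of $b$ to $a$ along the $2n$ points; its circles correspond to the connected components of the graph on $\{1,\dots,2n\}$ whose edges are the arcs of $a$ and of $b$. $|W(b)a|$ is the number of circles. **The group $OH^n$.** For a collection of circles $S$, $V(S)$ is the free abelian group on the circles of $S$. Put $b(OH^n)a:=\bigwedge^*V(W(b)a)$ (exterior algebra over $\mathbb Z$), graded so that a wedge of $k$ circles has degree $2k+n-|W(b)a|$. Let ${}_b1_a$ be the unit of this exterior algebra and $1_a:={}_a1_a$. Set $OH^n:=\bigoplus_{a,b\in B^n}b(OH^n)a$. **Multiplication rules.** A multiplication rule $C$ consists, for each triple $(c,b,a)\in (B^n)^3$, of (i) a total order on the points $\{1,\dots,2n\}$ such that whenever $i,j$ are joined by an arc of $b$ and $k$ lies strictly between $i$ and $j$ (in the usual order), then $i$ or $j$ precedes $k$ in the order of the rule; and (ii) an orientation $i\to j$ or $j\to i$ of each arc $\{i,j\}$ of $b$. **Multiplication.** $OH^n_C$ is $OH^n$ with the following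 multiplication. If $c\neq b$ the product of an element of $d(OH^n)c$ with an element of $b(OH^n)a$ is $0$. For $x\in c(OH^n)b$, $y\in b(OH^n)a$, place $W(c)b$ above $W(b)a$; this gives a collection of circles $D_0$ and the element $x\wedge y\in\bigwedge^*V(D_0)$ (using $V(D_0)=V(W(c)b)\oplus V(W(b)a)$). Go through the points in the order given by $C$ for $(c,b,a)$; each time an arc $\{i,j\}$ of $b$ is met for the first time, do a surgery: delete the copy of this arc in $W(c)b$ and its mirror copy in $W(b)a$, and join the upper point $i$ to the lower point $i$ and the upper point $j$ to the lower point $j$ by vertical segments. Each surgery either merges two circles into one or splits one circle into two. To a merge $S_1\to S_2$ of $a_1,a_2$ into $b_1$ associate the map $\bigwedge^*V(S_1)\to\bigwedge^*V(S_2)$ induced by $a_1,a_2\mapsto b_1$ and the identity on the other circles. To a split $S_1\to S_2$ of a circle $e$ into the circle $e_i$ through point $i$ and the circle $e_j$ through point $j$, with orientation $i\to j$ of the arc, associate the map $x\mapsto (e_i-e_j)\wedge x'$, where $x'$ is obtained from $x$ by replacing $e$ by $e_i$ (equivalently by $e_j$). After all $n$ surgeries one obtains $W(c)a$, and $xy\in c(OH^n)a$ is the image of $x\wedge y$ under the composite of these maps. $OH^n_C$ is a graded unital, in general non-associative, ring with unit $\sum_a 1_a$. **Khovanov's arc ring $H^n$.** Let $A$ be the free abelian group on $1,t$ with $\deg 1=-1$, $\deg t=1$. Put $b(H^n)a:=A^{\otimes |W(b)a|}$ (one tensor factor per circle of $W(b)a$) with degree shifted up by $n$, and $H^n:=\bigoplus_{a,b}b(H^n)a$.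 The multiplication is zero on $d(H^n)c\times b(H^n)a$ for $c\ne b$, and on $c(H^n)b\times b(H^n)a$ it is given by taking $x\otimes y$ and performing the same $n$ surgeries from $W(c)b\sqcup W(b)a$ to $W(c)a$ (in any order), where a merge induces $m:A\otimes A\to A$, $1\otimes1\mapsto1$, $1\otimes t,\,t\otimes1\mapsto t$, $t\otimes t\mapsto0$, and a split induces $\Delta:A\to A\otimes A$, $1\mapsto 1\otimes t+t\otimes1$, $t\mapsto t\otimes t$. *)

theory Defs
  imports
    "HOL-Algebra.Free_Abelian_Groups"
    "HOL-Algebra.Product_Groups"
    "HOL-Algebra.QuotRing"
    "HOL-Number_Theory.Residues"
    "HOL-Library.Disjoint_Sets"
begin

section \<open>Crossingless matchings\<close>

type_synonym matching = "nat set set"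

definition points :: "nat \<Rightarrow> nat set" where
  "points n = {1..2 * n}"

text \<open>The half-circle in the upper half-plane whose diameter is the segment between the two
  points of the arc on the real line (Thales).\<close>

definition half_circle :: "nat set \<Rightarrow> (real \<times> real) set" where
  "half_circle e =
     {(x, y). 0 \<le> y \<and> (x - real (Min e)) * (x - real (Max e)) + y\<^sup>2 = 0}"

definition B :: "nat \<Rightarrow> matching set" where
  "B n = {a. partition_on (points n) a \<and> (\<forall>e\<in>a. card e = 2)
             \<and> disjoint_family_on half_circle a}"

lemma half_circle_pair:
  "i < k \<Longrightarrow> half_circle {i, k} = {(x, y). 0 \<le> y \<and> (x - real i) * (x - real k) + y\<^sup>2 = 0}"
  by (simp add: half_circle_def min_def max_def)

text \<open>Two half-circles without common end points meet iff their end points interleave.\<close>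

lemma half_circles_meet_if_interleaved:
  assumes "i < j" "j < k" "k < (l :: nat)"
  shows "half_circle {i, k} \<inter> half_circle {j, l} \<noteq> {}"
proof -
  define D where "D = real j + real l - real i - real k"
  define x where "x = (real j * real l - real i * real k) / D"
  have D: "D > 0" using assms by (simp add: D_def)
  have 1: "x - real i = (real j - real i) * (real l - real i) / D"
    using D unfolding x_def D_def by (simp add: field_simps)
  have 2: "x - real k = - ((real k - real j) * (real l - real k) / D)"
    using D unfolding x_def D_def by (simp add: field_simps)
  have "(x - real i) * (x - real k) \<le> 0"
    unfolding 1 2 using D assms by (intro mult_nonneg_nonpos) auto
  moreover have "(x - real i) * (x - real k) = (x - real j) * (x - real l)"
  proof -
    have "x * D = real j * real l - real i * real k" using D by (simp add: x_def)
    then show ?thesis by (simp add: D_def algebra_simps)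
  qed
  ultimately have
    "(x, sqrt (- ((x - real i) * (x - real k)))) \<in> half_circle {i, k} \<inter> half_circle {j, l}"
    using assms by (simp add: half_circle_pair)
  then show ?thesis by blast
qed

lemma half_circle_range:
  assumes "i < k" "(x, y) \<in> half_circle {i, k}"
  shows "real i \<le> x \<and> x \<le> real k"
proof -
  have "(x - real i) * (x - real k) \<le> 0"
    using assms by (simp add: half_circle_pair) (smt (verit) zero_le_power2)
  then show ?thesis using assms(1) by (auto simp: mult_le_0_iff)
qed

lemma half_circles_nested_disjoint:
  assumes "i < j" "j < l" "l < (k :: nat)"
  shows "half_circle {i, k} \<inter> half_circle {j, l} = {}"
proof (rule ccontr)
  assume "\<not> ?thesis"
  then obtain x y where m: "(x, y) \<in> half_circle {i, k}" "(x, y) \<in> half_circle {j, l}"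
    by auto
  have r: "real j \<le> x" "x \<le> real l" using half_circle_range[OF assms(2) m(2)] by auto
  have "(x - real i) * (real k - x) = (x - real j) * (real l - x)"
    using m assms by (simp add: half_circle_pair algebra_simps)
  moreover have "(x - real j) * (real l - x) \<le> (x - real i) * (real l - x)"
    using r assms by (intro mult_right_mono) auto
  moreover have "(x - real i) * (real l - x) < (x - real i) * (real k - x)"
    using r assms by (intro mult_strict_left_mono) auto
  ultimately show False by linarith
qed

lemma half_circles_disjoint_iff:
  assumes "i < k" "j < l" "{i, k} \<inter> {j, l} = {}"
  shows "half_circle {i, k} \<inter> half_circle {j, l} = {} \<longleftrightarrow>
         \<not> (i < j \<and> j < k \<and> k < l) \<and> \<not> (j < i \<and> i < l \<and> l < k)"
proof -
  consider "i < j \<and> j < k \<and> k < l" | "j < i \<and> i < l \<and> l < k" | "i < j \<and> l < k"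
    | "j < i \<and> k < l" | "k < j" | "l < i"
    using assms by fastforce
  then show ?thesis
  proof cases
    case 1
    then show ?thesis using half_circles_meet_if_interleaved[of i j k l] by auto
  next
    case 2
    then show ?thesis using half_circles_meet_if_interleaved[of j i l k] by auto
  next
    case 3
    then show ?thesis using half_circles_nested_disjoint[of i j l k] assms by auto
  next
    case 4
    then show ?thesis using half_circles_nested_disjoint[of j i k l] assms by auto
  next
    case 5
    then have "half_circle {i, k} \<inter> half_circle {j, l} = {}"
      using half_circle_range[OF assms(1)] half_circle_range[OF assms(2)] by fastforce
    then show ?thesis using 5 by auto
  next
    case 6
    then have "half_circle {i, k} \<inter> half_circle {j, l} = {}"
      using half_circle_range[OF assms(1)] half_circle_range[OF assms(2)] by fastforce
    then show ?thesis using 6 by auto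
  qed
qed


section \<open>Circles and surgeries\<close>

text \<open>A collection of circles is given by a graph, a circle being the set of vertices of a
  connected component.\<close>

definition edge_rel :: "'v set set \<Rightarrow> 'v rel" where
  "edge_rel E = {(u, v). {u, v} \<in> E}"

definition circle_through :: "'v set set \<Rightarrow> 'v \<Rightarrow> 'v set" where
  "circle_through E v = (edge_rel E)\<^sup>* `` {v}"

definition circles_of :: "'v set \<Rightarrow> 'v set set \<Rightarrow> 'v set set" where
  "circles_of V E = circle_through E ` V"

text \<open>The circles of \<open>W(b)a\<close>.\<close>

definition circles :: "nat \<Rightarrow> matching \<Rightarrow> matching \<Rightarrow> nat set set" where
  "circles n b a = circles_of (points n) (b \<union> a)"

text \<open>\<open>W(c)b\<close> placed above \<open>W(b)a\<close>, after surgery along the set \<open>P\<close> of arcs of \<open>b\<close>. The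
  upper copy of the point \<open>p\<close> is \<open>Inl p\<close>, the lower copy is \<open>Inr p\<close>.\<close>

definition stacked :: "matching \<Rightarrow> matching \<Rightarrow> matching \<Rightarrow> nat set set \<Rightarrow> (nat + nat) set set" where
  "stacked c b a P =
     (`) Inl ` c \<union> (`) Inl ` (b - P) \<union> (`) Inr ` (b - P) \<union> (`) Inr ` a
     \<union> {{Inl p, Inr p} | p. p \<in> \<Union>P}"

definition stacked_circles ::
  "nat \<Rightarrow> matching \<Rightarrow> matching \<Rightarrow> matching \<Rightarrow> nat set set \<Rightarrow> (nat + nat) set set" where
  "stacked_circles n c b a P = circles_of (points n <+> points n) (stacked c b a P)"

text \<open>Contracting the vertical segments turns the circles obtained after all surgeries into
  those of \<open>W(c)a\<close>.\<close>

definition contract :: "(nat + nat) set \<Rightarrow> nat set" where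
  "contract K = case_sum id id ` K"

definition arc_at :: "matching \<Rightarrow> nat \<Rightarrow> nat set" where
  "arc_at b p = (THE e. e \<in> b \<and> p \<in> e)"

text \<open>Run through a list of points and do a surgery whenever an arc of \<open>b\<close> is met for the first
  time. The argument \<open>P\<close> is the set of arcs already met, and \<open>F P e\<close> is the map associated to
  the surgery along \<open>e\<close> performed after those along \<open>P\<close>.\<close>

primrec surgeries ::
  "(nat set set \<Rightarrow> nat set \<Rightarrow> 'x \<Rightarrow> 'x) \<Rightarrow> matching \<Rightarrow> nat list \<Rightarrow> nat set set \<Rightarrow> 'x \<Rightarrow> 'x" where
  "surgeries F b [] P x = x"
| "surgeries F b (p # ps) P x =
     (if arc_at b p \<in> P then surgeries F b ps P x
      else surgeries F b ps (insert (arc_at b p) P) (F P (arc_at b p) x))"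


section \<open>Graded rings\<close>

text \<open>Only the operations are recorded: the locale \<open>ring\<close> is not assumed, because odd arc rings
  need not be associative. The homogeneous elements of degree \<open>k\<close> form \<open>homog R k\<close>.\<close>

record 'a graded_ring = "'a ring" +
  homog :: "int \<Rightarrow> 'a set"

definition graded_ring_iso ::
  "('a, 'm) graded_ring_scheme \<Rightarrow> ('b, 'n) graded_ring_scheme \<Rightarrow> ('a \<Rightarrow> 'b) set" where
  "graded_ring_iso R S = {h \<in> ring_iso R S. \<forall>k. h ` homog R k = homog S k}"

text \<open>The tensor product over \<open>\<int>\<close> of the additive groups of two rings, as the quotient of the free
  abelian group on pairs by the biadditivity relations.\<close>

definition tensor_relations ::
  "('a, 'm) ring_scheme \<Rightarrow> ('b, 'n) ring_scheme \<Rightarrow> ('a \<times> 'b \<Rightarrow>\<^sub>0 int) set" where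
  "tensor_relations R S = generate (free_Abelian_group (carrier R \<times> carrier S))
     ({frag_of (r \<oplus>\<^bsub>R\<^esub> r', s) - frag_of (r, s) - frag_of (r', s) | r r' s.
         r \<in> carrier R \<and> r' \<in> carrier R \<and> s \<in> carrier S} \<union>
      {frag_of (r, s \<oplus>\<^bsub>S\<^esub> s') - frag_of (r, s) - frag_of (r, s') | r s s'.
         r \<in> carrier R \<and> s \<in> carrier S \<and> s' \<in> carrier S})"

definition tensor_group ::
  "('a, 'm) ring_scheme \<Rightarrow> ('b, 'n) ring_scheme \<Rightarrow> ('a \<times> 'b \<Rightarrow>\<^sub>0 int) set monoid" where
  "tensor_group R S =
     free_Abelian_group (carrier R \<times> carrier S) Mod tensor_relations R S"

definition tensor_class ::
  "('a, 'm) ring_scheme \<Rightarrow> ('b, 'n) ring_scheme \<Rightarrow> ('a \<times> 'b \<Rightarrow>\<^sub>0 int) \<Rightarrow> ('a \<times> 'b \<Rightarrow>\<^sub>0 int) set" where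
  "tensor_class R S x =
     tensor_relations R S #>\<^bsub>free_Abelian_group (carrier R \<times> carrier S)\<^esub> x"

text \<open>The bilinear extension of \<open>(r, s) (r', s') = (r r', s s')\<close>.\<close>

definition pair_mult ::
  "('a, 'm) ring_scheme \<Rightarrow> ('b, 'n) ring_scheme
     \<Rightarrow> ('a \<times> 'b \<Rightarrow>\<^sub>0 int) \<Rightarrow> ('a \<times> 'b \<Rightarrow>\<^sub>0 int) \<Rightarrow> ('a \<times> 'b \<Rightarrow>\<^sub>0 int)" where
  "pair_mult R S x y =
     frag_extend (\<lambda>(r, s). frag_extend (\<lambda>(r', s'). frag_of (r \<otimes>\<^bsub>R\<^esub> r', s \<otimes>\<^bsub>S\<^esub> s')) y) x"

text \<open>The ring \<open>R \<otimes> S\<close> for a graded ring \<open>R\<close> and a ring \<open>S\<close> placed in degree \<open>0\<close>. As for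
  \<open>rcoset_mult\<close>, the union in the multiplication is over the (equal) classes of the products of
  all pairs of representatives.\<close>

definition tensor_ring ::
  "('a, 'm) graded_ring_scheme \<Rightarrow> ('b, 'n) ring_scheme \<Rightarrow> ('a \<times> 'b \<Rightarrow>\<^sub>0 int) set graded_ring" where
  "tensor_ring R S =
     \<lparr>carrier = carrier (tensor_group R S),
      monoid.mult = (\<lambda>U V. \<Union>x\<in>U. \<Union>y\<in>V. tensor_class R S (pair_mult R S x y)),
      one = tensor_class R S (frag_of (\<one>\<^bsub>R\<^esub>, \<one>\<^bsub>S\<^esub>)),
      zero = \<one>\<^bsub>tensor_group R S\<^esub>,
      add = monoid.mult (tensor_group R S),
      homog = (\<lambda>k. generate (tensor_group R S)
        {tensor_class R S (frag_of (r, s)) | r s. r \<in> homog R k \<and> s \<in> carrier S})\<rparr>"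

text \<open>The graded ring with underlying group \<open>\<Oplus>\<^bsub>b,a\<^esub> G b a\<close>, with multiplication
  \<open>\<mu> c b a : G c b \<times> G b a \<rightarrow> G c a\<close> (and zero on \<open>G d c \<times> G b a\<close> for \<open>c \<noteq> b\<close>), with unit
  \<open>\<Sum>\<^bsub>a\<^esub> u a\<close>, and with \<open>D b a k\<close> the part of \<open>G b a\<close> of degree \<open>k\<close>. The groups \<open>G b a\<close> are
  written multiplicatively, so that \<open>finprod\<close> is a sum in the ring.\<close>

definition arc_ring ::
  "nat \<Rightarrow> (matching \<Rightarrow> matching \<Rightarrow> 'g monoid)
     \<Rightarrow> (matching \<Rightarrow> matching \<Rightarrow> matching \<Rightarrow> 'g \<Rightarrow> 'g \<Rightarrow> 'g)
     \<Rightarrow> (matching \<Rightarrow> 'g) \<Rightarrow> (matching \<Rightarrow> matching \<Rightarrow> int \<Rightarrow> 'g set)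
     \<Rightarrow> (matching \<times> matching \<Rightarrow> 'g) graded_ring" where
  "arc_ring n G \<mu> u D =
     (let \<Sigma> = sum_group (B n \<times> B n) (\<lambda>(b, a). G b a) in
     \<lparr>carrier = carrier \<Sigma>,
      monoid.mult = (\<lambda>x y. \<lambda>(c, a)\<in>B n \<times> B n.
        finprod (G c a) (\<lambda>b. \<mu> c b a (x (c, b)) (y (b, a))) (B n)),
      one = (\<lambda>(b, a)\<in>B n \<times> B n. if b = a then u a else \<one>\<^bsub>G b a\<^esub>),
      zero = \<one>\<^bsub>\<Sigma>\<^esub>,
      add = monoid.mult \<Sigma>,
      homog = (\<lambda>k. {x \<in> carrier \<Sigma>. \<forall>b\<in>B n. \<forall>a\<in>B n. x (b, a) \<in> D b a k})\<rparr>)"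


section \<open>Exterior algebras\<close>

text \<open>The tensor algebra of the free abelian group on \<open>S\<close> is the free abelian group on the words
  in \<open>S\<close>.\<close>

definition word_mult :: "('s list \<Rightarrow>\<^sub>0 int) \<Rightarrow> ('s list \<Rightarrow>\<^sub>0 int) \<Rightarrow> ('s list \<Rightarrow>\<^sub>0 int)" where
  "word_mult x y = frag_extend (\<lambda>u. frag_extend (\<lambda>v. frag_of (u @ v)) y) x"

definition word_map :: "('s \<Rightarrow> 't) \<Rightarrow> ('s list \<Rightarrow>\<^sub>0 int) \<Rightarrow> ('t list \<Rightarrow>\<^sub>0 int)" where
  "word_map f = frag_extend (\<lambda>w. frag_of (map f w))"

definition as_word :: "('s \<Rightarrow>\<^sub>0 int) \<Rightarrow> ('s list \<Rightarrow>\<^sub>0 int)" where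
  "as_word = frag_extend (\<lambda>s. frag_of [s])"

text \<open>The two-sided ideal generated by the squares \<open>v \<otimes> v\<close>.\<close>

definition ext_ideal :: "'s set \<Rightarrow> ('s list \<Rightarrow>\<^sub>0 int) set" where
  "ext_ideal S = generate (free_Abelian_group (lists S))
     {word_mult (word_mult x (word_mult (as_word v) (as_word v))) y | x v y.
        x \<in> carrier (free_Abelian_group (lists S)) \<and>
        v \<in> carrier (free_Abelian_group S) \<and>
        y \<in> carrier (free_Abelian_group (lists S))}"

definition exterior :: "'s set \<Rightarrow> ('s list \<Rightarrow>\<^sub>0 int) set monoid" where
  "exterior S = free_Abelian_group (lists S) Mod ext_ideal S"

definition ext_class :: "'s set \<Rightarrow> ('s list \<Rightarrow>\<^sub>0 int) \<Rightarrow> ('s list \<Rightarrow>\<^sub>0 int) set" where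
  "ext_class S x = ext_ideal S #>\<^bsub>free_Abelian_group (lists S)\<^esub> x"


section \<open>Odd arc rings\<close>

text \<open>The total order on the points is given by listing them in increasing order; an oriented arc
  \<open>i \<rightarrow> j\<close> is the pair \<open>(i, j)\<close>.\<close>

record mult_rule =
  point_order :: "matching \<Rightarrow> matching \<Rightarrow> matching \<Rightarrow> nat list"
  orientation :: "matching \<Rightarrow> matching \<Rightarrow> matching \<Rightarrow> nat set \<Rightarrow> nat \<times> nat"

definition precedes :: "nat list \<Rightarrow> nat \<Rightarrow> nat \<Rightarrow> bool" where
  "precedes ps p q \<longleftrightarrow> (\<exists>xs ys zs. ps = xs @ p # ys @ q # zs)"

definition multiplication_rule :: "nat \<Rightarrow> mult_rule \<Rightarrow> bool" where
  "multiplication_rule n C \<longleftrightarrow> (\<forall>c\<in>B n. \<forall>b\<in>B n. \<forall>a\<in>B n.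
     distinct (point_order C c b a) \<and> set (point_order C c b a) = points n \<and>
     (\<forall>i j k. {i, j} \<in> b \<and> i < k \<and> k < j \<longrightarrow>
        precedes (point_order C c b a) i k \<or> precedes (point_order C c b a) j k) \<and>
     (\<forall>e\<in>b. case orientation C c b a e of (i, j) \<Rightarrow> e = {i, j}))"

text \<open>The map associated to the surgery along \<open>e\<close> with orientation \<open>i \<rightarrow> j\<close>, on representatives in
  the tensor algebras. The upper copy of \<open>e\<close> lies on the circle through \<open>Inl i\<close> and the lower copy
  on the one through \<open>Inr i\<close>, so the surgery is a merge iff these are different circles.\<close>

definition odd_surgery ::
  "matching \<Rightarrow> matching \<Rightarrow> matching \<Rightarrow> (nat set \<Rightarrow> nat \<times> nat) \<Rightarrow> nat set set \<Rightarrow> nat set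
     \<Rightarrow> ((nat + nat) set list \<Rightarrow>\<^sub>0 int) \<Rightarrow> ((nat + nat) set list \<Rightarrow>\<^sub>0 int)" where
  "odd_surgery c b a ori P e x =
     (let (i, j) = ori e;
          a\<^sub>1 = circle_through (stacked c b a P) (Inl i);
          a\<^sub>2 = circle_through (stacked c b a P) (Inr i);
          e\<^sub>i = circle_through (stacked c b a (insert e P)) (Inl i);
          e\<^sub>j = circle_through (stacked c b a (insert e P)) (Inl j);
          x' = word_map (\<lambda>K. if K = a\<^sub>1 \<or> K = a\<^sub>2 then e\<^sub>i else K) x
      in if a\<^sub>1 \<noteq> a\<^sub>2 then x'
         else word_mult (as_word (frag_of e\<^sub>i - frag_of e\<^sub>j)) x')"

definition odd_product ::
  "mult_rule \<Rightarrow> matching \<Rightarrow> matching \<Rightarrow> matching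
     \<Rightarrow> (nat set list \<Rightarrow>\<^sub>0 int) \<Rightarrow> (nat set list \<Rightarrow>\<^sub>0 int) \<Rightarrow> (nat set list \<Rightarrow>\<^sub>0 int)" where
  "odd_product C c b a x y = word_map contract
     (surgeries (odd_surgery c b a (orientation C c b a)) b (point_order C c b a) {}
       (word_mult (word_map ((`) Inl) x) (word_map ((`) Inr) y)))"

definition OH :: "nat \<Rightarrow> mult_rule \<Rightarrow> (matching \<times> matching \<Rightarrow> (nat set list \<Rightarrow>\<^sub>0 int) set) graded_ring" where
  "OH n C = arc_ring n
     (\<lambda>b a. exterior (circles n b a))
     (\<lambda>c b a U V. \<Union>x\<in>U. \<Union>y\<in>V. ext_class (circles n c a) (odd_product C c b a x y))
     (\<lambda>a. ext_class (circles n a a) (frag_of []))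
     (\<lambda>b a k. ext_class (circles n b a) `
        {x \<in> carrier (free_Abelian_group (lists (circles n b a))).
           \<forall>w\<in>Poly_Mapping.keys x.
             2 * int (length w) + int n - int (card (circles n b a)) = k})"


section \<open>Khovanov's arc rings\<close>

text \<open>The basis \<open>1, t\<close> of the Frobenius algebra \<open>A\<close>.\<close>

datatype gen = Unit | T

fun gen_deg :: "gen \<Rightarrow> int" where
  "gen_deg Unit = -1"
| "gen_deg T = 1"

fun A_mult :: "gen \<Rightarrow> gen \<Rightarrow> (gen \<Rightarrow>\<^sub>0 int)" where
  "A_mult Unit g = frag_of g"
| "A_mult g Unit = frag_of g"
| "A_mult T T = 0"

fun A_comult :: "gen \<Rightarrow> (gen \<times> gen \<Rightarrow>\<^sub>0 int)" where
  "A_comult Unit = frag_of (Unit, T) + frag_of (T, Unit)"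
| "A_comult T = frag_of (T, T)"

text \<open>The tensor product of copies of \<open>A\<close> indexed by \<open>S\<close> is the free abelian group on the
  labellings of \<open>S\<close> by basis elements of \<open>A\<close>.\<close>

definition A_power :: "'s set \<Rightarrow> (('s \<Rightarrow> gen) \<Rightarrow>\<^sub>0 int) monoid" where
  "A_power S = free_Abelian_group (S \<rightarrow>\<^sub>E (UNIV :: gen set))"

definition labelling_map :: "('s set \<Rightarrow> 't set) \<Rightarrow> 's set set
     \<Rightarrow> (('s set \<Rightarrow> gen) \<Rightarrow>\<^sub>0 int) \<Rightarrow> (('t set \<Rightarrow> gen) \<Rightarrow>\<^sub>0 int)" where
  "labelling_map f S = frag_extend (\<lambda>l. frag_of (\<lambda>L\<in>f ` S. l (inv_into S f L)))"

definition even_surgery ::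
  "nat \<Rightarrow> matching \<Rightarrow> matching \<Rightarrow> matching \<Rightarrow> nat set set \<Rightarrow> nat set
     \<Rightarrow> (((nat + nat) set \<Rightarrow> gen) \<Rightarrow>\<^sub>0 int) \<Rightarrow> (((nat + nat) set \<Rightarrow> gen) \<Rightarrow>\<^sub>0 int)" where
  "even_surgery n c b a P e =
     (let i = Min e; j = Max e;
          S\<^sub>2 = stacked_circles n c b a (insert e P);
          a\<^sub>1 = circle_through (stacked c b a P) (Inl i);
          a\<^sub>2 = circle_through (stacked c b a P) (Inr i);
          e\<^sub>i = circle_through (stacked c b a (insert e P)) (Inl i);
          e\<^sub>j = circle_through (stacked c b a (insert e P)) (Inl j)
      in if a\<^sub>1 \<noteq> a\<^sub>2
         then frag_extend (\<lambda>l. frag_extend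
                (\<lambda>g. frag_of (\<lambda>K\<in>S\<^sub>2. if K = e\<^sub>i then g else l K))
                (A_mult (l a\<^sub>1) (l a\<^sub>2)))
         else frag_extend (\<lambda>l. frag_extend
                (\<lambda>(g, h). frag_of (\<lambda>K\<in>S\<^sub>2. if K = e\<^sub>i then g else if K = e\<^sub>j then h else l K))
                (A_comult (l a\<^sub>1))))"

text \<open>\<open>x \<otimes> y\<close> on the circles of \<open>W(c)b\<close> placed above \<open>W(b)a\<close>.\<close>

definition stack_labellings :: "nat \<Rightarrow> matching \<Rightarrow> matching \<Rightarrow> matching
     \<Rightarrow> ((nat set \<Rightarrow> gen) \<Rightarrow>\<^sub>0 int) \<Rightarrow> ((nat set \<Rightarrow> gen) \<Rightarrow>\<^sub>0 int)
     \<Rightarrow> (((nat + nat) set \<Rightarrow> gen) \<Rightarrow>\<^sub>0 int)" where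
  "stack_labellings n c b a x y =
     frag_extend (\<lambda>l. frag_extend (\<lambda>m.
       frag_of (\<lambda>K\<in>stacked_circles n c b a {}.
         if K \<in> (`) Inl ` circles n c b then l (Inl -` K) else m (Inr -` K))) y) x"

text \<open>The product does not depend on the order of the surgeries; here the points are visited from
  left to right.\<close>

definition even_product :: "nat \<Rightarrow> matching \<Rightarrow> matching \<Rightarrow> matching
     \<Rightarrow> ((nat set \<Rightarrow> gen) \<Rightarrow>\<^sub>0 int) \<Rightarrow> ((nat set \<Rightarrow> gen) \<Rightarrow>\<^sub>0 int)
     \<Rightarrow> ((nat set \<Rightarrow> gen) \<Rightarrow>\<^sub>0 int)" where
  "even_product n c b a x y = labelling_map contract (stacked_circles n c b a b)
     (surgeries (even_surgery n c b a) b [1..<2 * n + 1] {} (stack_labellings n c b a x y))"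

definition H :: "nat \<Rightarrow> (matching \<times> matching \<Rightarrow> ((nat set \<Rightarrow> gen) \<Rightarrow>\<^sub>0 int)) graded_ring" where
  "H n = arc_ring n
     (\<lambda>b a. A_power (circles n b a))
     (even_product n)
     (\<lambda>a. frag_of (\<lambda>K\<in>circles n a a. Unit))
     (\<lambda>b a k. {x \<in> carrier (A_power (circles n b a)).
        \<forall>l\<in>Poly_Mapping.keys x. (\<Sum>K\<in>circles n b a. gen_deg (l K)) + int n = k})"

end

theory Submission
  imports Defs "HOL-Library.Function_Algebras" "HOL-Library.Z2"
begin

text \<open>Modulo two both rings reduce to the same ring of matrices, indexed by pairs of matchings, with
  entries in commutative algebras of characteristic two generated by the circles, each of square
  zero: a labelling goes to the product of the circles labelled \<open>t\<close>, a wedge of circles to their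
  product. Under this reduction a merge identifies generators and a split of \<open>e\<close> into
  \<open>e\<^sub>i\<close>, \<open>e\<^sub>j\<close> multiplies by \<open>e\<^sub>i + e\<^sub>j\<close>, in both theories. So the composite of the surgeries
  sends \<open>x\<close> to \<open>z x\<close>, where \<open>z\<close> is the product over all splits of the sums of the final circles
  through the ends of the arc. The factor \<open>z\<close> does not depend on the order of the surgeries, since
  two consecutive ones can be exchanged: by a count of circles, the only cases that matter are two
  arcs that both split (or both merge) when performed first and do the opposite when performed second,
  and there both factors vanish (or agree).

  That a surgery within one circle really splits it uses planarity: arcs join points of opposite
  parity, so the circles are the orbits, on the vertices of one colour, of the composition of two
  involutions, and a surgery multiplies this permutation by a transposition.\<close>

section \<open>Linear extension\<close>

text \<open>Tensoring with the field of two elements divides a ring by its doubles. So no map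
  between \<open>H n\<close> and \<open>OH n C\<close> is built: each of them gets an additive map
  to one common target whose kernel consists of doubles, and it remains to see that the two maps
  have the same image, the same unit and homogeneous parts, and turn both products into the same
  biadditive operation. The obstacle is that the set of circles, and with it the algebra, changes at
  every surgery. All stages are therefore evaluated in the algebra of the final circles, an
  intermediate circle being sent to the generator of the final circle through one of its points.
  This depends on the point, because an intermediate circle can later be cut. The dependence
  disappears after multiplication by the factor contributed by the surgeries that are still to come,
  because (x + y) x = (x + y) y when x and y have square zero. Hence each statement about one
  surgery carries a multiplier \<open>z\<close>, and compatibility is proved from the last stage
  backwards.\<close>

abbreviation "keys \<equiv> Poly_Mapping.keys"

abbreviation "lookup \<equiv> Poly_Mapping.lookup"

text \<open>Values lie in a commutative ring, whereas \<open>frag_extend\<close> only has values in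
  a free Abelian group.\<close>

definition lin_ext :: "('a \<Rightarrow> 'r) \<Rightarrow> ('a \<Rightarrow>\<^sub>0 int) \<Rightarrow> 'r::comm_ring_1" where
  "lin_ext f x = (\<Sum>k\<in>keys x. of_int (lookup x k) * f k)"

lemma lin_ext_superset:
  assumes "finite K" "keys x \<subseteq> K"
  shows "lin_ext f x = (\<Sum>k\<in>K. of_int (lookup x k) * f k)"
  unfolding lin_ext_def using assms
  by (intro sum.mono_neutral_left) (auto simp: in_keys_iff)

lemma lin_ext_add [simp]: "lin_ext f (x + y) = lin_ext f x + lin_ext f y"
proof -
  let ?K = "keys x \<union> keys y"
  have "finite ?K" "keys (x + y) \<subseteq> ?K" using keys_add[of x y] by auto
  then show ?thesis
    by (simp add: lin_ext_superset[of ?K] lookup_add distrib_right sum.distrib)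
qed

lemma lin_ext_0 [simp]: "lin_ext f 0 = 0"
  by (simp add: lin_ext_def)

lemma lin_ext_minus [simp]: "lin_ext f (- x) = - lin_ext f x"
  using lin_ext_add[of f x "- x"] by (simp add: add_eq_0_iff)

lemma lin_ext_diff [simp]: "lin_ext f (x - y) = lin_ext f x - lin_ext f y"
  using lin_ext_add[of f "x - y" y] by simp

lemma lin_ext_frag_of [simp]: "lin_ext f (frag_of k) = f k"
  by (simp add: lin_ext_def)

lemma lin_ext_frag_extend: "lin_ext f (frag_extend g x) = lin_ext (\<lambda>k. lin_ext f (g k)) x"
  using subset_UNIV by (induction x rule: frag_induction) (auto simp: frag_extend_diff)

lemma lin_ext_cong:
  "(\<And>k. k \<in> keys x \<Longrightarrow> f k = g k) \<Longrightarrow> lin_ext f x = lin_ext g x"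
  by (simp add: lin_ext_def)

lemma lin_ext_mult_left: "lin_ext (\<lambda>k. c * f k) x = c * lin_ext f x"
  unfolding lin_ext_def sum_distrib_left by (intro sum.cong) (auto simp: mult_ac)

lemma lin_ext_mult_right: "lin_ext (\<lambda>k. f k * c) x = lin_ext f x * c"
  unfolding lin_ext_def sum_distrib_right by (intro sum.cong) (auto simp: mult_ac)

section \<open>Tensor products with the field of two elements\<close>

abbreviation Z2_ring :: "int ring" where "Z2_ring \<equiv> residue_ring 2"

lemma Z2_ring_simps [simp]:
  "carrier Z2_ring = {0, 1}" "\<one>\<^bsub>Z2_ring\<^esub> = 1"
  "s \<otimes>\<^bsub>Z2_ring\<^esub> s' = s * s' mod 2" "s \<oplus>\<^bsub>Z2_ring\<^esub> s' = (s + s') mod 2"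
  by (auto simp: residue_ring_def)

lemma group_free [simp]: "group (free_Abelian_group S)"
  using abelian_free_Abelian_group comm_group.axioms(2) by blast

lemma inv_free: "x \<in> carrier (free_Abelian_group S) \<Longrightarrow> inv\<^bsub>free_Abelian_group S\<^esub> x = - x"
  by simp

context
  fixes S :: "'a set" and N assumes sub: "subgroup N (free_Abelian_group S)"
begin

lemma free_subgroup_0: "0 \<in> N"
  using subgroup.one_closed[OF sub] by simp

lemma free_subgroup_add: "x \<in> N \<Longrightarrow> y \<in> N \<Longrightarrow> x + y \<in> N"
  using subgroup.m_closed[OF sub] by simp

lemma free_subgroup_minus: "x \<in> N \<Longrightarrow> - x \<in> N"
  using subgroup.m_inv_closed[OF sub] subgroup.mem_carrier[OF sub] inv_free by metis

lemma free_subgroup_diff: "x \<in> N \<Longrightarrow> y \<in> N \<Longrightarrow> x - y \<in> N"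
  using free_subgroup_add free_subgroup_minus by (metis add_uminus_conv_diff)

lemma free_coset_iff:
  "y \<in> N #>\<^bsub>free_Abelian_group S\<^esub> x \<longleftrightarrow> y - x \<in> N"
  by (force simp: r_coset_def)

lemma free_coset_eq_iff:
  "N #>\<^bsub>free_Abelian_group S\<^esub> x = N #>\<^bsub>free_Abelian_group S\<^esub> y \<longleftrightarrow> x - y \<in> N"
proof
  assume "N #>\<^bsub>free_Abelian_group S\<^esub> x = N #>\<^bsub>free_Abelian_group S\<^esub> y"
  then show "x - y \<in> N"
    using free_coset_iff[of x x] free_coset_iff[of x y] free_subgroup_0 by simp
next
  assume *: "x - y \<in> N"
  have "z - x \<in> N \<longleftrightarrow> z - y \<in> N" for z
    using free_subgroup_add[OF _ *, of "z - x"] free_subgroup_diff[OF _ *, of "z - y"] by auto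
  then show "N #>\<^bsub>free_Abelian_group S\<^esub> x = N #>\<^bsub>free_Abelian_group S\<^esub> y"
    by (auto simp: free_coset_iff)
qed

lemma free_subgroup_normal: "N \<lhd> free_Abelian_group S"
  using sub abelian_free_Abelian_group comm_group.normal_iff_subgroup by blast

lemma free_quotient_mult:
  assumes "x \<in> carrier (free_Abelian_group S)" "y \<in> carrier (free_Abelian_group S)"
  shows "(N #>\<^bsub>free_Abelian_group S\<^esub> x) \<otimes>\<^bsub>free_Abelian_group S Mod N\<^esub> (N #>\<^bsub>free_Abelian_group S\<^esub> y)
    = N #>\<^bsub>free_Abelian_group S\<^esub> (x + y)"
  using normal.rcos_sum[OF free_subgroup_normal assms] by (simp add: FactGroup_def)

end

lemma generate_free_subgroup:
  "X \<subseteq> carrier (free_Abelian_group S) \<Longrightarrow>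
    subgroup (generate (free_Abelian_group S) X) (free_Abelian_group S)"
  by (simp add: group.generate_is_subgroup)

lemma lin_ext_generate_0:
  assumes "x \<in> generate (free_Abelian_group S) X" "X \<subseteq> carrier (free_Abelian_group S)"
    "\<And>y. y \<in> X \<Longrightarrow> lin_ext f y = 0"
  shows "lin_ext f x = 0"
  using assms(1)
proof induction
  case (inv h)
  then have "inv\<^bsub>free_Abelian_group S\<^esub> h = - h" using assms(2) inv_free by blast
  then show ?case using inv assms(3) by simp
qed (use assms in auto)

text \<open>Products of classes are defined as unions over all representatives; such a union
  collapses once the product is independent of them and both classes are inhabited.\<close>

lemma UN_UN_eq:
  assumes "\<And>x' y'. x' \<in> X \<Longrightarrow> y' \<in> Y \<Longrightarrow> f x' y' = c" "x \<in> X" "y \<in> Y"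
  shows "(\<Union>x'\<in>X. \<Union>y'\<in>Y. f x' y') = c"
  using assms by blast

lemma tensor_ring_simps:
  "carrier (tensor_ring R S) = carrier (tensor_group R S)"
  "U \<otimes>\<^bsub>tensor_ring R S\<^esub> V = (\<Union>x\<in>U. \<Union>y\<in>V. tensor_class R S (pair_mult R S x y))"
  "\<one>\<^bsub>tensor_ring R S\<^esub> = tensor_class R S (frag_of (\<one>\<^bsub>R\<^esub>, \<one>\<^bsub>S\<^esub>))"
  "U \<oplus>\<^bsub>tensor_ring R S\<^esub> V = U \<otimes>\<^bsub>tensor_group R S\<^esub> V"
  "homog (tensor_ring R S) k = generate (tensor_group R S)
        {tensor_class R S (frag_of (r, s)) | r s. r \<in> homog R k \<and> s \<in> carrier S}"
  by (simp_all add: tensor_ring_def)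

abbreviation add_group :: "('a, 'm) ring_scheme \<Rightarrow> 'a monoid" where
  "add_group R \<equiv> \<lparr>carrier = carrier R, monoid.mult = add R, one = \<zero>\<^bsub>R\<^esub>\<rparr>"

text \<open>\<open>\<phi>\<close> presents the quotient of \<open>R\<close> by its doubles: by
  \<open>char2\<close> it kills doubles, and \<open>\<phi>_kernel\<close> says that it kills nothing
  else. The reduced product is a separate operation \<open>\<beta>\<close>, since later it is a
  matrix product and not the multiplication of the type \<open>'r\<close>.\<close>

locale mod2_reduction =
  fixes R :: "('a, 'm) graded_ring_scheme" and \<phi> :: "'a \<Rightarrow> 'r::comm_ring_1"
    and \<beta> :: "'r \<Rightarrow> 'r \<Rightarrow> 'r"
  assumes char2: "(2 :: 'r) = 0"
    and grp: "comm_group (add_group R)"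
    and mult_closed: "\<And>x y. x \<in> carrier R \<Longrightarrow> y \<in> carrier R \<Longrightarrow> x \<otimes>\<^bsub>R\<^esub> y \<in> carrier R"
    and one_closed: "\<one>\<^bsub>R\<^esub> \<in> carrier R"
    and homog_closed: "\<And>k. subgroup (homog R k) (add_group R)"
    and \<phi>_add: "\<And>x y. x \<in> carrier R \<Longrightarrow> y \<in> carrier R \<Longrightarrow> \<phi> (x \<oplus>\<^bsub>R\<^esub> y) = \<phi> x + \<phi> y"
    and \<phi>_kernel: "\<And>x. x \<in> carrier R \<Longrightarrow> \<phi> x = 0 \<Longrightarrow> \<exists>y\<in>carrier R. x = y \<oplus>\<^bsub>R\<^esub> y"
    and \<phi>_mult: "\<And>x y. x \<in> carrier R \<Longrightarrow> y \<in> carrier R \<Longrightarrow> \<phi> (x \<otimes>\<^bsub>R\<^esub> y) = \<beta> (\<phi> x) (\<phi> y)"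
    and \<beta>_add: "\<And>x y z. \<beta> (x + y) z = \<beta> x z + \<beta> y z" "\<And>x y z. \<beta> x (y + z) = \<beta> x y + \<beta> x z"

text \<open>\<open>\<kappa>\<close> is induced by sending the pair \<open>(r, s)\<close> to
  \<open>s\<close> times \<open>\<phi> r\<close>. Every class contains some generator
  \<open>(r, 1)\<close>, which gives the image. If \<open>\<phi> r = 0\<close>, then
  \<open>r\<close> is a double \<open>t \<oplus> t\<close>, and doubling can be moved to the second
  factor, where 1 + 1 = 0; this gives injectivity.\<close>

lemma (in mod2_reduction) tensor_mod2:
  defines "TR \<equiv> tensor_ring R Z2_ring"
  shows "\<exists>\<kappa>. bij_betw \<kappa> (carrier TR) (\<phi> ` carrier R)
    \<and> (\<forall>U\<in>carrier TR. \<forall>V\<in>carrier TR. U \<otimes>\<^bsub>TR\<^esub> V \<in> carrier TR \<and> \<kappa> (U \<otimes>\<^bsub>TR\<^esub> V) = \<beta> (\<kappa> U) (\<kappa> V))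
    \<and> (\<forall>U\<in>carrier TR. \<forall>V\<in>carrier TR. U \<oplus>\<^bsub>TR\<^esub> V \<in> carrier TR \<and> \<kappa> (U \<oplus>\<^bsub>TR\<^esub> V) = \<kappa> U + \<kappa> V)
    \<and> \<one>\<^bsub>TR\<^esub> \<in> carrier TR \<and> \<kappa> \<one>\<^bsub>TR\<^esub> = \<phi> \<one>\<^bsub>R\<^esub>
    \<and> (\<forall>k. homog TR k \<subseteq> carrier TR \<and> \<kappa> ` homog TR k = \<phi> ` homog R k)"
proof -
  interpret R: comm_group "add_group R" by (rule grp)
  define F where "F = free_Abelian_group (carrier R \<times> carrier Z2_ring)"
  define N where "N = tensor_relations R Z2_ring"
  define cls where "cls = tensor_class R Z2_ring"
  define K where "K = lin_ext (\<lambda>(r, s). of_int s * \<phi> r)"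
  have F: "x \<in> carrier F \<longleftrightarrow> keys x \<subseteq> carrier R \<times> {0, 1}" for x
    by (simp add: F_def)
  have F_diff: "x \<in> carrier F \<Longrightarrow> y \<in> carrier F \<Longrightarrow> x - y \<in> carrier F" for x y
    using keys_diff[of x y] unfolding F by blast
  have F_of [simp]: "frag_of (r, s) \<in> carrier F \<longleftrightarrow> r \<in> carrier R \<and> s \<in> {0, 1}" for r s
    by (auto simp: F)
  define G where "G = {frag_of (r \<oplus>\<^bsub>R\<^esub> r', s) - frag_of (r, s) - frag_of (r', s) | r r' s.
         r \<in> carrier R \<and> r' \<in> carrier R \<and> s \<in> carrier Z2_ring} \<union>
      {frag_of (r, s \<oplus>\<^bsub>Z2_ring\<^esub> s') - frag_of (r, s) - frag_of (r, s') | r s s'.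
         r \<in> carrier R \<and> s \<in> carrier Z2_ring \<and> s' \<in> carrier Z2_ring}"
  have radd [simp]: "r \<in> carrier R \<Longrightarrow> r' \<in> carrier R \<Longrightarrow> r \<oplus>\<^bsub>R\<^esub> r' \<in> carrier R" for r r'
    using R.m_closed by simp
  have G_F: "G \<subseteq> carrier F"
    by (auto simp: G_def intro!: F_diff)
  have N_gen: "N = generate F G"
    by (simp add: N_def F_def tensor_relations_def G_def)
  have N_sub: "subgroup N F"
    using G_F unfolding N_gen F_def by (rule generate_free_subgroup)
  note N_sub' = N_sub[unfolded F_def]
  have cls_def': "cls x = N #>\<^bsub>F\<^esub> x" for x
    by (simp add: cls_def tensor_class_def N_def F_def)
  have cls_eq: "cls x = cls y \<longleftrightarrow> x - y \<in> N" for x y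
    unfolding cls_def' F_def by (rule free_coset_eq_iff[OF N_sub'])
  have cls_mem: "y \<in> cls x \<longleftrightarrow> y - x \<in> N" for x y
    unfolding cls_def' F_def by (rule free_coset_iff[OF N_sub'])
  have NF: "x \<in> N \<Longrightarrow> x \<in> carrier F" for x
    using subgroup.mem_carrier[OF N_sub] .
  have K_diff [simp]: "K (x - y) = K x - K y" and K_minus [simp]: "K (- x) = - K x" and K_add [simp]: "K (x + y) = K x + K y"
    and K_of [simp]: "K (frag_of (r, s)) = of_int s * \<phi> r" for x y r s
    by (auto simp: K_def)
  have dbl: "a + a = 0" for a :: 'r
    using char2 by (metis mult_2 mult_zero_left)
  have neg: "a - b = a + b" for a b :: 'r
    using dbl[of b] by (metis add_diff_cancel_right' add.assoc add_0_right)
  have K_N: "K x = 0" if "x \<in> N" for x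
  proof -
    have "K g = 0" if "g \<in> G" for g
      using that dbl unfolding G_def by (auto simp del: diff_diff_eq simp: \<phi>_add)
    then show ?thesis
      using lin_ext_generate_0[OF that[unfolded N_gen F_def] G_F[unfolded F_def]] unfolding K_def by blast
  qed
  have rel1: "frag_of (r \<oplus>\<^bsub>R\<^esub> r', s) - frag_of (r, s) - frag_of (r', s) \<in> N"
    if "r \<in> carrier R" "r' \<in> carrier R" "s \<in> {0, 1}" for r r' s
    unfolding N_gen using that by (intro generate.incl) (auto simp: G_def)
  have rel2: "frag_of (r, (s + s') mod 2) - frag_of (r, s) - frag_of (r, s') \<in> N"
    if "r \<in> carrier R" "s' \<in> {0, 1}" "s \<in> {0, 1}" for r s s'
    unfolding N_gen using that by (intro generate.incl) (simp add: G_def, blast)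
  have N_diff: "x \<in> N \<Longrightarrow> y \<in> N \<Longrightarrow> x - y \<in> N" and N_add: "x \<in> N \<Longrightarrow> y \<in> N \<Longrightarrow> x + y \<in> N"
    and N_minus: "x \<in> N \<Longrightarrow> - x \<in> N" and N_0: "0 \<in> N" for x y
    using free_subgroup_diff[OF N_sub'] free_subgroup_add[OF N_sub'] free_subgroup_minus[OF N_sub']
      free_subgroup_0[OF N_sub'] by auto
  have r0: "frag_of (r, 0) \<in> N" if "r \<in> carrier R" for r
    using N_minus[OF rel2[OF that, of 0 0]] by simp
  have normal_form: "\<exists>r\<in>carrier R. x - frag_of (r, 1) \<in> N" if "x \<in> carrier F" for x
    using that unfolding F
  proof (induction x rule: frag_induction)
    case zero
    have "\<zero>\<^bsub>R\<^esub> \<in> carrier R" "\<zero>\<^bsub>R\<^esub> \<oplus>\<^bsub>R\<^esub> \<zero>\<^bsub>R\<^esub> = \<zero>\<^bsub>R\<^esub>" using R.one_closed R.r_one[of "\<zero>\<^bsub>R\<^esub>"] by simp_all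
    then show ?case using rel1[of "\<zero>\<^bsub>R\<^esub>" "\<zero>\<^bsub>R\<^esub>" 1] by (intro bexI[of _ "\<zero>\<^bsub>R\<^esub>"]) auto
  next
    case (one p)
    then obtain r s where p: "p = (r, s)" "r \<in> carrier R" "s = 0 \<or> s = 1" by auto
    have "\<zero>\<^bsub>R\<^esub> \<in> carrier R" "\<zero>\<^bsub>R\<^esub> \<oplus>\<^bsub>R\<^esub> \<zero>\<^bsub>R\<^esub> = \<zero>\<^bsub>R\<^esub>" using R.one_closed R.r_one[of "\<zero>\<^bsub>R\<^esub>"] by simp_all
    then have *: "\<zero>\<^bsub>R\<^esub> \<in> carrier R" "- frag_of (\<zero>\<^bsub>R\<^esub>, 1) \<in> N" using rel1[of "\<zero>\<^bsub>R\<^esub>" "\<zero>\<^bsub>R\<^esub>" 1] by auto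
    show ?case
    proof (cases "s = 0")
      case True
      then show ?thesis using p * N_add[OF r0[OF p(2)] *(2)] by auto
    next
      case False
      then show ?thesis using p N_0 by (intro bexI[of _ r]) auto
    qed
  next
    case (diff x y)
    then obtain r r' where r: "r \<in> carrier R" "x - frag_of (r, 1) \<in> N" "r' \<in> carrier R" "y - frag_of (r', 1) \<in> N"
      by blast
    define d where "d = r \<oplus>\<^bsub>R\<^esub> inv\<^bsub>add_group R\<^esub> r'"
    have inv: "inv\<^bsub>add_group R\<^esub> r' \<in> carrier R" using R.inv_closed[of r'] r by simp
    then have d: "d \<in> carrier R" unfolding d_def using r by simp
    have "d \<oplus>\<^bsub>R\<^esub> r' = r"
      using R.m_assoc[of r "inv\<^bsub>add_group R\<^esub> r'" r'] R.l_inv[of r'] R.r_one[of r] r inv by (simp add: d_def)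
    then have "frag_of (r, 1) - frag_of (d, 1) - frag_of (r', 1) \<in> N" using rel1[of d r' 1] d r by simp
    from N_add[OF this N_diff[OF r(2) r(4)]] have "x - y - frag_of (d, 1) \<in> N" by (simp add: algebra_simps)
    then show ?case using d by blast
  qed
  have K_kernel: "x \<in> N" if x: "x \<in> carrier F" "K x = 0" for x
  proof -
    obtain r where r: "r \<in> carrier R" "x - frag_of (r, 1) \<in> N" using normal_form[OF x(1)] by blast
    have "\<phi> r = 0" using K_N[OF r(2)] x(2) by simp
    then obtain t where t: "t \<in> carrier R" "r = t \<oplus>\<^bsub>R\<^esub> t" using \<phi>_kernel r(1) by blast
    have 1: "frag_of (r, 1) - frag_of (t, 1) - frag_of (t, 1) \<in> N" using rel1[of t t 1] t by simp
    \<comment> \<open>1 + 1 = 0 in the residue ring, so twice \<open>(t, 1)\<close> is congruent to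
      \<open>(t, 0)\<close>, which lies in \<open>N\<close> by \<open>r0\<close>.\<close>
    have 2: "frag_of (t, 0) - frag_of (t, 1) - frag_of (t, 1) \<in> N" using rel2[of t 1 1] t by simp
    have "x = x - frag_of (r, 1) + (frag_of (r, 1) - frag_of (t, 1) - frag_of (t, 1))
      - (frag_of (t, 0) - frag_of (t, 1) - frag_of (t, 1)) + frag_of (t, 0)"
      by (simp add: algebra_simps)
    also have "\<dots> \<in> N" using N_add[OF N_diff[OF N_add[OF r(2) 1] 2] r0[OF t(1)]] .
    finally show ?thesis .
  qed
  have cls_K: "cls x = cls y \<longleftrightarrow> K x = K y" if "x \<in> carrier F" "y \<in> carrier F" for x y
    using cls_eq[of x y] K_N[of "x - y"] K_kernel[of "x - y"] F_diff[OF that] by auto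
  have \<beta>0: "\<beta> 0 z = 0" "\<beta> z 0 = 0" for z
    using \<beta>_add(1)[of 0 0 z] \<beta>_add(2)[of z 0 0] by auto
  have \<beta>_diff: "\<beta> (x - y) z = \<beta> x z - \<beta> y z" "\<beta> z (x - y) = \<beta> z x - \<beta> z y" for x y z
    by (simp_all add: neg \<beta>_add)
  have pair: "pair_mult R Z2_ring x y \<in> carrier F \<and> K (pair_mult R Z2_ring x y) = \<beta> (K x) (K y)"
    if "x \<in> carrier F" "y \<in> carrier F" for x y
    using that(1) unfolding F
  proof (induction x rule: frag_induction)
    case zero
    then show ?case by (simp add: pair_mult_def K_def \<beta>0)
  next
    case (diff a b)
    then show ?case
      using keys_diff[of "pair_mult R Z2_ring a y" "pair_mult R Z2_ring b y"]
      by (auto simp: pair_mult_def frag_extend_diff \<beta>_diff)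
  next
    case (one p)
    then obtain r s where p: "p = (r, s)" "r \<in> carrier R" "s = 0 \<or> s = 1" by auto
    show ?case using that(2) unfolding F
    proof (induction y rule: frag_induction)
      case zero
      then show ?case using p by (simp add: pair_mult_def K_def \<beta>0)
    next
      case (diff a b)
      then show ?case
        using keys_diff[of "pair_mult R Z2_ring (frag_of p) a" "pair_mult R Z2_ring (frag_of p) b"] p
        by (auto simp: pair_mult_def frag_extend_diff \<beta>_diff)
    next
      case (one q)
      then obtain r' s' where q: "q = (r', s')" "r' \<in> carrier R" "s' = 0 \<or> s' = 1" by auto
      show ?case using p q by (auto simp: pair_mult_def \<phi>_mult \<beta>0 mult_closed)
    qed
  qed
  have car: "carrier TR = cls ` carrier F"
    by (auto simp: TR_def tensor_ring_def tensor_group_def FactGroup_def RCOSETS_def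
        cls_def tensor_class_def N_def F_def)
  define \<kappa> where "\<kappa> U = K (SOME x. x \<in> carrier F \<and> cls x = U)" for U
  have \<kappa>: "\<kappa> (cls x) = K x" if "x \<in> carrier F" for x
  proof -
    have "(SOME y. y \<in> carrier F \<and> cls y = cls x) \<in> carrier F \<and> cls (SOME y. y \<in> carrier F \<and> cls y = cls x) = cls x"
      by (rule someI) (use that in auto)
    then show ?thesis unfolding \<kappa>_def using cls_K that by blast
  qed
  have tmult: "cls x \<otimes>\<^bsub>TR\<^esub> cls y = cls (pair_mult R Z2_ring x y)"
    if "x \<in> carrier F" "y \<in> carrier F" for x y
  proof -
    have "cls (pair_mult R Z2_ring x' y') = cls (pair_mult R Z2_ring x y)"
      if "x' \<in> cls x" "y' \<in> cls y" for x' y'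
    proof -
      have "x' - x \<in> N" "y' - y \<in> N" using that cls_mem by auto
      then have "x' - x \<in> carrier F" "y' - y \<in> carrier F" "K x' = K x" "K y' = K y"
        using NF K_N[of "x' - x"] K_N[of "y' - y"] by auto
      then have "x' \<in> carrier F" "y' \<in> carrier F"
        using \<open>x \<in> carrier F\<close> \<open>y \<in> carrier F\<close> keys_add[of "x' - x" x] keys_add[of "y' - y" y]
        unfolding F by auto
      then show ?thesis
        using pair[of x' y'] pair[of x y] cls_K that \<open>x \<in> carrier F\<close> \<open>y \<in> carrier F\<close> \<open>K x' = K x\<close> \<open>K y' = K y\<close>
        by simp
    qed
    moreover have "x \<in> cls x" "y \<in> cls y" using cls_mem N_0 by auto
    ultimately have "(\<Union>x'\<in>cls x. \<Union>y'\<in>cls y. cls (pair_mult R Z2_ring x' y')) = cls (pair_mult R Z2_ring x y)"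
      by (intro UN_UN_eq)
    then show ?thesis unfolding TR_def cls_def tensor_ring_simps .
  qed
  have F_add: "x \<in> carrier F \<Longrightarrow> y \<in> carrier F \<Longrightarrow> x + y \<in> carrier F" for x y
    using keys_add[of x y] unfolding F by blast
  have tadd: "cls x \<oplus>\<^bsub>TR\<^esub> cls y = cls (x + y)" if "x \<in> carrier F" "y \<in> carrier F" for x y
    using free_quotient_mult[OF N_sub', of x y] that
    unfolding TR_def tensor_ring_simps tensor_group_def cls_def' F_def N_def[symmetric] by blast
  have tone: "\<one>\<^bsub>TR\<^esub> = cls (frag_of (\<one>\<^bsub>R\<^esub>, 1))"
    unfolding TR_def tensor_ring_simps cls_def by simp
  have "bij_betw \<kappa> (carrier TR) (\<phi> ` carrier R)"
  proof (rule bij_betw_imageI)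
    show "inj_on \<kappa> (carrier TR)" unfolding car inj_on_def by (simp add: \<kappa> cls_K)
    have "K x \<in> \<phi> ` carrier R" if "x \<in> carrier F" for x
    proof -
      obtain r where "r \<in> carrier R" "x - frag_of (r, 1) \<in> N" using normal_form \<open>x \<in> carrier F\<close> by blast
      then show ?thesis using K_N[of "x - frag_of (r, 1)"] by simp
    qed
    moreover have "\<phi> r \<in> \<kappa> ` carrier TR" if "r \<in> carrier R" for r
    proof -
      have "\<kappa> (cls (frag_of (r, 1))) = \<phi> r" using that by (simp add: \<kappa>)
      then show ?thesis unfolding car using that F_of by (metis image_eqI insertCI)
    qed
    ultimately show "\<kappa> ` carrier TR = \<phi> ` carrier R" unfolding car by (auto simp: \<kappa>)
  qed
  moreover have "U \<otimes>\<^bsub>TR\<^esub> V \<in> carrier TR \<and> \<kappa> (U \<otimes>\<^bsub>TR\<^esub> V) = \<beta> (\<kappa> U) (\<kappa> V)"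
    if "U \<in> carrier TR" "V \<in> carrier TR" for U V
    using that unfolding car by (auto simp: tmult \<kappa> pair)
  moreover have "U \<oplus>\<^bsub>TR\<^esub> V \<in> carrier TR \<and> \<kappa> (U \<oplus>\<^bsub>TR\<^esub> V) = \<kappa> U + \<kappa> V"
    if "U \<in> carrier TR" "V \<in> carrier TR" for U V
    using that unfolding car by (auto simp: tadd \<kappa> F_add)
  moreover have "\<one>\<^bsub>TR\<^esub> \<in> carrier TR \<and> \<kappa> \<one>\<^bsub>TR\<^esub> = \<phi> \<one>\<^bsub>R\<^esub>"
    unfolding tone car using one_closed by (simp add: \<kappa>)
  moreover have "homog TR k \<subseteq> carrier TR \<and> \<kappa> ` homog TR k = \<phi> ` homog R k" for k
  proof -
    have sub: "homog R k \<subseteq> carrier R" using subgroup.subset[OF homog_closed] by simp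
    define X where "X = {cls (frag_of (r, s)) | r s. r \<in> homog R k \<and> s \<in> {0, 1}}"
    have homog: "homog TR k = generate (F Mod N) X"
      unfolding TR_def tensor_ring_simps X_def cls_def tensor_group_def N_def F_def by simp
    have "X \<subseteq> carrier TR" unfolding X_def car using sub by auto
    have carM: "carrier (F Mod N) = carrier TR" unfolding TR_def tensor_ring_simps tensor_group_def N_def F_def ..
    have grpM: "group (F Mod N)"
      using normal.factorgroup_is_group[OF free_subgroup_normal[OF N_sub']] by (simp add: F_def)
    have subT: "homog TR k \<subseteq> carrier TR"
      unfolding homog using group.generate_incl[OF grpM, of X] \<open>X \<subseteq> carrier TR\<close> carM by simp
    have h0: "0 \<in> \<phi> ` homog R k"
    proof -
      have z: "\<zero>\<^bsub>R\<^esub> \<in> homog R k" using subgroup.one_closed[OF homog_closed] by simp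
      moreover from this have zc: "\<zero>\<^bsub>R\<^esub> \<in> carrier R" using sub by auto
      have "\<phi> (\<zero>\<^bsub>R\<^esub> \<oplus>\<^bsub>R\<^esub> \<zero>\<^bsub>R\<^esub>) = \<phi> \<zero>\<^bsub>R\<^esub> + \<phi> \<zero>\<^bsub>R\<^esub>" "\<zero>\<^bsub>R\<^esub> \<oplus>\<^bsub>R\<^esub> \<zero>\<^bsub>R\<^esub> = \<zero>\<^bsub>R\<^esub>"
        using \<phi>_add[OF zc zc] R.r_one[of "\<zero>\<^bsub>R\<^esub>"] zc by simp_all
      ultimately show ?thesis by force
    qed
    have hadd: "a + b \<in> \<phi> ` homog R k" if "a \<in> \<phi> ` homog R k" "b \<in> \<phi> ` homog R k" for a b
    proof -
      obtain x y where "x \<in> homog R k" "y \<in> homog R k" "a = \<phi> x" "b = \<phi> y"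
        using \<open>a \<in> _\<close> \<open>b \<in> _\<close> by blast
      then show ?thesis using subgroup.m_closed[OF homog_closed, of x k y] sub
        by (auto intro!: image_eqI[of _ \<phi> "x \<oplus>\<^bsub>R\<^esub> y"] simp: \<phi>_add subset_iff)
    qed
    have X_\<phi>: "\<kappa> U \<in> \<phi> ` homog R k" if "U \<in> X" for U
      using that sub h0 unfolding X_def by (auto simp: \<kappa>)
    have \<kappa>_mult: "\<kappa> (U \<otimes>\<^bsub>F Mod N\<^esub> V) = \<kappa> U + \<kappa> V" if "U \<in> carrier TR" "V \<in> carrier TR" for U V
    proof -
      have "U \<otimes>\<^bsub>F Mod N\<^esub> V = U \<oplus>\<^bsub>TR\<^esub> V"
        unfolding TR_def tensor_ring_simps tensor_group_def N_def F_def ..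
      then show ?thesis using that unfolding car by (auto simp: tadd \<kappa> F_add)
    qed
    have M_one: "\<one>\<^bsub>F Mod N\<^esub> = cls 0" using cls_mem[of _ 0] by (auto simp: FactGroup_def)
    have 0: "0 \<in> carrier F" by (simp add: F)
    have "\<kappa> U \<in> \<phi> ` homog R k" if "U \<in> homog TR k" for U
      using that unfolding homog
    proof induction
      case one
      then show ?case unfolding M_one \<kappa>[OF 0] using h0 by (simp add: K_def)
    next
      case (inv U)
      interpret M: group "F Mod N" by (rule grpM)
      have U: "U \<in> carrier TR" using inv \<open>X \<subseteq> carrier TR\<close> by auto
      have "\<kappa> (inv\<^bsub>F Mod N\<^esub> U) + \<kappa> U = \<kappa> \<one>\<^bsub>F Mod N\<^esub>"
        using \<kappa>_mult[of "inv\<^bsub>F Mod N\<^esub> U" U] M.inv_closed[of U] M.l_inv[of U] U carM by simp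
      also have "\<dots> = 0" unfolding M_one \<kappa>[OF 0] by (simp add: K_def)
      \<comment> \<open>An element and its inverse have the same value in characteristic
        two.\<close>
      finally have "\<kappa> (inv\<^bsub>F Mod N\<^esub> U) = \<kappa> U" using dbl[of "\<kappa> U"] by (metis add_right_cancel)
      then show ?case using X_\<phi> inv by simp
    next
      case (eng U V)
      have "generate (F Mod N) X \<subseteq> carrier TR" using subT homog by simp
      then have "U \<in> carrier TR" "V \<in> carrier TR" using eng by auto
      then show ?case using \<kappa>_mult hadd eng.IH by simp
    qed (use X_\<phi> in auto)
    moreover have "\<phi> r \<in> \<kappa> ` homog TR k" if "r \<in> homog R k" for r
    proof -
      have "cls (frag_of (r, 1)) \<in> homog TR k" unfolding homog X_def using that by (intro generate.incl) auto
      moreover have "\<kappa> (cls (frag_of (r, 1))) = \<phi> r" using that sub by (subst \<kappa>) auto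
      ultimately show ?thesis by (metis image_eqI)
    qed
    ultimately have "\<kappa> ` homog TR k = \<phi> ` homog R k" by (intro equalityI image_subsetI)
    with subT show ?thesis ..
  qed
  ultimately show ?thesis by blast
qed

text \<open>Both tensor rings are in bijection with the same subset of \<open>'r\<close>, carrying
  the same addition and the same \<open>\<beta>\<close>; the isomorphism is \<open>\<kappa>\<close>
  followed by the inverse of \<open>\<theta>\<close>.\<close>

lemma graded_ring_iso_tensor_mod2:
  assumes R: "mod2_reduction R \<phi> \<beta>" and S: "mod2_reduction S \<psi> \<beta>"
    and car: "\<phi> ` carrier R = \<psi> ` carrier S" and one: "\<phi> \<one>\<^bsub>R\<^esub> = \<psi> \<one>\<^bsub>S\<^esub>"
    and hom: "\<And>k. \<phi> ` homog R k = \<psi> ` homog S k"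
  shows "\<exists>h. h \<in> graded_ring_iso (tensor_ring R Z2_ring) (tensor_ring S Z2_ring)"
proof -
  define X where "X = tensor_ring R Z2_ring"
  define Y where "Y = tensor_ring S Z2_ring"
  obtain \<kappa> where \<kappa>: "bij_betw \<kappa> (carrier X) (\<phi> ` carrier R)"
    "\<forall>U\<in>carrier X. \<forall>V\<in>carrier X. U \<otimes>\<^bsub>X\<^esub> V \<in> carrier X \<and> \<kappa> (U \<otimes>\<^bsub>X\<^esub> V) = \<beta> (\<kappa> U) (\<kappa> V)"
    "\<forall>U\<in>carrier X. \<forall>V\<in>carrier X. U \<oplus>\<^bsub>X\<^esub> V \<in> carrier X \<and> \<kappa> (U \<oplus>\<^bsub>X\<^esub> V) = \<kappa> U + \<kappa> V"
    "\<one>\<^bsub>X\<^esub> \<in> carrier X \<and> \<kappa> \<one>\<^bsub>X\<^esub> = \<phi> \<one>\<^bsub>R\<^esub>"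
    "\<forall>k. homog X k \<subseteq> carrier X \<and> \<kappa> ` homog X k = \<phi> ` homog R k"
    using mod2_reduction.tensor_mod2[OF R, folded X_def]
    by (elim exE) (rule that; elim conjE; (intro conjI)?; assumption)
  obtain \<theta> where \<theta>: "bij_betw \<theta> (carrier Y) (\<psi> ` carrier S)"
    "\<forall>U\<in>carrier Y. \<forall>V\<in>carrier Y. U \<otimes>\<^bsub>Y\<^esub> V \<in> carrier Y \<and> \<theta> (U \<otimes>\<^bsub>Y\<^esub> V) = \<beta> (\<theta> U) (\<theta> V)"
    "\<forall>U\<in>carrier Y. \<forall>V\<in>carrier Y. U \<oplus>\<^bsub>Y\<^esub> V \<in> carrier Y \<and> \<theta> (U \<oplus>\<^bsub>Y\<^esub> V) = \<theta> U + \<theta> V"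
    "\<one>\<^bsub>Y\<^esub> \<in> carrier Y \<and> \<theta> \<one>\<^bsub>Y\<^esub> = \<psi> \<one>\<^bsub>S\<^esub>"
    "\<forall>k. homog Y k \<subseteq> carrier Y \<and> \<theta> ` homog Y k = \<psi> ` homog S k"
    using mod2_reduction.tensor_mod2[OF S, folded Y_def]
    by (elim exE) (rule that; elim conjE; (intro conjI)?; assumption)
  define h where "h U = inv_into (carrier Y) \<theta> (\<kappa> U)" for U
  have inj: "inj_on \<theta> (carrier Y)" using \<theta>(1) by (rule bij_betw_imp_inj_on)
  have h: "h U \<in> carrier Y" "\<theta> (h U) = \<kappa> U" if "U \<in> carrier X" for U
  proof -
    have "\<kappa> U \<in> \<theta> ` carrier Y"
      using bij_betw_apply[OF \<kappa>(1) that] bij_betw_imp_surj_on[OF \<theta>(1)] car by simp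
    then show "h U \<in> carrier Y" "\<theta> (h U) = \<kappa> U"
      unfolding h_def by (rule inv_into_into, rule f_inv_into_f)
  qed
  have eq: "h U = V" if "U \<in> carrier X" "V \<in> carrier Y" "\<kappa> U = \<theta> V" for U V
    using inj_onD[OF inj, of "h U" V] h that by simp
  have cX: "U \<otimes>\<^bsub>X\<^esub> V \<in> carrier X" "U \<oplus>\<^bsub>X\<^esub> V \<in> carrier X"
    if "U \<in> carrier X" "V \<in> carrier X" for U V
    using \<kappa>(2,3) that by simp_all
  have cY: "U \<otimes>\<^bsub>Y\<^esub> V \<in> carrier Y" "U \<oplus>\<^bsub>Y\<^esub> V \<in> carrier Y"
    if "U \<in> carrier Y" "V \<in> carrier Y" for U V
    using \<theta>(2,3) that by simp_all
  have bij: "bij_betw h (carrier X) (carrier Y)"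
    using bij_betw_trans[OF \<kappa>(1), of "inv_into (carrier Y) \<theta>" "carrier Y"] bij_betw_inv_into[OF \<theta>(1)] car
    by (simp add: h_def[abs_def] comp_def)
  have mult: "h (U \<otimes>\<^bsub>X\<^esub> V) = h U \<otimes>\<^bsub>Y\<^esub> h V" if "U \<in> carrier X" "V \<in> carrier X" for U V
    by (rule eq[OF cX(1)[OF that] cY(1)[OF h(1) h(1)]]) (use that h \<kappa>(2) \<theta>(2) in simp_all)
  have add: "h (U \<oplus>\<^bsub>X\<^esub> V) = h U \<oplus>\<^bsub>Y\<^esub> h V" if "U \<in> carrier X" "V \<in> carrier X" for U V
    by (rule eq[OF cX(2)[OF that] cY(2)[OF h(1) h(1)]]) (use that h \<kappa>(3) \<theta>(3) in simp_all)
  have one: "h \<one>\<^bsub>X\<^esub> = \<one>\<^bsub>Y\<^esub>"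
    by (rule eq) (use \<kappa>(4) \<theta>(4) one in simp_all)
  have homog: "h ` homog X k = homog Y k" for k
  proof -
    have sub: "homog X k \<subseteq> carrier X" "homog Y k \<subseteq> carrier Y" using \<kappa>(5) \<theta>(5) by simp_all
    have "\<theta> ` h ` homog X k = \<kappa> ` homog X k"
      unfolding image_image by (rule image_cong) (use h(2) sub(1) in auto)
    then have "\<theta> ` h ` homog X k = \<theta> ` homog Y k" using \<kappa>(5) \<theta>(5) hom by simp
    moreover have "h ` homog X k \<subseteq> carrier Y" using h(1) sub(1) by auto
    ultimately show ?thesis using inj_on_image_eq_iff[OF inj] sub(2) by simp
  qed
  have "h \<in> graded_ring_iso X Y"
    unfolding graded_ring_iso_def ring_iso_def ring_hom_def
    using h(1) mult add one bij homog by simp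
  then show ?thesis unfolding X_def Y_def by blast
qed

section \<open>Reduction of arc rings\<close>

lemma finite_points [simp]: "finite (points n)"
  by (simp add: points_def)

lemma finite_B [simp]: "finite (B n)"
proof (rule finite_subset)
  show "B n \<subseteq> Pow (Pow (points n))"
    unfolding B_def partition_on_def by auto
qed auto

text \<open>\<open>arc_ring\<close> writes its groups multiplicatively, so the sum over the middle
  matching in a matrix product appears there as a \<open>finprod\<close>.\<close>

lemma (in comm_monoid) hom_finprod_sum:
  fixes \<phi> :: "'a \<Rightarrow> 'r::comm_monoid_add"
  assumes add: "\<And>x y. x \<in> carrier G \<Longrightarrow> y \<in> carrier G \<Longrightarrow> \<phi> (x \<otimes> y) = \<phi> x + \<phi> y"
    and one: "\<phi> \<one> = 0" and "finite I" "\<And>i. i \<in> I \<Longrightarrow> f i \<in> carrier G"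
  shows "\<phi> (finprod G f I) = (\<Sum>i\<in>I. \<phi> (f i))"
  using assms(3,4)
proof (induction I)
  case empty
  then show ?case by (simp add: one)
next
  case (insert i I)
  then show ?case
    by (subst finprod_insert) (auto simp: add Pi_iff)
qed

text \<open>The requirements of \<open>mod2_reduction\<close>, entry by entry:
  \<open>\<beta> c b a\<close> is the reduced product of an entry at \<open>(c, b)\<close> with one
  at \<open>(b, a)\<close>.\<close>

locale arc_ring_mod2 =
  fixes n :: nat and G :: "matching \<Rightarrow> matching \<Rightarrow> 'g monoid" and \<mu> u and D :: "matching \<Rightarrow> matching \<Rightarrow> int \<Rightarrow> 'g set"
    and \<phi> :: "matching \<Rightarrow> matching \<Rightarrow> 'g \<Rightarrow> 'r::comm_ring_1"
    and \<beta> :: "matching \<Rightarrow> matching \<Rightarrow> matching \<Rightarrow> 'r \<Rightarrow> 'r \<Rightarrow> 'r"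
  assumes char2: "(2 :: 'r) = 0"
    and grp: "\<And>b a. b \<in> B n \<Longrightarrow> a \<in> B n \<Longrightarrow> comm_group (G b a)"
    and \<mu>_closed: "\<And>c b a x y. c \<in> B n \<Longrightarrow> b \<in> B n \<Longrightarrow> a \<in> B n \<Longrightarrow>
      x \<in> carrier (G c b) \<Longrightarrow> y \<in> carrier (G b a) \<Longrightarrow> \<mu> c b a x y \<in> carrier (G c a)"
    and u_closed: "\<And>a. a \<in> B n \<Longrightarrow> u a \<in> carrier (G a a)"
    and D_sub: "\<And>b a k. b \<in> B n \<Longrightarrow> a \<in> B n \<Longrightarrow> subgroup (D b a k) (G b a)"
    and \<phi>_add: "\<And>b a x y. b \<in> B n \<Longrightarrow> a \<in> B n \<Longrightarrow> x \<in> carrier (G b a) \<Longrightarrow> y \<in> carrier (G b a) \<Longrightarrow>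
      \<phi> b a (x \<otimes>\<^bsub>G b a\<^esub> y) = \<phi> b a x + \<phi> b a y"
    and \<phi>_kernel: "\<And>b a x. b \<in> B n \<Longrightarrow> a \<in> B n \<Longrightarrow> x \<in> carrier (G b a) \<Longrightarrow> \<phi> b a x = 0 \<Longrightarrow>
      \<exists>y\<in>carrier (G b a). x = y \<otimes>\<^bsub>G b a\<^esub> y"
    and \<phi>_mult: "\<And>c b a x y. c \<in> B n \<Longrightarrow> b \<in> B n \<Longrightarrow> a \<in> B n \<Longrightarrow>
      x \<in> carrier (G c b) \<Longrightarrow> y \<in> carrier (G b a) \<Longrightarrow>
      \<phi> c a (\<mu> c b a x y) = \<beta> c b a (\<phi> c b x) (\<phi> b a y)"
    and \<beta>_add: "\<And>c b a x y z. \<beta> c b a (x + y) z = \<beta> c b a x z + \<beta> c b a y z"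
      "\<And>c b a x y z. \<beta> c b a x (y + z) = \<beta> c b a x y + \<beta> c b a x z"
begin

text \<open>The value 0 off \<open>B n \<times> B n\<close> keeps the map additive for the pointwise
  addition on the whole function type.\<close>

definition total_\<phi> :: "(matching \<times> matching \<Rightarrow> 'g) \<Rightarrow> matching \<times> matching \<Rightarrow> 'r" where
  "total_\<phi> x = (\<lambda>(b, a). if b \<in> B n \<and> a \<in> B n then \<phi> b a (x (b, a)) else 0)"

abbreviation "\<Sigma> \<equiv> sum_group (B n \<times> B n) (\<lambda>(b, a). G b a)"

abbreviation "R \<equiv> arc_ring n G \<mu> u D"

lemma groups: "i \<in> B n \<times> B n \<Longrightarrow> group ((\<lambda>(b, a). G b a) i)"
  using grp comm_group.axioms(2) by auto

text \<open>\<open>B n\<close> is finite, so the direct sum is the full product; entries can then be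
  chosen independently of each other.\<close>

lemma carrier_\<Sigma>: "carrier \<Sigma> = (\<Pi>\<^sub>E (b, a)\<in>B n \<times> B n. carrier (G b a))"
  using groups by (simp add: carrier_sum_group case_prod_unfold)

lemma carrier_\<Sigma>_D: "x \<in> carrier \<Sigma> \<Longrightarrow> b \<in> B n \<Longrightarrow> a \<in> B n \<Longrightarrow> x (b, a) \<in> carrier (G b a)"
  unfolding carrier_\<Sigma> by (auto simp: PiE_iff)

lemma R_simps:
  "carrier R = carrier \<Sigma>"
  "x \<otimes>\<^bsub>R\<^esub> y = (\<lambda>(c, a)\<in>B n \<times> B n. finprod (G c a) (\<lambda>b. \<mu> c b a (x (c, b)) (y (b, a))) (B n))"
  "\<one>\<^bsub>R\<^esub> = (\<lambda>(b, a)\<in>B n \<times> B n. if b = a then u a else \<one>\<^bsub>G b a\<^esub>)"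
  "x \<oplus>\<^bsub>R\<^esub> y = x \<otimes>\<^bsub>\<Sigma>\<^esub> y"
  "\<zero>\<^bsub>R\<^esub> = \<one>\<^bsub>\<Sigma>\<^esub>"
  "homog R k = {x \<in> carrier \<Sigma>. \<forall>b\<in>B n. \<forall>a\<in>B n. x (b, a) \<in> D b a k}"
  by (simp_all add: arc_ring_def Let_def)

lemma \<phi>_one: "b \<in> B n \<Longrightarrow> a \<in> B n \<Longrightarrow> \<phi> b a \<one>\<^bsub>G b a\<^esub> = 0"
  using \<phi>_add[of b a "\<one>\<^bsub>G b a\<^esub>" "\<one>\<^bsub>G b a\<^esub>"] grp[of b a]
  by (simp add: comm_group_def comm_monoid_def)

lemma mult_entry_closed:
  assumes "x \<in> carrier \<Sigma>" "y \<in> carrier \<Sigma>" "c \<in> B n" "a \<in> B n" "b \<in> B n"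
  shows "\<mu> c b a (x (c, b)) (y (b, a)) \<in> carrier (G c a)"
  using assms \<mu>_closed carrier_\<Sigma>_D by blast

lemma comm_group_\<Sigma>: "comm_group \<Sigma>"
proof (rule group.group_comm_groupI)
  show "group \<Sigma>" using groups by simp
  fix x y assume xy: "x \<in> carrier \<Sigma>" "y \<in> carrier \<Sigma>"
  have "x (b, a) \<otimes>\<^bsub>G b a\<^esub> y (b, a) = y (b, a) \<otimes>\<^bsub>G b a\<^esub> x (b, a)" if "b \<in> B n" "a \<in> B n" for b a
    using comm_monoid.m_comm[OF comm_group.axioms(1)[OF grp[OF that]]] carrier_\<Sigma>_D[OF _ that] xy by simp
  then show "x \<otimes>\<^bsub>\<Sigma>\<^esub> y = y \<otimes>\<^bsub>\<Sigma>\<^esub> x" by (auto intro!: restrict_ext)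
qed

text \<open>Everything is checked entrywise. A matrix that reduces to zero is halved by choosing a
  half of each entry.\<close>

lemma mod2_reduction:
  "mod2_reduction R total_\<phi> (\<lambda>X Y (c, a). if c \<in> B n \<and> a \<in> B n
     then \<Sum>b\<in>B n. \<beta> c b a (X (c, b)) (Y (b, a)) else 0)"
proof (rule mod2_reduction.intro)
  show "(2 :: matching \<times> matching \<Rightarrow> 'r) = 0"
    using char2 by (auto simp: fun_eq_iff)
  have add_group: "add_group R = \<Sigma>"
    by (simp add: arc_ring_def Let_def)
  then show "comm_group (add_group R)" using comm_group_\<Sigma> by simp
  show "x \<otimes>\<^bsub>R\<^esub> y \<in> carrier R" if "x \<in> carrier R" "y \<in> carrier R" for x y
  proof -
    have "finprod (G c a) (\<lambda>b. \<mu> c b a (x (c, b)) (y (b, a))) (B n) \<in> carrier (G c a)"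
      if "c \<in> B n" "a \<in> B n" for c a
      using mult_entry_closed \<open>x \<in> _\<close> \<open>y \<in> _\<close> that
      by (intro comm_monoid.finprod_closed comm_group.axioms(1) grp) (auto simp: R_simps)
    then show ?thesis unfolding R_simps carrier_\<Sigma> by (auto simp: case_prod_unfold)
  qed
  show "\<one>\<^bsub>R\<^esub> \<in> carrier R"
    using u_closed groups unfolding R_simps carrier_\<Sigma>
    by (auto intro!: monoid.one_closed group.is_monoid)
  show "subgroup (homog R k) (add_group R)" for k
    unfolding add_group
  proof (rule group.subgroupI)
    show "group \<Sigma>" using groups by simp
    show "homog R k \<subseteq> carrier \<Sigma>" by (auto simp: R_simps)
    have "\<one>\<^bsub>\<Sigma>\<^esub> \<in> homog R k"
      using subgroup.one_closed[OF D_sub] monoid.one_closed[OF group.is_monoid[OF \<open>group \<Sigma>\<close>]]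
      by (simp add: R_simps)
    then show "homog R k \<noteq> {}" by auto
    show "inv\<^bsub>\<Sigma>\<^esub> x \<in> homog R k" if "x \<in> homog R k" for x
    proof -
      have x: "x \<in> carrier \<Sigma>" using that by (simp add: R_simps)
      then have "inv\<^bsub>\<Sigma>\<^esub> x \<in> carrier \<Sigma>" by (rule group.inv_closed[OF \<open>group \<Sigma>\<close>])
      moreover have "(inv\<^bsub>\<Sigma>\<^esub> x) (b, a) \<in> D b a k" if "b \<in> B n" "a \<in> B n" for b a
        using \<open>x \<in> homog R k\<close> subgroup.m_inv_closed[OF D_sub] that inv_sum_group[OF groups x]
        by (simp add: R_simps)
      ultimately show ?thesis by (simp add: R_simps)
    qed
    show "x \<otimes>\<^bsub>\<Sigma>\<^esub> y \<in> homog R k" if "x \<in> homog R k" "y \<in> homog R k" for x y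
    proof -
      have x: "x \<in> carrier \<Sigma>" "y \<in> carrier \<Sigma>" using that by (simp_all add: R_simps)
      then have "x \<otimes>\<^bsub>\<Sigma>\<^esub> y \<in> carrier \<Sigma>" by (rule monoid.m_closed[OF group.is_monoid[OF \<open>group \<Sigma>\<close>]])
      moreover have "(x \<otimes>\<^bsub>\<Sigma>\<^esub> y) (b, a) \<in> D b a k" if "b \<in> B n" "a \<in> B n" for b a
        using \<open>x \<in> homog R k\<close> \<open>y \<in> homog R k\<close> subgroup.m_closed[OF D_sub] that
        by (simp add: R_simps)
      ultimately show ?thesis by (simp add: R_simps)
    qed
  qed
  show "total_\<phi> (x \<oplus>\<^bsub>R\<^esub> y) = total_\<phi> x + total_\<phi> y" if "x \<in> carrier R" "y \<in> carrier R" for x y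
    using that by (auto simp: total_\<phi>_def R_simps fun_eq_iff \<phi>_add carrier_\<Sigma>_D)
  show "\<exists>y\<in>carrier R. x = y \<oplus>\<^bsub>R\<^esub> y" if "x \<in> carrier R" "total_\<phi> x = 0" for x
  proof -
    have "\<forall>i\<in>B n \<times> B n. \<exists>y. y \<in> carrier (G (fst i) (snd i)) \<and> x i = y \<otimes>\<^bsub>G (fst i) (snd i)\<^esub> y"
    proof clarify
      fix b a assume "b \<in> B n" "a \<in> B n"
      then have "\<phi> b a (x (b, a)) = 0" using fun_cong[OF that(2), of "(b, a)"] by (simp add: total_\<phi>_def)
      then show "\<exists>y. y \<in> carrier (G (fst (b, a)) (snd (b, a))) \<and> x (b, a) = y \<otimes>\<^bsub>G (fst (b, a)) (snd (b, a))\<^esub> y"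
        using \<phi>_kernel[of b a "x (b, a)"] \<open>b \<in> B n\<close> \<open>a \<in> B n\<close> that(1) carrier_\<Sigma>_D by (fastforce simp: R_simps)
    qed
    then obtain y where y: "\<And>i. i \<in> B n \<times> B n \<Longrightarrow>
        y i \<in> carrier (G (fst i) (snd i)) \<and> x i = y i \<otimes>\<^bsub>G (fst i) (snd i)\<^esub> y i"
      by metis
    have "restrict y (B n \<times> B n) \<in> carrier R"
      using y unfolding R_simps carrier_\<Sigma> by (auto simp: case_prod_unfold)
    moreover have "x = restrict y (B n \<times> B n) \<oplus>\<^bsub>R\<^esub> restrict y (B n \<times> B n)"
    proof
      fix i
      show "x i = (restrict y (B n \<times> B n) \<oplus>\<^bsub>R\<^esub> restrict y (B n \<times> B n)) i"
        using y[of i] PiE_arb[OF that(1)[unfolded R_simps carrier_\<Sigma>], of i]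
        by (cases "i \<in> B n \<times> B n") (auto simp: R_simps case_prod_unfold)
    qed
    ultimately show ?thesis by blast
  qed
  show "total_\<phi> (x \<otimes>\<^bsub>R\<^esub> y) = (\<lambda>(c, a). if c \<in> B n \<and> a \<in> B n
     then \<Sum>b\<in>B n. \<beta> c b a (total_\<phi> x (c, b)) (total_\<phi> y (b, a)) else 0)"
    if "x \<in> carrier R" "y \<in> carrier R" for x y
  proof (rule ext, clarify)
    fix c a
    have "\<phi> c a (finprod (G c a) (\<lambda>b. \<mu> c b a (x (c, b)) (y (b, a))) (B n)) =
      (\<Sum>b\<in>B n. \<beta> c b a (\<phi> c b (x (c, b))) (\<phi> b a (y (b, a))))" if "c \<in> B n" "a \<in> B n"
    proof -
      interpret comm_group "G c a" using grp that .
      have "\<phi> c a (finprod (G c a) (\<lambda>b. \<mu> c b a (x (c, b)) (y (b, a))) (B n)) =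
        (\<Sum>b\<in>B n. \<phi> c a (\<mu> c b a (x (c, b)) (y (b, a))))"
        using that \<open>x \<in> carrier R\<close> \<open>y \<in> carrier R\<close>
        by (intro hom_finprod_sum \<phi>_add \<phi>_one mult_entry_closed) (auto simp: R_simps)
      also have "\<dots> = (\<Sum>b\<in>B n. \<beta> c b a (\<phi> c b (x (c, b))) (\<phi> b a (y (b, a))))"
        using that \<open>x \<in> carrier R\<close> \<open>y \<in> carrier R\<close> carrier_\<Sigma>_D
        by (intro sum.cong \<phi>_mult) (auto simp: R_simps)
      finally show ?thesis .
    qed
    then show "total_\<phi> (x \<otimes>\<^bsub>R\<^esub> y) (c, a) = (if c \<in> B n \<and> a \<in> B n
     then \<Sum>b\<in>B n. \<beta> c b a (total_\<phi> x (c, b)) (total_\<phi> y (b, a)) else 0)"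
      by (simp add: total_\<phi>_def R_simps)
  qed
qed (auto simp: fun_eq_iff \<beta>_add sum.distrib)

lemma total_\<phi>_one: "total_\<phi> \<one>\<^bsub>R\<^esub> = (\<lambda>(b, a). if b \<in> B n \<and> b = a then \<phi> a a (u a) else 0)"
  using \<phi>_one by (auto simp: total_\<phi>_def R_simps fun_eq_iff)

lemma total_\<phi>_image:
  assumes "\<And>b a. b \<in> B n \<Longrightarrow> a \<in> B n \<Longrightarrow> E b a \<subseteq> carrier (G b a)"
  shows "total_\<phi> ` {x \<in> carrier \<Sigma>. \<forall>b\<in>B n. \<forall>a\<in>B n. x (b, a) \<in> E b a} =
    {X. \<forall>b a. X (b, a) \<in> (if b \<in> B n \<and> a \<in> B n then \<phi> b a ` E b a else {0})}" (is "_ ` ?X = ?Y")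
proof
  show "total_\<phi> ` ?X \<subseteq> ?Y" by (auto simp: total_\<phi>_def)
  show "?Y \<subseteq> total_\<phi> ` ?X"
  proof
    fix Y assume Y: "Y \<in> ?Y"
    have Y': "Y (b, a) \<in> (if b \<in> B n \<and> a \<in> B n then \<phi> b a ` E b a else {0})" for b a
      using Y by blast
    have "\<forall>i\<in>B n \<times> B n. \<exists>y. y \<in> E (fst i) (snd i) \<and> Y i = \<phi> (fst i) (snd i) y"
    proof clarify
      fix b a assume "b \<in> B n" "a \<in> B n"
      then have "Y (b, a) \<in> \<phi> b a ` E b a" using Y'[of b a] by simp
      then show "\<exists>y. y \<in> E (fst (b, a)) (snd (b, a)) \<and> Y (b, a) = \<phi> (fst (b, a)) (snd (b, a)) y"
        by auto
    qed
    then obtain y where y: "\<And>i. i \<in> B n \<times> B n \<Longrightarrow> y i \<in> E (fst i) (snd i) \<and> Y i = \<phi> (fst i) (snd i) (y i)"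
      by metis
    have "restrict y (B n \<times> B n) \<in> ?X"
      using subsetD[OF assms] y unfolding carrier_\<Sigma> by (auto simp: case_prod_unfold)
    moreover have "Y p = total_\<phi> (restrict y (B n \<times> B n)) p" for p
      using y[of p] Y'[of "fst p" "snd p"] by (cases p) (auto simp: total_\<phi>_def split: if_splits)
    then have "Y = total_\<phi> (restrict y (B n \<times> B n))" by blast
    ultimately show "Y \<in> total_\<phi> ` ?X" by blast
  qed
qed

lemma total_\<phi>_carrier:
  "total_\<phi> ` carrier R =
    {X. \<forall>b a. X (b, a) \<in> (if b \<in> B n \<and> a \<in> B n then \<phi> b a ` carrier (G b a) else {0})}"
proof -
  have "carrier R = {x \<in> carrier \<Sigma>. \<forall>b\<in>B n. \<forall>a\<in>B n. x (b, a) \<in> carrier (G b a)}"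
    using carrier_\<Sigma>_D by (auto simp: R_simps)
  then show ?thesis using total_\<phi>_image[of "\<lambda>b a. carrier (G b a)"] by simp
qed

lemma total_\<phi>_homog:
  "total_\<phi> ` homog R k =
    {X. \<forall>b a. X (b, a) \<in> (if b \<in> B n \<and> a \<in> B n then \<phi> b a ` D b a k else {0})}"
  unfolding R_simps using D_sub by (intro total_\<phi>_image subgroup.subset)

end

text \<open>Leaves three comparisons of single entries, made inside one algebra of characteristic
  two.\<close>

lemma graded_ring_iso_arc_rings:
  assumes R: "arc_ring_mod2 n G \<mu> u D \<phi> \<beta>" and S: "arc_ring_mod2 n G' \<mu>' u' D' \<phi>' \<beta>"
    and carrier: "\<And>b a. \<phi> b a ` carrier (G b a) = \<phi>' b a ` carrier (G' b a)"
    and one: "\<And>a. \<phi> a a (u a) = \<phi>' a a (u' a)"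
    and homog: "\<And>b a k. \<phi> b a ` D b a k = \<phi>' b a ` D' b a k"
  shows "\<exists>h. h \<in> graded_ring_iso (tensor_ring (arc_ring n G \<mu> u D) Z2_ring)
    (tensor_ring (arc_ring n G' \<mu>' u' D') Z2_ring)"
  by (rule graded_ring_iso_tensor_mod2[OF arc_ring_mod2.mod2_reduction[OF R] arc_ring_mod2.mod2_reduction[OF S]])
    (simp_all only: arc_ring_mod2.total_\<phi>_carrier[OF R] arc_ring_mod2.total_\<phi>_carrier[OF S]
      arc_ring_mod2.total_\<phi>_one[OF R] arc_ring_mod2.total_\<phi>_one[OF S]
      arc_ring_mod2.total_\<phi>_homog[OF R] arc_ring_mod2.total_\<phi>_homog[OF S] carrier one homog)

section \<open>The exterior algebra modulo two\<close>

text \<open>Over the field of two elements the exterior algebra on \<open>'s\<close> is the algebra generated by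
  commuting elements of square zero. It is realised as the group algebra of the elementary abelian
  2-group on \<open>'s\<close>, in which \<open>1 + g\<close> has square zero for every group element \<open>g\<close>.\<close>

type_synonym 's ext2 = "('s \<Rightarrow>\<^sub>0 bit) \<Rightarrow>\<^sub>0 bit"

definition ext_gen :: "'s \<Rightarrow> 's ext2" where
  "ext_gen s = 1 + Poly_Mapping.single (Poly_Mapping.single s 1) 1"

definition indicator_vec :: "'s set \<Rightarrow> 's \<Rightarrow>\<^sub>0 bit" where
  "indicator_vec A = (\<Sum>s\<in>A. Poly_Mapping.single s 1)"

lemma bit_add_self [simp]: "(b :: bit) + b = 0"
  by (cases b) auto

lemma poly_bit_add_self: "(x :: 'a \<Rightarrow>\<^sub>0 bit) + x = 0"
  by (rule poly_mapping_eqI) (simp add: lookup_add)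

lemma ext2_char2: "(2 :: 's ext2) = 0"
  using poly_bit_add_self[of "1 :: 's ext2"] by simp

lemma ext_gen_square: "ext_gen s * ext_gen s = 0"
proof -
  let ?g = "Poly_Mapping.single (Poly_Mapping.single s (1 :: bit)) (1 :: bit)"
  have "?g * ?g = 1"
    by (simp only: mult_single poly_bit_add_self) simp
  moreover have "(1 + ?g) * (1 + ?g) = (1 + ?g * ?g) + (?g + ?g)"
    by (simp only: algebra_simps mult_1_left mult_1_right)
  ultimately show ?thesis
    unfolding ext_gen_def by (simp only: poly_bit_add_self add_0_right)
qed

lemma keys_indicator_vec [simp]: "finite A \<Longrightarrow> keys (indicator_vec A) = A"
proof -
  assume "finite A"
  then have "lookup (indicator_vec A) s = (if s \<in> A then 1 else 0)" for s
    by (simp add: indicator_vec_def lookup_sum lookup_single when_def)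
  then show ?thesis by (auto simp: in_keys_iff split: if_splits)
qed

lemma prod_single:
  "finite A \<Longrightarrow> (\<Prod>s\<in>A. Poly_Mapping.single (f s) (1 :: bit)) = Poly_Mapping.single (\<Sum>s\<in>A. f s) 1"
  by (induction A rule: finite_induct) (auto simp: mult_single)

text \<open>Multiply out the factors \<open>1 + g\<close>, one for each generator; the subsets index
  the resulting group elements.\<close>

lemma prod_ext_gen:
  assumes "finite A"
  shows "(\<Prod>s\<in>A. ext_gen s) = (\<Sum>X\<in>Pow A. Poly_Mapping.single (indicator_vec X) 1)"
proof -
  have "(\<Prod>s\<in>A. ext_gen s) = (\<Prod>s\<in>A. Poly_Mapping.single (Poly_Mapping.single s 1) 1 + 1)"
    by (simp add: ext_gen_def add.commute)
  also have "\<dots> = (\<Sum>X\<in>Pow A. \<Prod>s\<in>X. Poly_Mapping.single (Poly_Mapping.single s 1) 1)"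
    using assms by (subst prod_add) auto
  also have "\<dots> = (\<Sum>X\<in>Pow A. Poly_Mapping.single (indicator_vec X) 1)"
    using finite_subset[OF _ assms]
    by (intro sum.cong) (auto simp: prod_single[where f = "\<lambda>s. Poly_Mapping.single s 1"] indicator_vec_def)
  finally show ?thesis .
qed

text \<open>These coefficients form the incidence matrix of the inclusion order, which is
  unitriangular; this is why the products are independent.\<close>

lemma lookup_prod_ext_gen:
  assumes "finite A" "finite C"
  shows "lookup (\<Prod>s\<in>A. ext_gen s) (indicator_vec C) = (if C \<subseteq> A then 1 else 0)"
proof -
  have "indicator_vec X = indicator_vec C \<longleftrightarrow> X = C" if "X \<in> Pow A" for X
  proof
    assume "indicator_vec X = indicator_vec C"
    then have "keys (indicator_vec X) = keys (indicator_vec C)" by simp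
    then show "X = C" using that assms finite_subset[of X A] by simp
  qed simp
  then have "(\<Sum>X\<in>Pow A. lookup (Poly_Mapping.single (indicator_vec X) (1::bit)) (indicator_vec C))
      = (\<Sum>X\<in>Pow A. if X = C then 1 else 0)"
    by (intro sum.cong) (auto simp: lookup_single when_def)
  then show ?thesis
    using assms by (simp add: prod_ext_gen lookup_sum)
qed

text \<open>The coefficient at a set of maximal size sees only one summand.\<close>

lemma prod_ext_gen_independent:
  assumes "finite F" "\<And>A. A \<in> F \<Longrightarrow> finite A" "(\<Sum>A\<in>F. \<Prod>s\<in>A. ext_gen s) = 0"
  shows "F = {}"
proof (rule ccontr)
  assume "F \<noteq> {}"
  then obtain C where C: "C \<in> F" "\<And>A. A \<in> F \<Longrightarrow> card A \<le> card C"
    using obtains_MAX[OF assms(1), of card] assms(1) by (metis Max_ge finite_imageI imageI)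
  have "C \<subseteq> A \<longleftrightarrow> A = C" if "A \<in> F" for A
    using C(2)[OF that] card_seteq[of A C] assms(2)[OF that] by auto
  then have "(\<Sum>A\<in>F. lookup (\<Prod>s\<in>A. ext_gen s) (indicator_vec C))
      = (\<Sum>A\<in>F. if A = C then 1 else 0)"
    using assms C by (intro sum.cong) (auto simp: lookup_prod_ext_gen)
  also have "\<dots> = 1" using C assms(1) by simp
  finally have "lookup (\<Sum>A\<in>F. \<Prod>s\<in>A. ext_gen s) (indicator_vec C) = 1"
    by (simp add: lookup_sum)
  then show False using assms(3) by simp
qed

lemma char2_of_int: "(2 :: 'r::comm_ring_1) = 0 \<Longrightarrow> (of_int k :: 'r) = (if odd k then 1 else 0)"
  by (cases "even k") (auto elim!: evenE oddE)

lemma char2_minus: "(2 :: 'r::comm_ring_1) = 0 \<Longrightarrow> - x = (x :: 'r)"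
  by (metis add_eq_0_iff mult_2 mult_zero_left)

lemma char2_diff: "(2 :: 'r::comm_ring_1) = 0 \<Longrightarrow> x - y = x + (y :: 'r)"
  using char2_minus[of y] by (metis add_uminus_conv_diff)

lemma frag_double:
  assumes "\<And>k. even (lookup x k)"
  obtains y where "x = y + y" "keys y \<subseteq> keys (x :: 'a \<Rightarrow>\<^sub>0 int)"
proof
  let ?y = "Poly_Mapping.map (\<lambda>n. n div 2) x"
  have l: "lookup ?y k = lookup x k div 2" for k
    by (simp add: Poly_Mapping.map.rep_eq when_def)
  show "x = ?y + ?y"
    by (rule poly_mapping_eqI) (use assms in \<open>auto simp: lookup_add l\<close>)
  show "keys ?y \<subseteq> keys x"
    by (auto simp: in_keys_iff l)
qed

text \<open>Modulo two only the odd coefficients survive. They multiply distinct square-free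
  monomials, which are independent, so there are none of them and \<open>x\<close> can be
  halved.\<close>

lemma lin_ext_prod_ext_gen_kernel:
  assumes "keys x \<subseteq> K" "inj_on t K" "\<And>k. k \<in> K \<Longrightarrow> finite (t k)"
    and "lin_ext (\<lambda>k. \<Prod>s\<in>t k. ext_gen s) x = 0"
  obtains y where "x = y + y" "keys y \<subseteq> K"
proof -
  define Odd where "Odd = {k \<in> keys x. odd (lookup x k)}"
  have inj: "inj_on t Odd" using assms(1,2) by (auto simp: Odd_def intro: inj_on_subset)
  have "0 = lin_ext (\<lambda>k. \<Prod>s\<in>t k. ext_gen s) x" using assms(4) by simp
  also have "\<dots> = (\<Sum>k\<in>keys x. if odd (lookup x k) then \<Prod>s\<in>t k. ext_gen s else 0)"
    unfolding lin_ext_def by (intro sum.cong) (auto simp: char2_of_int[OF ext2_char2])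
  also have "\<dots> = (\<Sum>k\<in>Odd. \<Prod>s\<in>t k. ext_gen s)"
    unfolding Odd_def by (subst sum.inter_filter) auto
  also have "\<dots> = (\<Sum>A\<in>t ` Odd. \<Prod>s\<in>A. ext_gen s)"
    using inj by (simp add: sum.reindex)
  finally have "t ` Odd = {}"
    using assms(1,3) by (intro prod_ext_gen_independent) (auto simp: Odd_def)
  then have "even (lookup x k)" for k
    by (cases "k \<in> keys x") (auto simp: Odd_def in_keys_iff)
  from frag_double[OF this] obtain y where "x = y + y" "keys y \<subseteq> keys x" by blast
  then show thesis using assms(1) that by blast
qed

text \<open>Linear extension of \<open>\<Prod>s\<in>A. ext_gen s \<mapsto> \<Prod>s\<in>A. \<theta> s\<close>.\<close>

definition ext_subst :: "('s \<Rightarrow> 'r::comm_ring_1) \<Rightarrow> 's ext2 \<Rightarrow> 'r" where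
  "ext_subst \<theta> X = (\<Sum>g\<in>keys X. \<Prod>s\<in>keys g. \<theta> s + 1)"

lemma ext_subst_superset:
  assumes "finite K" "keys X \<subseteq> K"
  shows "ext_subst \<theta> X =
    (\<Sum>g\<in>K. of_bool (lookup X g = 1) * (\<Prod>s\<in>keys g. \<theta> s + 1))"
  unfolding ext_subst_def using assms by (intro sum.mono_neutral_cong_left) (auto simp: in_keys_iff)

lemma of_bool_bit_add:
  assumes "(2 :: 'r::comm_ring_1) = 0"
  shows "(of_bool (b + c = 1) :: 'r) = of_bool (b = 1) + of_bool (c = (1 :: bit))"
  by (cases b; cases c) (use assms in auto)

lemma ext_subst_add:
  assumes "(2 :: 'r::comm_ring_1) = 0"
  shows "ext_subst \<theta> (X + Y) = ext_subst \<theta> X + (ext_subst \<theta> Y :: 'r)"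
proof -
  let ?K = "keys X \<union> keys Y"
  have "finite ?K" "keys (X + Y) \<subseteq> ?K" using keys_add[of X Y] by auto
  then show ?thesis
    unfolding ext_subst_superset[OF \<open>finite ?K\<close> \<open>_ \<subseteq> ?K\<close>]
      ext_subst_superset[OF \<open>finite ?K\<close> Un_upper1] ext_subst_superset[OF \<open>finite ?K\<close> Un_upper2]
      lookup_add of_bool_bit_add[OF assms] distrib_right sum.distrib by blast
qed

lemma ext_subst_0 [simp]: "ext_subst \<theta> 0 = 0"
  by (simp add: ext_subst_def)

lemma ext_subst_sum:
  assumes "(2 :: 'r::comm_ring_1) = 0"
  shows "ext_subst \<theta> (\<Sum>i\<in>I. f i) = (\<Sum>i\<in>I. ext_subst \<theta> (f i) :: 'r)"
  by (induction I rule: infinite_finite_induct) (auto simp: ext_subst_add[OF assms])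

text \<open>In characteristic two the group element attached to \<open>s\<close> is
  \<open>ext_gen s + 1\<close>, whence the factors \<open>\<theta> s + 1\<close> in
  \<open>ext_subst\<close>. Summing over all subsets reassembles the product of the terms
  \<open>(\<theta> s + 1) + 1\<close>, that is, of the \<open>\<theta> s\<close>.\<close>

lemma ext_subst_prod:
  assumes "(2 :: 'r::comm_ring_1) = 0" "finite A"
  shows "ext_subst \<theta> (\<Prod>s\<in>A. ext_gen s) = (\<Prod>s\<in>A. \<theta> s :: 'r)"
proof -
  have "ext_subst \<theta> (\<Prod>s\<in>A. ext_gen s) = (\<Sum>X\<in>Pow A. \<Prod>s\<in>X. \<theta> s + 1)"
    using assms finite_subset[OF _ assms(2)]
    by (simp add: prod_ext_gen ext_subst_sum) (auto simp: ext_subst_def intro!: sum.cong)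
  also have "\<dots> = (\<Prod>s\<in>A. (\<theta> s + 1) + 1)"
    using assms(2) by (subst prod_add) auto
  also have "\<dots> = (\<Prod>s\<in>A. \<theta> s)"
    using assms(1) by (simp add: add.assoc)
  finally show ?thesis .
qed

text \<open>Integers act on both sides through their parity.\<close>

lemma ext_subst_lin_ext:
  assumes "(2 :: 'r::comm_ring_1) = 0"
  shows "ext_subst \<theta> (lin_ext f x) = (lin_ext (\<lambda>k. ext_subst \<theta> (f k)) x :: 'r)"
  unfolding lin_ext_def by (simp add: ext_subst_sum[OF assms])
    (intro sum.cong, auto simp: char2_of_int[OF ext2_char2] char2_of_int[OF assms])

section \<open>Words\<close>

text \<open>The extension of \<open>\<theta>\<close> to a ring homomorphism on the tensor algebra;
  it factors through the exterior algebra as soon as the target has characteristic two and the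
  values have square zero.\<close>

definition word_eval :: "('s \<Rightarrow> 'r::comm_ring_1) \<Rightarrow> ('s list \<Rightarrow>\<^sub>0 int) \<Rightarrow> 'r" where
  "word_eval \<theta> = lin_ext (\<lambda>w. \<Prod>s\<leftarrow>w. \<theta> s)"

lemma word_eval_simps [simp]:
  "word_eval \<theta> (x + y) = word_eval \<theta> x + word_eval \<theta> y" "word_eval \<theta> (x - y) = word_eval \<theta> x - word_eval \<theta> y"
  "word_eval \<theta> (- x) = - word_eval \<theta> x" "word_eval \<theta> 0 = 0" "word_eval \<theta> (frag_of w) = (\<Prod>s\<leftarrow>w. \<theta> s)"
  by (simp_all add: word_eval_def)

lemma word_mult_simps [simp]:
  "word_mult (x - x') y = word_mult x y - word_mult x' y"
  "word_mult x (y - y') = word_mult x y - word_mult x y'"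
  "word_mult 0 y = 0" "word_mult x 0 = 0"
  "word_mult (frag_of u) (frag_of v) = frag_of (u @ v)"
proof -
  show "word_mult x (y - y') = word_mult x y - word_mult x y'" using subset_UNIV
    by (induction x rule: frag_induction) (auto simp: word_mult_def frag_extend_diff)
  show "word_mult x 0 = 0" by (simp add: word_mult_def frag_extend_eq_0)
qed (simp_all add: word_mult_def frag_extend_diff)

lemma word_mult_minus [simp]: "word_mult (- x) y = - word_mult x y" "word_mult x (- y) = - word_mult x y"
  using word_mult_simps(1)[of 0 x y] word_mult_simps(2)[of x 0 y] by simp_all

lemma word_mult_add [simp]:
  "word_mult (x + x') y = word_mult x y + word_mult x' y"
  "word_mult x (y + y') = word_mult x y + word_mult x y'"
  using word_mult_simps(1)[of x "- x'" y] word_mult_simps(2)[of x y "- y'"] by simp_all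

lemma word_mult_assoc: "word_mult (word_mult x y) z = word_mult x (word_mult y z)"
  using subset_UNIV[of "keys x"]
proof (induction x rule: frag_induction)
  case (one u)
  show ?case using subset_UNIV[of "keys y"]
  proof (induction y rule: frag_induction)
    case (one v)
    show ?case using subset_UNIV[of "keys z"]
      by (induction z rule: frag_induction) auto
  qed auto
qed auto

lemma keys_word_mult:
  assumes "keys x \<subseteq> lists S" "keys y \<subseteq> lists S"
  shows "keys (word_mult x y) \<subseteq> lists S"
  using assms(1)
proof (induction x rule: frag_induction)
  case (one u)
  show ?case using assms(2)
  proof (induction y rule: frag_induction)
    case (diff a b)
    then show ?case
      using keys_diff[of "word_mult (frag_of u) a" "word_mult (frag_of u) b"] by auto
  qed (use one in auto)
next
  case (diff a b)
  then show ?case using keys_diff[of "word_mult a y" "word_mult b y"] by auto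
qed auto

lemma word_eval_mult: "word_eval \<theta> (word_mult x y) = word_eval \<theta> x * word_eval \<theta> y"
  using subset_UNIV[of "keys x"]
proof (induction x rule: frag_induction)
  case (one u)
  show ?case using subset_UNIV[of "keys y"]
    by (induction y rule: frag_induction) (auto simp: algebra_simps)
qed (auto simp: algebra_simps)

lemma word_map_simps [simp]:
  "word_map f (x - y) = word_map f x - word_map f y" "word_map f (x + y) = word_map f x + word_map f y"
  "word_map f (- x) = - word_map f x" "word_map f 0 = 0" "word_map f (frag_of w) = frag_of (map f w)"
  by (simp_all add: word_map_def frag_extend_diff frag_extend_add frag_extend_minus)

lemma keys_word_map: "keys (word_map f x) \<subseteq> map f ` keys x"
  unfolding word_map_def using keys_frag_extend[of "\<lambda>w. frag_of (map f w)" x] by auto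

lemma word_map_mult: "word_map f (word_mult x y) = word_mult (word_map f x) (word_map f y)"
  using subset_UNIV[of "keys x"]
proof (induction x rule: frag_induction)
  case (one u)
  show ?case using subset_UNIV[of "keys y"]
    by (induction y rule: frag_induction) auto
qed auto

lemma as_word_simps [simp]:
  "as_word (x - y) = as_word x - as_word y" "as_word (x + y) = as_word x + as_word y" "as_word 0 = 0" "as_word (frag_of s) = frag_of [s]"
  by (simp_all add: as_word_def frag_extend_diff frag_extend_add)

lemma keys_as_word: "keys v \<subseteq> S \<Longrightarrow> keys (as_word v) \<subseteq> lists S"
  unfolding as_word_def using keys_frag_extend[of "\<lambda>s. frag_of [s]" v] by fastforce

lemma word_map_as_word: "word_map f (as_word v) = as_word (frag_extend (\<lambda>s. frag_of (f s)) v)"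
  using subset_UNIV[of "keys v"]
  by (induction v rule: frag_induction) (auto simp: frag_extend_diff)

definition ext_squares :: "'s set \<Rightarrow> ('s list \<Rightarrow>\<^sub>0 int) set" where
  "ext_squares S = {word_mult (word_mult x (word_mult (as_word v) (as_word v))) y | x v y.
        x \<in> carrier (free_Abelian_group (lists S)) \<and>
        v \<in> carrier (free_Abelian_group S) \<and>
        y \<in> carrier (free_Abelian_group (lists S))}"

lemma ext_ideal_squares: "ext_ideal S = generate (free_Abelian_group (lists S)) (ext_squares S)"
  by (simp add: ext_ideal_def ext_squares_def)

lemma ext_squares_sub: "ext_squares S \<subseteq> carrier (free_Abelian_group (lists S))"
  unfolding ext_squares_def
  by clarify (simp only: carrier_free_Abelian_group_iff keys_word_mult keys_as_word)

lemma subgroup_ext_ideal: "subgroup (ext_ideal S) (free_Abelian_group (lists S))"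
  unfolding ext_ideal_squares by (rule generate_free_subgroup[OF ext_squares_sub])

lemmas ext_ideal_add = free_subgroup_add[OF subgroup_ext_ideal]
  and ext_ideal_diff = free_subgroup_diff[OF subgroup_ext_ideal]
  and ext_ideal_0 = free_subgroup_0[OF subgroup_ext_ideal]

lemma ext_ideal_keys: "x \<in> ext_ideal S \<Longrightarrow> keys x \<subseteq> lists S"
  using subgroup.mem_carrier[OF subgroup_ext_ideal, of x S] by simp

text \<open>Closure under differences suffices: an inverse is \<open>0 - h\<close> and a sum is
  \<open>x - (0 - y)\<close>.\<close>

lemma ext_ideal_induct [consumes 1, case_names zero square diff]:
  assumes "x \<in> ext_ideal S" "P 0"
    and sq: "\<And>x v y. keys x \<subseteq> lists S \<Longrightarrow> keys v \<subseteq> S \<Longrightarrow> keys y \<subseteq> lists S \<Longrightarrow>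
      P (word_mult (word_mult x (word_mult (as_word v) (as_word v))) y)"
    and "\<And>x y. P x \<Longrightarrow> P y \<Longrightarrow> P (x - y)"
  shows "P x"
  using assms(1) unfolding ext_ideal_squares
proof induction
  case one
  then show ?case using assms(2) by simp
next
  case (incl h)
  then show ?case unfolding ext_squares_def by (auto intro: sq)
next
  case (inv h)
  then have "P h" unfolding ext_squares_def by (auto intro: sq)
  moreover have "h \<in> carrier (free_Abelian_group (lists S))" using inv ext_squares_sub by blast
  ultimately show ?case using assms(2) assms(4)[of 0 h] inv_free by fastforce
next
  case (eng x y)
  then have "P (x - (0 - y))" using assms(2,4) by blast
  then show ?case by simp
qed

lemma ext_ideal_square:
  assumes "keys x \<subseteq> lists S" "keys v \<subseteq> S" "keys y \<subseteq> lists S"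
  shows "word_mult (word_mult x (word_mult (as_word v) (as_word v))) y \<in> ext_ideal S"
  unfolding ext_ideal_squares by (rule generate.incl) (use assms in \<open>auto simp: ext_squares_def\<close>)

lemma ext_ideal_mult_left:
  assumes "x \<in> ext_ideal S" "keys z \<subseteq> lists S"
  shows "word_mult z x \<in> ext_ideal S"
  using assms(1)
proof (induction x rule: ext_ideal_induct)
  case (square x v y)
  then show ?case
    using ext_ideal_square[of "word_mult z x" S v y] keys_word_mult[OF assms(2)]
    by (simp add: word_mult_assoc)
qed (auto intro: ext_ideal_0 ext_ideal_diff)

lemma ext_ideal_mult_right:
  assumes "x \<in> ext_ideal S" "keys z \<subseteq> lists S"
  shows "word_mult x z \<in> ext_ideal S"
  using assms(1)
proof (induction x rule: ext_ideal_induct)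
  case (square x v y)
  then show ?case
    using ext_ideal_square[of x S v "word_mult y z"] keys_word_mult[OF _ assms(2)]
    by (simp add: word_mult_assoc)
qed (auto intro: ext_ideal_0 ext_ideal_diff)

text \<open>Renaming generators is multiplicative and sends the square of \<open>v\<close> to the
  square of the renamed combination, also when \<open>f\<close> identifies generators, as a merge
  does.\<close>

lemma ext_ideal_map:
  assumes "x \<in> ext_ideal S" "f ` S \<subseteq> S'"
  shows "word_map f x \<in> ext_ideal S'"
  using assms(1)
proof (induction x rule: ext_ideal_induct)
  case (square x v y)
  have *: "keys (word_map f z) \<subseteq> lists S'" if "keys z \<subseteq> lists S" for z
    using keys_word_map[of f z] that assms(2) by fastforce
  have "keys (frag_extend (\<lambda>s. frag_of (f s)) v) \<subseteq> S'"
    using keys_frag_extend[of "\<lambda>s. frag_of (f s)" v] square assms(2) by fastforce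
  then show ?case
    using square * by (simp add: word_map_mult word_map_as_word ext_ideal_square)
qed (auto intro: ext_ideal_0 ext_ideal_diff)

text \<open>The squares that generate the ideal are those of arbitrary combinations
  \<open>v\<close>, not just of generators; in a commutative ring the mixed terms of such a square
  come in equal pairs and cancel modulo two.\<close>

lemma word_eval_ext_ideal:
  fixes \<theta> :: "'s \<Rightarrow> 'r::comm_ring_1"
  assumes "x \<in> ext_ideal S" "(2 :: 'r) = 0" "\<And>s. s \<in> S \<Longrightarrow> \<theta> s * \<theta> s = 0"
  shows "word_eval \<theta> x = 0"
  using assms(1)
proof (induction x rule: ext_ideal_induct)
  case (square x v y)
  have "word_eval \<theta> (as_word v) * word_eval \<theta> (as_word v) = 0" using square(2)
  proof (induction v rule: frag_induction)
    case (diff a b)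
    have "word_eval \<theta> (as_word (a - b)) * word_eval \<theta> (as_word (a - b)) =
      word_eval \<theta> (as_word a) * word_eval \<theta> (as_word a) + word_eval \<theta> (as_word b) * word_eval \<theta> (as_word b)
      - 2 * (word_eval \<theta> (as_word a) * word_eval \<theta> (as_word b))"
      by (simp add: algebra_simps)
    then show ?case using diff assms(2) by simp
  qed (use assms in auto)
  then show ?case by (simp add: word_eval_mult)
qed auto

section \<open>The reduction modulo two of an exterior algebra\<close>

text \<open>The ideal together with all doubles: dividing by it gives the exterior algebra modulo
  two.\<close>

definition ext_ideal2 :: "'s set \<Rightarrow> ('s list \<Rightarrow>\<^sub>0 int) set" where
  "ext_ideal2 S = {x + y + y | x y. x \<in> ext_ideal S \<and> keys y \<subseteq> lists S}"

lemma ext_ideal2_I: "x \<in> ext_ideal S \<Longrightarrow> keys y \<subseteq> lists S \<Longrightarrow> x + y + y \<in> ext_ideal2 S"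
  by (auto simp: ext_ideal2_def)

lemma ext_ideal_imp_ideal2: "x \<in> ext_ideal S \<Longrightarrow> x \<in> ext_ideal2 S"
  using ext_ideal2_I[of x S 0] by simp

lemma ext_ideal2_diff:
  assumes "x \<in> ext_ideal2 S" "y \<in> ext_ideal2 S"
  shows "x - y \<in> ext_ideal2 S"
proof -
  obtain a b a' b' where "x = a + b + b" "y = a' + b' + b'" "a \<in> ext_ideal S" "a' \<in> ext_ideal S"
    "keys b \<subseteq> lists S" "keys b' \<subseteq> lists S"
    using assms unfolding ext_ideal2_def by blast
  then show ?thesis
    using ext_ideal2_I[OF ext_ideal_diff, of a S a' "b - b'"] keys_diff[of b b']
    by (auto simp: algebra_simps)
qed

lemma ext_ideal2_0: "0 \<in> ext_ideal2 S"
  by (simp add: ext_ideal_imp_ideal2 ext_ideal_0)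

lemma ext_ideal2_add: "x \<in> ext_ideal2 S \<Longrightarrow> y \<in> ext_ideal2 S \<Longrightarrow> x + y \<in> ext_ideal2 S"
  using ext_ideal2_diff[OF _ ext_ideal2_diff[OF ext_ideal2_0], of x S y] by simp

lemma word_square_in_ideal:
  assumes "u \<in> lists S" "s \<in> S" "v \<in> lists S"
  shows "frag_of (u @ [s, s] @ v) \<in> ext_ideal S"
  using ext_ideal_square[of "frag_of u" S "frag_of s" "frag_of v"] assms by simp

text \<open>The square of \<open>s + t\<close> minus the squares of \<open>s\<close> and of
  \<open>t\<close> is \<open>st + ts\<close>, which differs from \<open>st - ts\<close> by twice
  \<open>ts\<close>.\<close>

lemma word_swap_in_ideal2:
  assumes "u \<in> lists S" "s \<in> S" "t \<in> S" "v \<in> lists S"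
  shows "frag_of (u @ [s, t] @ v) - frag_of (u @ [t, s] @ v) \<in> ext_ideal2 S"
proof -
  have k: "keys (frag_of s + frag_of t) \<subseteq> S"
    using keys_add[of "frag_of s" "frag_of t"] assms by auto
  have "word_mult (word_mult (frag_of u) (word_mult (as_word (frag_of s + frag_of t)) (as_word (frag_of s + frag_of t)))) (frag_of v)
      - frag_of (u @ [s, s] @ v) - frag_of (u @ [t, t] @ v) \<in> ext_ideal S" (is "?x \<in> _")
    using k assms by (intro ext_ideal_diff word_square_in_ideal ext_ideal_square) auto
  moreover have "frag_of (u @ [s, t] @ v) - frag_of (u @ [t, s] @ v) =
      ?x + (- frag_of (u @ [t, s] @ v)) + (- frag_of (u @ [t, s] @ v))"
    by (simp add: algebra_simps)
  moreover have "keys (- frag_of (u @ [t, s] @ v)) \<subseteq> lists S" using assms by simp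
  ultimately show ?thesis using ext_ideal2_I by metis
qed

lemma word_move_in_ideal2:
  assumes "u \<in> lists S" "s \<in> S" "v \<in> lists S" "v' \<in> lists S"
  shows "frag_of (u @ s # v @ v') - frag_of (u @ v @ s # v') \<in> ext_ideal2 S"
  using assms
proof (induction v arbitrary: u)
  case (Cons t v)
  have "frag_of (u @ [s, t] @ v @ v') - frag_of (u @ [t, s] @ v @ v') \<in> ext_ideal2 S"
    using Cons.prems by (intro word_swap_in_ideal2) auto
  moreover have "frag_of ((u @ [t]) @ s # v @ v') - frag_of ((u @ [t]) @ v @ s # v') \<in> ext_ideal2 S"
    using Cons.prems by (intro Cons.IH) auto
  ultimately show ?case using ext_ideal2_add by fastforce
qed (simp add: ext_ideal2_0)

text \<open>The first letter of \<open>v\<close> is moved to the front of \<open>w\<close>; the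
  prefix \<open>u\<close> collects the letters already in place.\<close>

lemma word_permute_in_ideal2:
  assumes "mset v = mset w" "u \<in> lists S" "v \<in> lists S"
  shows "frag_of (u @ v) - frag_of (u @ w) \<in> ext_ideal2 S"
  using assms
proof (induction v arbitrary: u w)
  case Nil
  then show ?case by (simp add: ext_ideal2_0)
next
  case (Cons s v)
  then have "s \<in> set w" by (metis list.set_intros(1) set_mset_mset)
  then obtain w1 w2 where w: "w = w1 @ s # w2" by (meson split_list)
  have "set w = set (s # v)" using Cons.prems(1) by (metis set_mset_mset)
  then have "w \<in> lists S" using Cons.prems(3) by (simp add: in_lists_conv_set)
  have "frag_of ((u @ [s]) @ v) - frag_of ((u @ [s]) @ w1 @ w2) \<in> ext_ideal2 S"
    using Cons.prems w by (intro Cons.IH) auto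
  moreover have "frag_of (u @ s # w1 @ w2) - frag_of (u @ w1 @ s # w2) \<in> ext_ideal2 S"
    using Cons.prems w \<open>w \<in> lists S\<close> by (intro word_move_in_ideal2) auto
  ultimately show ?case using ext_ideal2_add w by fastforce
qed

text \<open>Two equal letters can be moved next to each other, where they form a square.\<close>

lemma word_not_distinct_in_ideal2:
  assumes "w \<in> lists S" "\<not> distinct w"
  shows "frag_of w \<in> ext_ideal2 S"
proof -
  obtain u v v' s where w: "w = u @ [s] @ v @ [s] @ v'" using not_distinct_decomp[OF assms(2)] by blast
  have "frag_of (u @ s # v @ s # v') - frag_of (u @ v @ s # s # v') \<in> ext_ideal2 S"
    using assms w by (intro word_move_in_ideal2) auto
  moreover have "frag_of ((u @ v) @ [s, s] @ v') \<in> ext_ideal2 S"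
    using assms w by (intro ext_ideal_imp_ideal2 word_square_in_ideal) auto
  ultimately show ?thesis using ext_ideal2_add w by fastforce
qed

text \<open>Which enumeration is chosen does not matter modulo \<open>ext_ideal2\<close>, by
  \<open>word_permute_in_ideal2\<close>.\<close>

definition set_word :: "'s set \<Rightarrow> 's list" where
  "set_word A = (SOME w. distinct w \<and> set w = A)"

lemma set_word: "finite A \<Longrightarrow> distinct (set_word A) \<and> set (set_word A) = A"
  unfolding set_word_def by (rule someI_ex) (metis finite_distinct_list)

lemma word_eval_ext_gen:
  "(\<Prod>s\<leftarrow>w. ext_gen s) = (if distinct w then \<Prod>s\<in>set w. ext_gen s else 0)"
proof (cases "distinct w")
  case False
  then obtain u v v' s where w: "w = u @ [s] @ v @ [s] @ v'" using not_distinct_decomp by blast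
  have "(\<Prod>s\<leftarrow>w. ext_gen s) =
    (\<Prod>s\<leftarrow>u. ext_gen s) * (\<Prod>s\<leftarrow>v. ext_gen s) * (ext_gen s * ext_gen s) * (\<Prod>s\<leftarrow>v'. ext_gen s)"
    unfolding w by (simp only: map_append prod_list.append list.map prod_list.Cons prod_list.Nil mult_1_right mult_1_left mult_ac)
  then show ?thesis using False by (simp add: ext_gen_square)
qed (simp add: prod.distinct_set_conv_list)

text \<open>Modulo \<open>ext_ideal2\<close> an element is a combination of enumerated subsets.
  These evaluate to distinct, hence independent, monomials, so a vanishing combination has even
  coefficients and lies in \<open>ext_ideal2\<close> as a double.\<close>

lemma word_eval_ext_gen_kernel:
  assumes "finite S" "keys x \<subseteq> lists S" "word_eval ext_gen x = 0"
  shows "x \<in> ext_ideal2 S"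
proof -
  have *: "\<exists>z. keys z \<subseteq> Pow S \<and> x - frag_extend (\<lambda>A. frag_of (set_word A)) z \<in> ext_ideal2 S"
    using assms(2)
  proof (induction x rule: frag_induction)
    case zero
    then show ?case using ext_ideal2_0 by (intro exI[of _ 0]) auto
  next
    case (one w)
    show ?case
    proof (cases "distinct w")
      case True
      then have "mset w = mset (set_word (set w))"
        using set_word[of "set w"] set_eq_iff_mset_eq_distinct[OF True, of "set_word (set w)"] by simp
      then show ?thesis
        using word_permute_in_ideal2[of w "set_word (set w)" "[]" S] one
        by (intro exI[of _ "frag_of (set w)"]) auto
    next
      case False
      then show ?thesis using word_not_distinct_in_ideal2[of w S] one by (intro exI[of _ 0]) auto
    qed
  next
    case (diff a b)
    then obtain y z where yz: "keys y \<subseteq> Pow S" "keys z \<subseteq> Pow S"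
      "a - frag_extend (\<lambda>A. frag_of (set_word A)) y \<in> ext_ideal2 S"
      "b - frag_extend (\<lambda>A. frag_of (set_word A)) z \<in> ext_ideal2 S" by blast
    then show ?case
      using ext_ideal2_diff[OF yz(3,4)] keys_diff[of y z]
      by (intro exI[of _ "y - z"]) (auto simp: frag_extend_diff algebra_simps)
  qed
  then obtain z where z: "keys z \<subseteq> Pow S"
    "x - frag_extend (\<lambda>A. frag_of (set_word A)) z \<in> ext_ideal2 S" by blast
  have ideal2_0: "word_eval ext_gen y = 0" if "y \<in> ext_ideal2 S" for y
  proof -
    obtain a b where "y = a + b + b" "a \<in> ext_ideal S" using \<open>y \<in> _\<close> unfolding ext_ideal2_def by blast
    then show ?thesis
      using word_eval_ext_ideal[of a S ext_gen] by (simp add: ext2_char2 ext_gen_square add.assoc poly_bit_add_self)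
  qed
  have fin: "finite A" if "A \<in> Pow S" for A using that assms(1) finite_subset by auto
  have "word_eval ext_gen (frag_extend (\<lambda>A. frag_of (set_word A)) z) = 0"
    using ideal2_0[OF z(2)] assms(3) by simp
  then have "lin_ext (\<lambda>A. \<Prod>s\<leftarrow>set_word A. ext_gen s) z = 0"
    by (simp add: word_eval_def lin_ext_frag_extend)
  moreover have "lin_ext (\<lambda>A. \<Prod>s\<leftarrow>set_word A. ext_gen s) z = lin_ext (\<lambda>A. \<Prod>s\<in>A. ext_gen s) z"
  proof (rule lin_ext_cong)
    fix A assume "A \<in> keys z"
    then have "finite A" using z(1) fin by blast
    from set_word[OF this] show "(\<Prod>s\<leftarrow>set_word A. ext_gen s) = (\<Prod>s\<in>A. ext_gen s)"
      by (simp add: word_eval_ext_gen)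
  qed
  ultimately have "lin_ext (\<lambda>A. \<Prod>s\<in>id A. ext_gen s) z = 0" by simp
  then obtain y where y: "z = y + y" "keys y \<subseteq> Pow S"
    using lin_ext_prod_ext_gen_kernel[of z "Pow S" id] z(1) fin by auto
  have "keys (frag_extend (\<lambda>A. frag_of (set_word A)) y) \<subseteq> lists S"
    using keys_frag_extend[of "\<lambda>A. frag_of (set_word A)" y] y(2) set_word[OF fin]
    by (auto simp: in_lists_conv_set subset_iff)
  then have "frag_extend (\<lambda>A. frag_of (set_word A)) z \<in> ext_ideal2 S"
    using ext_ideal2_I[OF ext_ideal_0, of "frag_extend (\<lambda>A. frag_of (set_word A)) y" S]
    by (simp add: y(1) frag_extend_add)
  from ext_ideal2_add[OF z(2) this] show ?thesis by simp
qed

section \<open>Classes in the exterior algebra and their values modulo two\<close>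

lemma ext_class_eq_iff: "ext_class S x = ext_class S y \<longleftrightarrow> x - y \<in> ext_ideal S"
  unfolding ext_class_def by (rule free_coset_eq_iff[OF subgroup_ext_ideal])

lemma in_ext_class_iff: "y \<in> ext_class S x \<longleftrightarrow> y - x \<in> ext_ideal S"
  unfolding ext_class_def by (rule free_coset_iff[OF subgroup_ext_ideal])

lemma carrier_exterior: "carrier (exterior S) = ext_class S ` {x. keys x \<subseteq> lists S}"
  by (auto simp: exterior_def FactGroup_def RCOSETS_def ext_class_def)

lemma mult_exterior:
  assumes "keys x \<subseteq> lists S" "keys y \<subseteq> lists S"
  shows "ext_class S x \<otimes>\<^bsub>exterior S\<^esub> ext_class S y = ext_class S (x + y)"
  unfolding ext_class_def exterior_def by (rule free_quotient_mult[OF subgroup_ext_ideal]) (use assms in auto)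

lemma comm_group_exterior: "comm_group (exterior S)"
  unfolding exterior_def
  by (rule comm_group.abelian_FactGroup[OF abelian_free_Abelian_group subgroup_ext_ideal])

definition ext_eval :: "('s list \<Rightarrow>\<^sub>0 int) set \<Rightarrow> 's ext2" where
  "ext_eval U = word_eval ext_gen (SOME x. x \<in> U)"

text \<open>Elements of the ideal evaluate to 0, so the chosen representative may be replaced by
  \<open>x\<close>.\<close>

lemma ext_eval_class: "ext_eval (ext_class S x) = word_eval ext_gen x"
proof -
  have "x \<in> ext_class S x" by (simp add: in_ext_class_iff ext_ideal_0)
  then have "(SOME y. y \<in> ext_class S x) \<in> ext_class S x" by (rule someI)
  then have "(SOME y. y \<in> ext_class S x) - x \<in> ext_ideal S" by (simp add: in_ext_class_iff)
  then have "word_eval ext_gen ((SOME y. y \<in> ext_class S x) - x) = 0"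
    by (rule word_eval_ext_ideal) (simp_all add: ext2_char2 ext_gen_square)
  then show ?thesis by (simp add: ext_eval_def)
qed

lemma ext_eval_kernel:
  assumes "finite S" "U \<in> carrier (exterior S)" "ext_eval U = 0"
  shows "\<exists>V\<in>carrier (exterior S). U = V \<otimes>\<^bsub>exterior S\<^esub> V"
proof -
  obtain x where x: "U = ext_class S x" "keys x \<subseteq> lists S"
    using assms(2) unfolding carrier_exterior by blast
  then have "x \<in> ext_ideal2 S"
    using assms by (intro word_eval_ext_gen_kernel) (auto simp: ext_eval_class)
  then obtain a y where y: "x = a + y + y" "a \<in> ext_ideal S" "keys y \<subseteq> lists S"
    unfolding ext_ideal2_def by blast
  then have "U = ext_class S y \<otimes>\<^bsub>exterior S\<^esub> ext_class S y"
    by (simp add: x(1) mult_exterior ext_class_eq_iff)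
  then show ?thesis using y(3) unfolding carrier_exterior by blast
qed

section \<open>Labellings of the circles, compared with wedges of circles\<close>

definition label_eval :: "('s \<Rightarrow> 'r::comm_ring_1) \<Rightarrow> 's set \<Rightarrow> (('s \<Rightarrow> gen) \<Rightarrow>\<^sub>0 int) \<Rightarrow> 'r" where
  "label_eval \<theta> S = lin_ext (\<lambda>l. \<Prod>K\<in>{K \<in> S. l K = T}. \<theta> K)"

lemma label_eval_kernel:
  assumes "finite S" "x \<in> carrier (A_power S)" "label_eval ext_gen S x = 0"
  shows "\<exists>y\<in>carrier (A_power S). x = y \<otimes>\<^bsub>A_power S\<^esub> y"
proof -
  have "inj_on (\<lambda>l. {K \<in> S. l K = T}) (S \<rightarrow>\<^sub>E UNIV)"
  proof (rule inj_onI)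
    fix l m assume lm: "l \<in> S \<rightarrow>\<^sub>E UNIV" "m \<in> S \<rightarrow>\<^sub>E UNIV" "{K \<in> S. l K = T} = {K \<in> S. m K = T}"
    have "l K = m K" if "K \<in> S" for K
      using eqset_imp_iff[OF lm(3), of K] that by (cases "l K"; cases "m K") auto
    then show "l = m" using lm(1,2) by (intro PiE_ext) auto
  qed
  then obtain y where "x = y + y" "keys y \<subseteq> S \<rightarrow>\<^sub>E UNIV"
    using lin_ext_prod_ext_gen_kernel[of x "S \<rightarrow>\<^sub>E UNIV" "\<lambda>l. {K \<in> S. l K = T}"] assms
    by (auto simp: A_power_def label_eval_def)
  then show ?thesis by (auto simp: A_power_def)
qed

text \<open>The alternative \<open>f k = 0\<close> accommodates words with a repeated letter, whose
  monomial vanishes.\<close>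

lemma lin_ext_image_subset:
  assumes "\<And>k. k \<in> K \<Longrightarrow> f k = 0 \<or> (\<exists>l\<in>L. f k = g l)"
  shows "lin_ext f ` {x. keys x \<subseteq> K} \<subseteq> lin_ext g ` {x. keys x \<subseteq> L}"
proof clarify
  fix x :: "'a \<Rightarrow>\<^sub>0 int" assume "keys x \<subseteq> K"
  then show "lin_ext f x \<in> lin_ext g ` {x. keys x \<subseteq> L}"
  proof (induction x rule: frag_induction)
    case zero
    then show ?case by (intro image_eqI[of _ _ 0]) auto
  next
    case (one k)
    from assms[OF this] show ?case
    proof
      assume "f k = 0"
      then show ?thesis by (intro image_eqI[of _ _ 0]) auto
    next
      assume "\<exists>l\<in>L. f k = g l"
      then obtain l where "l \<in> L" "f k = g l" by blast
      then show ?thesis by (intro image_eqI[of _ _ "frag_of l"]) auto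
    qed
  next
    case (diff a b)
    then obtain y z where "keys y \<subseteq> L" "keys z \<subseteq> L" "lin_ext f a = lin_ext g y" "lin_ext f b = lin_ext g z"
      by blast
    then show ?case using keys_diff[of y z] by (intro image_eqI[of _ _ "y - z"]) auto
  qed
qed

text \<open>Each circle contributes -1, and 2 more when it carries \<open>T\<close>. Up to the
  common shift by \<open>n\<close>, this is the degree of a wedge of as many circles as there are
  labels \<open>T\<close>.\<close>

lemma label_degree:
  assumes "finite S"
  shows "(\<Sum>K\<in>S. gen_deg (l K)) = 2 * int (card {K \<in> S. l K = T}) - int (card S)"
proof -
  have "gen_deg (l K) = 2 * (if l K = T then 1 else 0) - 1" for K by (cases "l K") auto
  then show ?thesis using assms
    by (simp add: sum_subtractf flip: sum_distrib_left) (simp add: sum.If_cases Int_def)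
qed

text \<open>Labellings by \<open>1\<close> and \<open>t\<close> correspond to the words listing the elements labelled \<open>t\<close>.\<close>

lemma label_eval_image_eq_ext_eval_image:
  assumes "finite S"
  shows "label_eval ext_gen S ` {x. keys x \<subseteq> {l \<in> S \<rightarrow>\<^sub>E UNIV. P (card {K \<in> S. l K = T})}} =
    ext_eval ` ext_class S ` {x. keys x \<subseteq> {w \<in> lists S. P (length w)}}" (is "?L = ?R")
proof -
  let ?X = "{l \<in> S \<rightarrow>\<^sub>E UNIV. P (card {K \<in> S. l K = T})}" and ?Y = "{w \<in> lists S. P (length w)}"
  have R: "?R = word_eval ext_gen ` {x. keys x \<subseteq> ?Y}"
    by (simp add: image_image ext_eval_class)
  show ?thesis unfolding R label_eval_def word_eval_def
  proof (intro equalityI lin_ext_image_subset)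
    fix l assume l: "l \<in> ?X"
    have w: "distinct (set_word {K \<in> S. l K = T})" "set (set_word {K \<in> S. l K = T}) = {K \<in> S. l K = T}"
      using set_word[of "{K \<in> S. l K = T}"] assms by auto
    then have "set_word {K \<in> S. l K = T} \<in> ?Y" using l by (auto simp flip: distinct_card)
    moreover have "(\<Prod>K\<in>{K \<in> S. l K = T}. ext_gen K) = (\<Prod>s\<leftarrow>set_word {K \<in> S. l K = T}. ext_gen s)"
      using w by (simp add: word_eval_ext_gen)
    ultimately show "(\<Prod>K\<in>{K \<in> S. l K = T}. ext_gen K) = 0 \<or>
        (\<exists>w\<in>?Y. (\<Prod>K\<in>{K \<in> S. l K = T}. ext_gen K) = (\<Prod>s\<leftarrow>w. ext_gen s))"
      by blast
  next
    fix w assume w: "w \<in> ?Y"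
    show "(\<Prod>s\<leftarrow>w. ext_gen s) = 0 \<or>
        (\<exists>l\<in>?X. (\<Prod>s\<leftarrow>w. ext_gen s) = (\<Prod>K\<in>{K \<in> S. l K = T}. ext_gen K))"
    proof (cases "distinct w")
      case True
      let ?l = "\<lambda>K\<in>S. if K \<in> set w then T else Unit"
      have "{K \<in> S. ?l K = T} = set w" using w by auto
      moreover from this have "?l \<in> ?X" using w True by (simp add: distinct_card)
      ultimately show ?thesis using True by (intro disjI2 bexI[of _ ?l]) (simp_all add: word_eval_ext_gen)
    qed (simp add: word_eval_ext_gen)
  qed
qed

section \<open>Components of a graph\<close>

lemma in_circle_through: "w \<in> circle_through E v \<longleftrightarrow> (v, w) \<in> (edge_rel E)\<^sup>*"
  by (simp add: circle_through_def)

lemma circle_through_self [simp]: "v \<in> circle_through E v"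
  by (simp add: in_circle_through)

lemma circle_through_eq_iff: "circle_through E v = circle_through E w \<longleftrightarrow> w \<in> circle_through E v"
proof -
  have "sym ((edge_rel E)\<^sup>*)" by (intro sym_rtrancl symI) (simp add: edge_rel_def insert_commute)
  then have "equiv UNIV ((edge_rel E)\<^sup>*)"
    by (intro equivI) (auto intro: refl_rtrancl trans_rtrancl)
  then show ?thesis unfolding circle_through_def by (simp add: eq_equiv_class_iff)
qed

lemma circle_through_edge: "{v, w} \<in> E \<Longrightarrow> circle_through E v = circle_through E w"
  unfolding circle_through_eq_iff in_circle_through by (rule r_into_rtrancl) (simp add: edge_rel_def)

lemma circle_through_subset:
  assumes "v \<in> K" "\<And>x y. x \<in> K \<Longrightarrow> {x, y} \<in> E \<Longrightarrow> y \<in> K"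
  shows "circle_through E v \<subseteq> K"
proof
  fix w assume "w \<in> circle_through E v"
  then have "(v, w) \<in> (edge_rel E)\<^sup>*" by (simp add: in_circle_through)
  then show "w \<in> K"
    by induction (use assms in \<open>auto simp: edge_rel_def\<close>)
qed

lemma circle_through_disjoint:
  "x \<in> circle_through E v \<Longrightarrow> x \<in> circle_through E w \<Longrightarrow> circle_through E v = circle_through E w"
  by (metis circle_through_eq_iff)

section \<open>Surgery\<close>

text \<open>The arcs \<open>{u, v}\<close> and \<open>{u', v'}\<close> are replaced by the segments
  \<open>{u, u'}\<close> and \<open>{v, v'}\<close>. Edges among the four ends are otherwise left
  unconstrained, because edge sets forget multiplicities: an old arc that is also an arc of an outer
  matching is still an edge afterwards.\<close>

locale surgery =
  fixes E E' :: "'v set set" and u v u' v' :: 'v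
  assumes E_old: "{u, v} \<in> E" "{u', v'} \<in> E" and E_new: "{u, u'} \<in> E'" "{v, v'} \<in> E'"
    and same: "\<And>x y. x \<notin> {u, v, u', v'} \<Longrightarrow> {x, y} \<in> E \<longleftrightarrow> {x, y} \<in> E'"
    and same_ends: "\<And>x y. x \<in> {u, v, u', v'} \<Longrightarrow> {x, y} \<in> E \<Longrightarrow> y \<in> {u, v, u', v'} \<or> {x, y} \<in> E'"
      "\<And>x y. x \<in> {u, v, u', v'} \<Longrightarrow> {x, y} \<in> E' \<Longrightarrow> y \<in> {u, v, u', v'} \<or> {x, y} \<in> E"
begin

text \<open>Each side contains all four ends and is closed under the edges of the other
  graph.\<close>

lemma surgery_union:
  "circle_through E u \<union> circle_through E u' = circle_through E' u \<union> circle_through E' v" (is "?K = ?K'")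
proof -
  have E: "circle_through E u = circle_through E v" "circle_through E u' = circle_through E v'"
    by (rule E_old[THEN circle_through_edge])+
  have E': "circle_through E' u = circle_through E' u'" "circle_through E' v = circle_through E' v'"
    by (rule E_new[THEN circle_through_edge])+
  have K: "{u, v, u', v'} \<subseteq> ?K"
    using E circle_through_self[of u E] circle_through_self[of v E]
      circle_through_self[of u' E] circle_through_self[of v' E] by simp
  have K': "{u, v, u', v'} \<subseteq> ?K'"
    using E' circle_through_self[of u E'] circle_through_self[of v E']
      circle_through_self[of u' E'] circle_through_self[of v' E'] by simp
  have step: "y \<in> circle_through F z" if "x \<in> circle_through F z" "{x, y} \<in> F" for F and x y z :: 'v
    using circle_through_edge[OF that(2)] that(1) circle_through_eq_iff by metis
  have clK: "y \<in> ?K" if "x \<in> ?K" "{x, y} \<in> E'" for x y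
  proof -
    have "y \<in> {u, v, u', v'} \<or> {x, y} \<in> E" using same[of x y] same_ends(2)[of x y] that(2) by blast
    then show ?thesis
    proof
      assume "{x, y} \<in> E"
      then show ?thesis using that(1) step[of x E u y] step[of x E u' y] by blast
    qed (use K in blast)
  qed
  have clK': "y \<in> ?K'" if "x \<in> ?K'" "{x, y} \<in> E" for x y
  proof -
    have "y \<in> {u, v, u', v'} \<or> {x, y} \<in> E'" using same[of x y] same_ends(1)[of x y] that(2) by blast
    then show ?thesis
    proof
      assume "{x, y} \<in> E'"
      then show ?thesis using that(1) step[of x E' u y] step[of x E' v y] by blast
    qed (use K' in blast)
  qed
  have "circle_through E' w \<subseteq> ?K" if "w \<in> {u, v}" for w
    by (rule circle_through_subset) (use that K clK in auto)
  moreover have "circle_through E w \<subseteq> ?K'" if "w \<in> {u, u'}" for w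
    by (rule circle_through_subset) (use that K' clK' in auto)
  ultimately show ?thesis by blast
qed

text \<open>In both graphs the component of \<open>w\<close> avoids the four ends, and away from
  them the edges agree.\<close>

lemma surgery_other:
  assumes "w \<notin> circle_through E u \<union> circle_through E u'"
  shows "circle_through E' w = circle_through E w"
proof -
  have E: "circle_through E u = circle_through E v" "circle_through E u' = circle_through E v'"
    by (rule E_old[THEN circle_through_edge])+
  have E': "circle_through E' u = circle_through E' u'" "circle_through E' v = circle_through E' v'"
    by (rule E_new[THEN circle_through_edge])+
  have "circle_through E w \<noteq> circle_through E x" if "x \<in> {u, v, u', v'}" for x
    using that assms E circle_through_self[of w E] by auto
  then have w: "x \<notin> circle_through E w" if "x \<in> {u, v, u', v'}" for x
    using that circle_through_eq_iff by metis
  have "circle_through E' w \<noteq> circle_through E' x" if "x \<in> {u, v, u', v'}" for x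
    using that assms[unfolded surgery_union] E' circle_through_self[of w E'] by auto
  then have w': "x \<notin> circle_through E' w" if "x \<in> {u, v, u', v'}" for x
    using that circle_through_eq_iff by metis
  show ?thesis
  proof
    show "circle_through E' w \<subseteq> circle_through E w"
    proof (rule circle_through_subset)
      fix x y assume "x \<in> circle_through E w" "{x, y} \<in> E'"
      then have "{x, y} \<in> E" using w[of x] same[of x y] by blast
      then show "y \<in> circle_through E w"
        using \<open>x \<in> circle_through E w\<close> circle_through_edge circle_through_eq_iff by metis
    qed simp
    show "circle_through E w \<subseteq> circle_through E' w"
    proof (rule circle_through_subset)
      fix x y assume "x \<in> circle_through E' w" "{x, y} \<in> E"
      then have "{x, y} \<in> E'" using w'[of x] same[of x y] by blast
      then show "y \<in> circle_through E' w"
        using \<open>x \<in> circle_through E' w\<close> circle_through_edge circle_through_eq_iff by metis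
    qed simp
  qed
qed

end

subsection \<open>Composing a permutation with a transposition\<close>

text \<open>Think of \<open>f'\<close> as \<open>f\<close> preceded by the transposition of
  \<open>x\<close> and \<open>y\<close>: from its first step on, the path of \<open>y\<close> under
  \<open>f'\<close> follows the path of \<open>x\<close> under \<open>f\<close> until that path
  meets \<open>x\<close> or \<open>y\<close>.\<close>

lemma funpow_eq_on_segment:
  assumes "f' y = f x" "\<And>j. 1 \<le> j \<Longrightarrow> j < k \<Longrightarrow> (f ^^ j) x \<noteq> x \<and> (f ^^ j) x \<noteq> y"
    and "\<And>j. (f ^^ j) x \<noteq> x \<Longrightarrow> (f ^^ j) x \<noteq> y \<Longrightarrow> f' ((f ^^ j) x) = f ((f ^^ j) x)"
    and "1 \<le> j" "j \<le> k"
  shows "(f' ^^ j) y = (f ^^ j) x"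
  using assms(4,5)
proof (induction j)
  case (Suc j)
  then show ?case using assms(1-3) by (cases "j = 0") auto
qed simp

text \<open>If \<open>k\<close> is the first time at which \<open>f\<close> leads from
  \<open>x\<close> to \<open>y\<close>, then under \<open>f'\<close> the element \<open>y\<close>
  runs through the iterates of \<open>x\<close> under \<open>f\<close> at the times 1 to
  \<open>k\<close> and closes up at \<open>y\<close>, leaving out \<open>x\<close>.\<close>

lemma orbit_split:
  assumes f': "f' y = f x" "\<And>z. z \<in> X \<Longrightarrow> z \<noteq> x \<Longrightarrow> z \<noteq> y \<Longrightarrow> f' z = f z"
    and X: "x \<in> X" "\<And>z. z \<in> X \<Longrightarrow> f z \<in> X" and "x \<noteq> y" "(f ^^ i) x = y"
  shows "(f' ^^ j) y \<noteq> x"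
proof
  assume x: "(f' ^^ j) y = x"
  have inX: "(f ^^ j) x \<in> X" for j by (induction j) (use X in auto)
  define k where "k = (LEAST k. (f ^^ k) x = y)"
  have k: "(f ^^ k) x = y" unfolding k_def by (rule LeastI) (rule assms)
  have min: "(f ^^ j) x \<noteq> y" if "j < k" for j using that not_less_Least unfolding k_def by blast
  have "k \<noteq> 0" using k \<open>x \<noteq> y\<close> by (metis funpow_0)
  \<comment> \<open>A return to \<open>x\<close> at time \<open>j\<close> would let \<open>f\<close>
    reach \<open>y\<close> already at time \<open>k - j\<close>.\<close>
  have per: "(f ^^ j) x \<noteq> x" if "1 \<le> j" "j < k" for j
  proof
    assume "(f ^^ j) x = x"
    then have "(f ^^ (k - j)) x = (f ^^ (k - j + j)) x" by (simp only: funpow_add comp_apply)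
    also have "\<dots> = y" using k that by simp
    finally show False using min[of "k - j"] that by simp
  qed
  have seg: "(f' ^^ j) y = (f ^^ j) x" if "1 \<le> j" "j \<le> k" for j
    by (rule funpow_eq_on_segment[where k = k and f = f and f' = f' and x = x and y = y, OF f'(1)]) (use that per min f'(2)[OF inX] in auto)
  have "(f' ^^ k) y = y" using seg[of k] k \<open>k \<noteq> 0\<close> by simp
  then have "(f' ^^ (j mod k)) y = x" using x funpow_mod_eq by metis
  moreover have "(f' ^^ (j mod k)) y = (f ^^ (j mod k)) x" if "j mod k \<noteq> 0"
    using seg[of "j mod k"] that \<open>k \<noteq> 0\<close> by (simp add: less_imp_le)
  ultimately show False
    using per[of "j mod k"] \<open>x \<noteq> y\<close> \<open>k \<noteq> 0\<close> by (cases "j mod k = 0") auto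
qed

text \<open>Finiteness and injectivity make \<open>x\<close> periodic under \<open>f\<close>. Its
  cycle avoids \<open>y\<close>, so after one full period \<open>f'\<close> leads from
  \<open>y\<close> to \<open>x\<close>.\<close>

lemma orbit_merge:
  assumes f': "f' y = f x" "\<And>z. z \<in> X \<Longrightarrow> z \<noteq> x \<Longrightarrow> z \<noteq> y \<Longrightarrow> f' z = f z"
    and X: "x \<in> X" "bij_betw f X X" "finite X" and y: "\<And>i. (f ^^ i) x \<noteq> y"
  shows "\<exists>j. (f' ^^ j) y = x"
proof -
  have fX: "f z \<in> X" if "z \<in> X" for z using X(2) that by (rule bij_betw_apply)
  have inX: "(f ^^ j) x \<in> X" for j by (induction j) (use X fX in auto)
  have "\<exists>k\<ge>1. (f ^^ k) x = x"
  proof -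
    have "finite (range (\<lambda>j. (f ^^ j) x))" using inX X(3) by (auto intro: finite_subset[of _ X])
    then have "\<not> inj (\<lambda>j. (f ^^ j) x)" using range_inj_infinite by blast
    then obtain i j where ij: "i < j" "(f ^^ i) x = (f ^^ j) x"
      by (auto simp: inj_def) (metis linorder_neqE_nat)
    have pow_X: "(f ^^ i) z \<in> X" if "z \<in> X" for i z by (induction i) (use that fX in auto)
    have "inj_on (f ^^ i) X"
    proof (induction i)
      case (Suc i)
      have "inj_on f ((f ^^ i) ` X)"
        using bij_betw_imp_inj_on[OF X(2)] by (rule inj_on_subset) (use pow_X in auto)
      then have "inj_on (f \<circ> f ^^ i) X" using Suc by (intro comp_inj_on)
      then show ?case by (simp only: funpow.simps)
    qed simp
    moreover have "(f ^^ i) ((f ^^ (j - i)) x) = (f ^^ i) x"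
      using ij by (simp flip: funpow_add comp_apply[of "f ^^ i"])
    ultimately have "(f ^^ (j - i)) x = x" using inX X(1) by (meson inj_onD)
    then show ?thesis using ij by (intro exI[of _ "j - i"]) auto
  qed
  then obtain k0 where k0: "1 \<le> k0" "(f ^^ k0) x = x" by blast
  define k where "k = (LEAST k. 1 \<le> k \<and> (f ^^ k) x = x)"
  have k: "1 \<le> k" "(f ^^ k) x = x" using LeastI[of "\<lambda>k. 1 \<le> k \<and> (f ^^ k) x = x" k0] k0 unfolding k_def by auto
  have "(f ^^ j) x \<noteq> x" if "1 \<le> j" "j < k" for j
    using that not_less_Least[of j "\<lambda>k. 1 \<le> k \<and> (f ^^ k) x = x"] unfolding k_def by blast
  then have "(f' ^^ k) y = (f ^^ k) x"
    using y f'(2)[OF inX] k(1) by (intro funpow_eq_on_segment[where k = k and f = f and f' = f' and x = x and y = y, OF f'(1)]) auto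
  then show ?thesis using k(2) by auto
qed

subsection \<open>Surgery on a union of two matchings\<close>

text \<open>The union of two perfect matchings of a bipartite graph is given by two involutions
  exchanging the colours. On the vertices of one colour, its components are the orbits of the composition.\<close>

locale bicoloured_matchings =
  fixes V Bl :: "'v set" and m1 m2 :: "'v \<Rightarrow> 'v" and E :: "'v set set"
  assumes fin: "finite V"
    and m1: "\<And>x. x \<in> V \<Longrightarrow> m1 x \<in> V \<and> m1 (m1 x) = x \<and> (m1 x \<in> Bl \<longleftrightarrow> x \<notin> Bl)"
    and m2: "\<And>x. x \<in> V \<Longrightarrow> m2 x \<in> V \<and> m2 (m2 x) = x \<and> (m2 x \<in> Bl \<longleftrightarrow> x \<notin> Bl)"
    and E: "\<And>x y. x \<in> V \<Longrightarrow> {x, y} \<in> E \<longleftrightarrow> y = m1 x \<or> y = m2 x"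
begin

lemma bij: "bij_betw (m1 \<circ> m2) (V \<inter> Bl) (V \<inter> Bl)"
  by (rule bij_betw_byWitness[where f' = "m2 \<circ> m1"]) (use m1 m2 in auto)

text \<open>The orbit together with its image under \<open>m1\<close> is closed under all edges, and
  \<open>m1\<close> changes the colour, so the component meets the colour class in the orbit alone.
  Backward steps stay in the orbit, since it is finite and mapped injectively into itself, hence
  onto itself.\<close>

lemma in_circle_through_iff_orbit:
  assumes "x \<in> V \<inter> Bl" "y \<in> V \<inter> Bl"
  shows "y \<in> circle_through E x \<longleftrightarrow> (\<exists>k. ((m1 \<circ> m2) ^^ k) x = y)"
proof -
  let ?f = "m1 \<circ> m2"
  define Or where "Or = {z. \<exists>k. (?f ^^ k) x = z}"
  have f: "?f z \<in> V \<inter> Bl" if "z \<in> V \<inter> Bl" for z using bij that by (rule bij_betw_apply)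
  have Or: "Or \<subseteq> V \<inter> Bl"
  proof -
    have "(?f ^^ k) x \<in> V \<inter> Bl" for k by (induction k) (use assms f in auto)
    then show ?thesis by (auto simp: Or_def)
  qed
  have Or_f: "?f z \<in> Or" if "z \<in> Or" for z
  proof -
    obtain k where "(?f ^^ k) x = z" using \<open>z \<in> Or\<close> by (auto simp: Or_def)
    then have "(?f ^^ Suc k) x = ?f z" by simp
    then show ?thesis unfolding Or_def by blast
  qed
  have "?f ` Or = Or"
    by (rule endo_inj_surj) (use Or fin Or_f bij in \<open>auto intro: finite_subset inj_on_subset[OF bij_betw_imp_inj_on]\<close>)
  have Or_inv: "m2 (m1 z) \<in> Or" if "z \<in> Or" for z
  proof -
    obtain z' where z': "z' \<in> Or" "z = m1 (m2 z')" using \<open>?f ` Or = Or\<close> \<open>z \<in> Or\<close> by (metis comp_apply imageE)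
    then have "z' \<in> V" using Or by auto
    then have "m2 (m1 z) = z'" using z' m1 m2 by simp
    then show ?thesis using z' by simp
  qed
  have x: "x \<in> Or" unfolding Or_def by (auto intro: exI[of _ 0])
  show ?thesis
  proof
    assume "y \<in> circle_through E x"
    moreover have "circle_through E x \<subseteq> Or \<union> m1 ` Or"
    proof (rule circle_through_subset)
      fix w z assume w: "w \<in> Or \<union> m1 ` Or" and wz: "{w, z} \<in> E"
      have "w \<in> V" using w Or m1 by auto
      then have z: "z = m1 w \<or> z = m2 w" using wz E by simp
      from w show "z \<in> Or \<union> m1 ` Or"
      proof
        assume "w \<in> Or"
        have "m2 w = m1 (?f w)" using m1 m2 \<open>w \<in> V\<close> by simp
        then show ?thesis using z Or_f[OF \<open>w \<in> Or\<close>] \<open>w \<in> Or\<close> by auto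
      next
        assume "w \<in> m1 ` Or"
        then obtain o' where o': "w = m1 o'" "o' \<in> Or" by blast
        then have "m1 w = o'" using m1 Or by auto
        then show ?thesis using z o' Or_inv by auto
      qed
    qed (use x in simp)
    moreover have "y \<notin> m1 ` Or" using Or m1 assms by auto
    ultimately have "y \<in> Or" by blast
    then show "\<exists>k. (?f ^^ k) x = y" by (simp add: Or_def)
  next
    assume "\<exists>k. (?f ^^ k) x = y"
    then obtain k where "(?f ^^ k) x = y" ..
    moreover have "(?f ^^ k) x \<in> V \<inter> circle_through E x" for k
    proof (induction k)
      case 0
      then show ?case using assms by simp
    next
      case (Suc k)
      let ?z = "(?f ^^ k) x"
      have V: "?z \<in> V" using Suc by blast
      then have V2: "m2 ?z \<in> V" using m2 by blast
      have "{?z, m2 ?z} \<in> E" "{m2 ?z, m1 (m2 ?z)} \<in> E" using E[OF V] E[OF V2] by blast+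
      then have "circle_through E ?z = circle_through E (?f ?z)" using circle_through_edge by (metis comp_apply)
      then have "?f ?z \<in> circle_through E x" using Suc circle_through_eq_iff by (metis IntD2)
      moreover have "?f ?z \<in> V" using m1[OF V2] by simp
      ultimately have "?f ?z \<in> V \<inter> circle_through E x" by (rule IntI[rotated])
      moreover have "(?f ^^ Suc k) x = ?f ?z" unfolding funpow.simps(2) by (rule comp_apply)
      ultimately show ?case by (rule back_subst[where P = "\<lambda>w. w \<in> _", OF _ sym])
    qed
    ultimately show "y \<in> circle_through E x" by blast
  qed
qed

end

text \<open>On the colour class of \<open>u\<close>, which also contains \<open>v'\<close>, the
  permutation \<open>m1 \<circ> m2'\<close> is \<open>m1 \<circ> m2\<close> preceded by the
  transposition of \<open>u\<close> and \<open>v'\<close>. A transposition cuts a cycle through both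
  points and joins two cycles otherwise.\<close>

lemma surgery_splits_iff:
  assumes E: "bicoloured_matchings V Bl m1 m2 E" and E': "bicoloured_matchings V Bl m1 m2' E'"
    and V: "u \<in> V" "u' \<in> V" and Bl: "u \<in> Bl" "u' \<notin> Bl" and "u \<noteq> v'"
    and m: "m2 u = v" "m2 u' = v'" "m2' u = u'" "m2' v = v'"
    and same: "\<And>x. x \<in> V \<Longrightarrow> x \<notin> {u, v, u', v'} \<Longrightarrow> m2' x = m2 x"
  shows "circle_through E u = circle_through E u' \<longleftrightarrow> circle_through E' u \<noteq> circle_through E' v"
proof -
  interpret E: bicoloured_matchings V Bl m1 m2 E by (rule E)
  interpret E': bicoloured_matchings V Bl m1 m2' E' by (rule E')
  have vV: "v \<in> V" "v' \<in> V" "v \<notin> Bl" "v' \<in> Bl" using E.m2[OF V(1)] E.m2[OF V(2)] m Bl by simp_all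
  have inv: "m2 v' = u'" "m2' v' = v" "m2 v = u" using m E.m2[OF V(2)] E'.m2[OF vV(1)] E.m2[OF V(1)] by simp_all
  have u: "u \<in> V \<inter> Bl" "v' \<in> V \<inter> Bl" using V vV Bl by auto
  have f: "(m1 \<circ> m2') v' = (m1 \<circ> m2) u" using inv m by simp
  have f_same: "(m1 \<circ> m2') z = (m1 \<circ> m2) z" if "z \<in> V \<inter> Bl" "z \<noteq> u" "z \<noteq> v'" for z
  proof -
    have "z \<notin> {u, v, u', v'}" using that vV Bl by auto
    then show ?thesis using same[of z] that by simp
  qed
  have "{u, v} \<in> E" "{u', v'} \<in> E" "{u, u'} \<in> E'" "{v, v'} \<in> E'"
    using E.E[of u v] E.E[of u' v'] E'.E[of u u'] E'.E[of v v'] V vV m by auto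
  then have c: "circle_through E u' = circle_through E v'" "circle_through E' v = circle_through E' v'"
    by (blast dest: circle_through_edge)+
  have "v' \<in> circle_through E u \<longleftrightarrow> \<not> u \<in> circle_through E' v'"
    unfolding E.in_circle_through_iff_orbit[OF u] E'.in_circle_through_iff_orbit[OF u(2) u(1)]
  proof
    assume "\<exists>k. ((m1 \<circ> m2) ^^ k) u = v'"
    then obtain k where "((m1 \<circ> m2) ^^ k) u = v'" ..
    from orbit_split[where X = "V \<inter> Bl", OF f f_same u(1) bij_betw_apply[OF E.bij] \<open>u \<noteq> v'\<close> this]
    show "\<not> (\<exists>k. ((m1 \<circ> m2') ^^ k) v' = u)" by blast
  next
    assume "\<not> (\<exists>k. ((m1 \<circ> m2') ^^ k) v' = u)"
    with orbit_merge[where X = "V \<inter> Bl", OF f f_same u(1) E.bij finite_Int] E.fin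
    show "\<exists>k. ((m1 \<circ> m2) ^^ k) u = v'" by blast
  qed
  then show ?thesis using c circle_through_eq_iff by metis
qed

section \<open>Crossingless matchings are bipartite\<close>

definition partner :: "matching \<Rightarrow> nat \<Rightarrow> nat" where
  "partner a p = (THE q. {p, q} \<in> a)"

context
  fixes n a assumes a: "a \<in> B n"
begin

lemma B_partition: "\<Union>a = points n" "disjoint a" "e \<in> a \<Longrightarrow> card e = 2"
  "e \<in> a \<Longrightarrow> f \<in> a \<Longrightarrow> e \<noteq> f \<Longrightarrow> half_circle e \<inter> half_circle f = {}"
  using a by (auto simp: B_def partition_on_def disjoint_family_on_def)

lemma B_arc_unique: "e \<in> a \<Longrightarrow> f \<in> a \<Longrightarrow> p \<in> e \<Longrightarrow> p \<in> f \<Longrightarrow> e = f"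
  using B_partition(2) by (auto simp: disjoint_def)

lemma B_arc_cases:
  assumes "e \<in> a"
  obtains p q where "e = {p, q}" "p < q" "p \<in> points n" "q \<in> points n"
proof -
  obtain p q where "e = {p, q}" "p \<noteq> q" using B_partition(3)[OF assms] by (auto simp: card_2_iff)
  moreover have "e \<subseteq> points n" using assms B_partition(1) by blast
  ultimately show thesis using that[of p q] that[of q p] by (cases p q rule: linorder_cases) (auto simp: insert_commute)
qed

lemma B_arc_at: "p \<in> points n \<Longrightarrow> arc_at a p \<in> a \<and> p \<in> arc_at a p"
proof -
  assume "p \<in> points n"
  then have "p \<in> \<Union>a" using B_partition(1) by simp
  then obtain e where e: "e \<in> a" "p \<in> e" by (rule UnionE)
  show ?thesis unfolding arc_at_def
  proof (rule theI)
    show "e \<in> a \<and> p \<in> e" using e by simp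
    show "f = e" if "f \<in> a \<and> p \<in> f" for f using that e B_arc_unique[of f e p] by simp
  qed
qed

lemma B_arc_at_eq: "e \<in> a \<Longrightarrow> p \<in> e \<Longrightarrow> arc_at a p = e"
  unfolding arc_at_def by (rule the_equality) (auto dest: B_arc_unique[of e _ p])

lemma B_partner: "{p, q} \<in> a \<longleftrightarrow> p \<in> points n \<and> q = partner a p"
proof -
  have *: "\<exists>!q. {p, q} \<in> a" if "p \<in> points n"
  proof -
    note arc = B_arc_at[OF that]
    obtain x y where xy: "arc_at a p = {x, y}" "x < y" using arc B_arc_cases[of "arc_at a p"] by metis
    then obtain q where q: "arc_at a p = {p, q}" using arc by (cases "p = x") auto
    show ?thesis
    proof (rule ex1I[of _ q])
      show "{p, q} \<in> a" using arc q by simp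
      fix r assume "{p, r} \<in> a"
      then have "{p, r} = {p, q}" using B_arc_unique[of "{p, r}" "arc_at a p" p] arc q by simp
      then show "r = q" by (auto simp: doubleton_eq_iff)
    qed
  qed
  have "p \<in> points n" if "{p, q} \<in> a" using that B_partition(1) by blast
  moreover have "{p, q} \<in> a \<longleftrightarrow> q = partner a p" if "p \<in> points n"
    unfolding partner_def using theI'[OF *[OF that]] the1_equality[OF *[OF that]] by metis
  ultimately show ?thesis by blast
qed

lemma B_partner_simps:
  assumes "p \<in> points n"
  shows "partner a p \<in> points n" "partner a (partner a p) = p" "partner a p \<noteq> p"
proof -
  have arc: "{p, partner a p} \<in> a" using assms B_partner by blast
  then show "partner a p \<in> points n" using B_partition(1) by blast
  show "partner a (partner a p) = p" using arc B_partner[of "partner a p" p] by (simp add: insert_commute)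
  show "partner a p \<noteq> p" using B_partition(3)[OF arc] by auto
qed

text \<open>The arcs with one end below a given arc lie entirely below it, so they pair off the points there.\<close>

lemma B_arc_parity:
  assumes "{p, q} \<in> a"
  shows "even p \<longleftrightarrow> odd q"
proof -
  have main: "odd (q - p)" if pq: "{p, q} \<in> a" "p < q" for p q
  proof -
    let ?I = "{p<..<q}"
    have below: "e \<subseteq> ?I" if e: "e \<in> a" "e \<inter> ?I \<noteq> {}" for e
    proof -
      obtain x y where xy: "e = {x, y}" "x < y" using B_arc_cases[OF e(1)] by metis
      have "e \<noteq> {p, q}" using e(2) by auto
      then have "e \<inter> {p, q} = {}" using B_arc_unique[OF e(1) pq(1)] by auto
      moreover have "half_circle {p, q} \<inter> half_circle e = {}"
        using B_partition(4)[OF pq(1) e(1)] \<open>e \<noteq> {p, q}\<close> by simp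
      ultimately show ?thesis
        using half_circles_disjoint_iff[OF pq(2) xy(2)] e(2) xy by auto
    qed
    have "q \<in> points n" "p \<in> points n" using pq B_partition(1) by auto
    then have "?I \<subseteq> points n" by (auto simp: points_def)
    then have I: "?I = \<Union>{e \<in> a. e \<subseteq> ?I}" using below B_arc_at by (fastforce intro!: equalityI)
    have "card ?I = (\<Sum>e\<in>{e \<in> a. e \<subseteq> ?I}. card e)"
      by (subst I, rule card_Union_disjoint)
        (use B_partition(2) in \<open>auto simp: pairwise_def disjnt_def disjoint_def intro: finite_subset\<close>)
    also have "\<dots> = (\<Sum>e\<in>{e \<in> a. e \<subseteq> ?I}. 2)" by (intro sum.cong) (auto simp: B_partition(3))
    finally have "even (card ?I)" by simp
    then show ?thesis using pq(2) by auto
  qed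
  have "p \<noteq> q" using B_partition(3)[OF assms] by auto
  then show ?thesis
    using main[of p q] main[of q p] assms by (cases p q rule: linorder_cases) (auto simp: insert_commute)
qed

end

section \<open>Stacked matchings\<close>

lemma Inl_doubleton_simps:
  fixes w :: "'a + 'a"
  shows "{Inl p, w} \<in> (`) Inl ` c \<longleftrightarrow> (\<exists>q. w = Inl q \<and> {p, q} \<in> c)"
  "{Inl p, w} \<in> (`) Inr ` c \<longleftrightarrow> False"
  "{Inl p, w} \<in> {{Inl p, Inr p} | p. p \<in> X} \<longleftrightarrow> w = Inr p \<and> p \<in> X"
proof -
  show "{Inl p, w} \<in> (`) Inl ` c \<longleftrightarrow> (\<exists>q. w = Inl q \<and> {p, q} \<in> c)"
  proof
    assume "{Inl p, w} \<in> (`) Inl ` c"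
    then obtain e where e: "e \<in> c" "{Inl p, w} = Inl ` e" by blast
    then obtain q where q: "w = Inl q" by blast
    then have "Inl ` {p, q} = (Inl ` e :: ('a + 'a) set)" using e(2) by simp
    then have "{p, q} = e" by (subst (asm) inj_image_eq_iff) simp_all
    then show "\<exists>q. w = Inl q \<and> {p, q} \<in> c" using q e(1) by blast
  next
    assume "\<exists>q. w = Inl q \<and> {p, q} \<in> c"
    then obtain q where q: "w = Inl q" "{p, q} \<in> c" by blast
    then have "{Inl p, w} = Inl ` {p, q}" by simp
    then show "{Inl p, w} \<in> (`) Inl ` c" using q(2) by (rule image_eqI)
  qed
  show "{Inl p, w} \<in> (`) Inr ` c \<longleftrightarrow> False" by blast
  show "{Inl p, w} \<in> {{Inl p, Inr p} | p. p \<in> X} \<longleftrightarrow> w = Inr p \<and> p \<in> X"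
    by (auto simp: doubleton_eq_iff)
qed

lemma Inr_doubleton_simps:
  fixes w :: "'a + 'a"
  shows "{Inr p, w} \<in> (`) Inr ` c \<longleftrightarrow> (\<exists>q. w = Inr q \<and> {p, q} \<in> c)"
  "{Inr p, w} \<in> (`) Inl ` c \<longleftrightarrow> False"
  "{Inr p, w} \<in> {{Inl p, Inr p} | p. p \<in> X} \<longleftrightarrow> w = Inl p \<and> p \<in> X"
proof -
  show "{Inr p, w} \<in> (`) Inr ` c \<longleftrightarrow> (\<exists>q. w = Inr q \<and> {p, q} \<in> c)"
  proof
    assume "{Inr p, w} \<in> (`) Inr ` c"
    then obtain e where e: "e \<in> c" "{Inr p, w} = Inr ` e" by blast
    then obtain q where q: "w = Inr q" by blast
    then have "Inr ` {p, q} = (Inr ` e :: ('a + 'a) set)" using e(2) by simp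
    then have "{p, q} = e" by (subst (asm) inj_image_eq_iff) simp_all
    then show "\<exists>q. w = Inr q \<and> {p, q} \<in> c" using q e(1) by blast
  next
    assume "\<exists>q. w = Inr q \<and> {p, q} \<in> c"
    then obtain q where q: "w = Inr q" "{p, q} \<in> c" by blast
    then have "{Inr p, w} = Inr ` {p, q}" by simp
    then show "{Inr p, w} \<in> (`) Inr ` c" using q(2) by (rule image_eqI)
  qed
  show "{Inr p, w} \<in> (`) Inl ` c \<longleftrightarrow> False" by blast
  show "{Inr p, w} \<in> {{Inl p, Inr p} | p. p \<in> X} \<longleftrightarrow> w = Inl p \<and> p \<in> X"
    by (auto simp: doubleton_eq_iff)
qed

locale stack =
  fixes n c b a
  assumes c: "c \<in> B n" and b: "b \<in> B n" and a: "a \<in> B n"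
begin

abbreviation "Vt \<equiv> points n <+> points n"

abbreviation "SC P \<equiv> stacked_circles n c b a P"

abbreviation circ :: "nat set set \<Rightarrow> nat + nat \<Rightarrow> (nat + nat) set" where
  "circ P v \<equiv> circle_through (stacked c b a P) v"

abbreviation crossed :: "nat set set \<Rightarrow> nat \<Rightarrow> bool" where
  "crossed P p \<equiv> p \<in> \<Union>P"

text \<open>The stacked graph is the union of two perfect matchings, given as involutions: the arcs
  of \<open>c\<close> and \<open>a\<close>, which no surgery touches, and the copies of arcs of
  \<open>b\<close> together with the vertical segments, which depend on the stage
  \<open>P\<close>.\<close>

definition outer :: "nat + nat \<Rightarrow> nat + nat" where
  "outer v = (case v of Inl p \<Rightarrow> Inl (partner c p) | Inr p \<Rightarrow> Inr (partner a p))"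

definition inner :: "nat set set \<Rightarrow> nat + nat \<Rightarrow> nat + nat" where
  "inner P v = (case v of Inl p \<Rightarrow> if crossed P p then Inr p else Inl (partner b p)
                        | Inr p \<Rightarrow> if crossed P p then Inl p else Inr (partner b p))"

lemma uncrossed_arc_iff:
  assumes "P \<subseteq> b"
  shows "{p, q} \<in> b - P \<longleftrightarrow> p \<in> points n \<and> q = partner b p \<and> \<not> crossed P p"
proof -
  have "{p, q} \<in> P \<longleftrightarrow> crossed P p" if "{p, q} \<in> b"
    using B_arc_unique[OF b that] assms by blast
  then show ?thesis using B_partner[OF b] by auto
qed

lemma crossed_points: "P \<subseteq> b \<Longrightarrow> crossed P p \<Longrightarrow> p \<in> points n"
  using B_partition(1)[OF b] by blast

lemma stacked_edge_iff:
  assumes "P \<subseteq> b"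
  shows "{v, w} \<in> stacked c b a P \<longleftrightarrow> v \<in> Vt \<and> (w = outer v \<or> w = inner P v)"
proof (cases v)
  case (Inl p)
  then show ?thesis
    using crossed_points[OF assms, of p]
    unfolding stacked_def Un_iff Inl Inl_doubleton_simps uncrossed_arc_iff[OF assms] B_partner[OF c]
    by (auto simp: outer_def inner_def)
next
  case (Inr p)
  then show ?thesis
    using crossed_points[OF assms, of p]
    unfolding stacked_def Un_iff Inr Inr_doubleton_simps uncrossed_arc_iff[OF assms] B_partner[OF a]
    by (auto simp: outer_def inner_def)
qed

text \<open>Parity is reversed on the lower copy so that the vertical segments, too, join different
  colours.\<close>

fun colour :: "nat + nat \<Rightarrow> bool" where
  "colour (Inl p) = even p"
| "colour (Inr p) = odd p"

lemma crossed_partner: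
  assumes "P \<subseteq> b" "p \<in> points n"
  shows "crossed P (partner b p) \<longleftrightarrow> crossed P p"
proof -
  have "{p, partner b p} \<in> b" using B_partner[OF b] assms(2) by blast
  then show ?thesis using B_arc_unique[OF b] assms(1) by blast
qed

lemma partner_parity: "d \<in> B n \<Longrightarrow> p \<in> points n \<Longrightarrow> even (partner d p) \<longleftrightarrow> odd p"
  using B_partner B_arc_parity by blast

text \<open>\<open>k\<close> is left open so that the colour class can be taken to be the one that
  contains the upper end at hand.\<close>

lemma bicoloured:
  assumes "P \<subseteq> b"
  shows "bicoloured_matchings Vt {v. colour v = k} outer (inner P) (stacked c b a P)"
proof
  show "finite Vt" by (simp add: points_def)
  show "outer v \<in> Vt \<and> outer (outer v) = v \<and> (outer v \<in> {v. colour v = k} \<longleftrightarrow> v \<notin> {v. colour v = k})" if "v \<in> Vt" for v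
    using that c a by (cases v) (auto simp: outer_def B_partner_simps partner_parity)
  show "inner P v \<in> Vt \<and> inner P (inner P v) = v \<and> (inner P v \<in> {v. colour v = k} \<longleftrightarrow> v \<notin> {v. colour v = k})" if "v \<in> Vt" for v
    using that b crossed_partner[OF assms] crossed_points[OF assms]
    by (cases v) (auto simp: inner_def B_partner_simps partner_parity)
  show "{v, w} \<in> stacked c b a P \<longleftrightarrow> w = outer v \<or> w = inner P v" if "v \<in> Vt" for v w
    using that stacked_edge_iff[OF assms] by blast
qed

context
  fixes P e i j assumes P: "P \<subseteq> b" and e: "e \<in> b" "e \<notin> P" "e = {i, j}"
begin

lemma arc_facts: "i \<in> points n" "j \<in> points n" "partner b i = j" "partner b j = i" "i \<noteq> j"
  "\<not> crossed P i" "\<not> crossed P j" "insert e P \<subseteq> b"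
proof -
  have ij: "{i, j} \<in> b - P" "{j, i} \<in> b - P" using e by (auto simp: insert_commute)
  then show "i \<in> points n" "j \<in> points n" "partner b i = j" "partner b j = i" "\<not> crossed P i" "\<not> crossed P j"
    unfolding uncrossed_arc_iff[OF P] by auto
  show "i \<noteq> j" using B_partition(3)[OF b e(1)] e(3) by auto
  show "insert e P \<subseteq> b" using P e by blast
qed

lemma inner_insert: "v \<notin> {Inl i, Inl j, Inr i, Inr j} \<Longrightarrow> inner (insert e P) v = inner P v"
  using e(3) by (cases v) (auto simp: inner_def)

lemma inner_ends:
  "inner P (Inl i) = Inl j" "inner P (Inr i) = Inr j" "inner P (Inl j) = Inl i" "inner P (Inr j) = Inr i"
  "inner (insert e P) (Inl i) = Inr i" "inner (insert e P) (Inl j) = Inr j"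
  "inner (insert e P) (Inr i) = Inl i" "inner (insert e P) (Inr j) = Inl j"
  using arc_facts e(3) by (auto simp: inner_def)

lemma is_surgery:
  "surgery (stacked c b a P) (stacked c b a (insert e P)) (Inl i) (Inl j) (Inr i) (Inr j)"
proof
  note edge = stacked_edge_iff[OF P] stacked_edge_iff[OF arc_facts(8)]
  show "{Inl i, Inl j} \<in> stacked c b a P" "{Inr i, Inr j} \<in> stacked c b a P"
    "{Inl i, Inr i} \<in> stacked c b a (insert e P)" "{Inl j, Inr j} \<in> stacked c b a (insert e P)"
    unfolding edge using inner_ends arc_facts by auto
  show "({v, w} \<in> stacked c b a P) = ({v, w} \<in> stacked c b a (insert e P))"
    if "v \<notin> {Inl i, Inl j, Inr i, Inr j}" for v w
    unfolding edge using inner_insert[OF that] by simp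
  show "w \<in> {Inl i, Inl j, Inr i, Inr j} \<or> {v, w} \<in> stacked c b a (insert e P)"
    if "v \<in> {Inl i, Inl j, Inr i, Inr j}" "{v, w} \<in> stacked c b a P" for v w
    using that inner_ends unfolding edge by auto
  show "w \<in> {Inl i, Inl j, Inr i, Inr j} \<or> {v, w} \<in> stacked c b a P"
    if "v \<in> {Inl i, Inl j, Inr i, Inr j}" "{v, w} \<in> stacked c b a (insert e P)" for v w
    using that inner_ends unfolding edge by auto
qed

lemmas circ_union = surgery.surgery_union[OF is_surgery]
  and circ_other = surgery.surgery_other[OF is_surgery]

lemma circ_ends: "circ P (Inl i) = circ P (Inl j)" "circ P (Inr i) = circ P (Inr j)"
  "circ (insert e P) (Inl i) = circ (insert e P) (Inr i)" "circ (insert e P) (Inl j) = circ (insert e P) (Inr j)"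
  using is_surgery unfolding surgery_def by (auto dest: circle_through_edge)

text \<open>Planarity enters here, through the colouring: in general, reconnecting two edges of one
  cycle may give a single cycle again.\<close>

lemma splits_iff: "circ P (Inl i) = circ P (Inr i) \<longleftrightarrow> circ (insert e P) (Inl i) \<noteq> circ (insert e P) (Inl j)"
proof (rule surgery_splits_iff[OF bicoloured[OF P] bicoloured[OF arc_facts(8)]])
  show "Inl i \<in> {v. colour v = even i}" "Inr i \<notin> {v. colour v = even i}" by auto
  show "Inl i \<in> Vt" "Inr i \<in> Vt" "(Inl i :: nat + nat) \<noteq> Inr j" using arc_facts(1) by auto
  show "inner (insert e P) v = inner P v" if "v \<notin> {Inl i, Inl j, Inr i, Inr j}" for v
    using that by (rule inner_insert)
qed (rule inner_ends)+

lemma stacked_circles_insert: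
  "stacked_circles n c b a (insert e P) =
    (stacked_circles n c b a P - {circ P (Inl i), circ P (Inr i)})
    \<union> {circ (insert e P) (Inl i), circ (insert e P) (Inl j)}"
  (is "?L = ?R")
proof (intro equalityI subsetI)
  fix K assume "K \<in> ?L"
  then obtain v where v: "v \<in> Vt" "K = circ (insert e P) v"
    by (auto simp: stacked_circles_def circles_of_def)
  show "K \<in> ?R"
  proof (cases "v \<in> circ P (Inl i) \<union> circ P (Inr i)")
    case True
    then have "v \<in> circ (insert e P) (Inl i) \<or> v \<in> circ (insert e P) (Inl j)" using circ_union by simp
    then have "K = circ (insert e P) (Inl i) \<or> K = circ (insert e P) (Inl j)"
      using v(2) circle_through_eq_iff by metis
    then show ?thesis by (elim disjE) simp_all
  next
    case False
    then have "K = circ P v" using circ_other v(2) by simp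
    moreover have "circ P v \<noteq> circ P (Inl i)" "circ P v \<noteq> circ P (Inr i)"
      using False circle_through_self[of v "stacked c b a P"] by (metis UnI1 UnI2)+
    ultimately show ?thesis using v(1) by (auto simp: stacked_circles_def circles_of_def)
  qed
next
  fix K assume "K \<in> ?R"
  then consider "K \<in> {circ (insert e P) (Inl i), circ (insert e P) (Inl j)}"
    | "K \<in> stacked_circles n c b a P - {circ P (Inl i), circ P (Inr i)}" by blast
  then show "K \<in> ?L"
  proof cases
    case 1
    then show ?thesis using arc_facts by (auto simp: stacked_circles_def circles_of_def)
  next
    case 2
    then obtain v where v: "v \<in> Vt" "K = circ P v" "circ P v \<noteq> circ P (Inl i)" "circ P v \<noteq> circ P (Inr i)"
      by (auto simp: stacked_circles_def circles_of_def)
    then have "v \<notin> circ P (Inl i) \<union> circ P (Inr i)"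
      using circle_through_eq_iff by (metis UnE)
    then have "K = circ (insert e P) v" using circ_other v(2) by simp
    then show ?thesis using v(1) by (auto simp: stacked_circles_def circles_of_def)
  qed
qed

text \<open>A new circle contains an end of the arc, whereas an untouched old circle contains
  none.\<close>

lemma new_circle_not_old:
  "circ (insert e P) (Inl i) \<notin> stacked_circles n c b a P - {circ P (Inl i), circ P (Inr i)}"
  "circ (insert e P) (Inl j) \<notin> stacked_circles n c b a P - {circ P (Inl i), circ P (Inr i)}"
proof -
  have "circ (insert e P) v \<notin> stacked_circles n c b a P - {circ P (Inl i), circ P (Inr i)}"
    if "v \<in> circ P (Inl i)" for v
  proof
    assume *: "circ (insert e P) v \<in> stacked_circles n c b a P - {circ P (Inl i), circ P (Inr i)}"
    then obtain w where "circ (insert e P) v = circ P w" "circ P w \<noteq> circ P (Inl i)"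
      by (auto simp: stacked_circles_def circles_of_def)
    moreover from this have "v \<in> circ P w" using circle_through_self by metis
    ultimately show False using that circle_through_disjoint by metis
  qed
  then show "circ (insert e P) (Inl i) \<notin> stacked_circles n c b a P - {circ P (Inl i), circ P (Inr i)}"
    "circ (insert e P) (Inl j) \<notin> stacked_circles n c b a P - {circ P (Inl i), circ P (Inr i)}"
    using circ_ends(1) circle_through_self[of "Inl i" "stacked c b a P"]
      circle_through_self[of "Inl j" "stacked c b a P"] by simp_all
qed

end

lemma finite_stacked_circles [simp]: "finite (stacked_circles n c b a P)"
  by (simp add: stacked_circles_def circles_of_def points_def)

text \<open>Two surgeries lead to the same graph in either order; this count serves to compare the
  types of the surgeries along the two ways.\<close>

lemma card_stacked_circles_insert:
  assumes "P \<subseteq> b" "e \<in> b" "e \<notin> P" "e = {i, j}"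
  shows "int (card (stacked_circles n c b a (insert e P))) =
    int (card (stacked_circles n c b a P)) + (if circ P (Inl i) = circ P (Inr i) then 1 else - 1)"
proof -
  let ?S = "stacked_circles n c b a P - {circ P (Inl i), circ P (Inr i)}"
  note facts = arc_facts[OF assms] and new = new_circle_not_old[OF assms] and splits = splits_iff[OF assms]
  have old: "{circ P (Inl i), circ P (Inr i)} \<subseteq> stacked_circles n c b a P"
    using facts by (auto simp: stacked_circles_def circles_of_def)
  have "card (stacked_circles n c b a (insert e P)) =
      card ?S + card {circ (insert e P) (Inl i), circ (insert e P) (Inl j)}"
    unfolding stacked_circles_insert[OF assms] using new by (intro card_Un_disjoint) auto
  moreover have "card (stacked_circles n c b a P) = card ?S + card {circ P (Inl i), circ P (Inr i)}"
    using old by (metis card_Diff_subset card_mono finite.emptyI finite_insert finite_stacked_circles le_add_diff_inverse2)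
  ultimately show ?thesis using splits by (cases "circ P (Inl i) = circ P (Inr i)") auto
qed

section \<open>The first and the last stage\<close>

text \<open>No edge of \<open>F\<close> leaves the range of \<open>f\<close>, so a path can be
  followed on either side.\<close>

lemma circle_through_image:
  assumes "\<And>p w. {f p, w} \<in> F \<longleftrightarrow> (\<exists>q. w = f q \<and> {p, q} \<in> F')"
  shows "circle_through F (f p) = f ` circle_through F' p"
proof
  show "circle_through F (f p) \<subseteq> f ` circle_through F' p"
  proof (rule circle_through_subset)
    fix x y assume "x \<in> f ` circle_through F' p" "{x, y} \<in> F"
    then obtain q r where "x = f q" "q \<in> circle_through F' p" "y = f r" "{q, r} \<in> F'"
      using assms by auto
    then show "y \<in> f ` circle_through F' p"
      using circle_through_edge circle_through_eq_iff by (metis imageI)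
  qed simp
  have "circle_through F' p \<subseteq> {q. f q \<in> circle_through F (f p)}"
  proof (rule circle_through_subset)
    fix x y assume "x \<in> {q. f q \<in> circle_through F (f p)}" "{x, y} \<in> F'"
    then have "f x \<in> circle_through F (f p)" "{f x, f y} \<in> F" using assms by auto
    then show "y \<in> {q. f q \<in> circle_through F (f p)}"
      using circle_through_edge circle_through_eq_iff by (metis mem_Collect_eq)
  qed simp
  then show "f ` circle_through F' p \<subseteq> circle_through F (f p)" by blast
qed

lemma circ_empty:
  "circ {} (Inl p) = Inl ` circle_through (c \<union> b) p"
  "circ {} (Inr p) = Inr ` circle_through (b \<union> a) p"
proof -
  show "circ {} (Inl p) = Inl ` circle_through (c \<union> b) p"
    by (rule circle_through_image) (auto simp: stacked_def Inl_doubleton_simps)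
  show "circ {} (Inr p) = Inr ` circle_through (b \<union> a) p"
    by (rule circle_through_image) (auto simp: stacked_def Inr_doubleton_simps)
qed

lemma stacked_circles_empty:
  "stacked_circles n c b a {} = (`) Inl ` circles n c b \<union> (`) Inr ` circles n b a"
  unfolding stacked_circles_def circles_of_def circles_def Plus_def image_Un image_image circ_empty by simp

lemma crossed_all: "crossed b p \<longleftrightarrow> p \<in> points n"
  using B_partition(1)[OF b] by simp

text \<open>After all surgeries every point carries a vertical segment, so its two copies lie on the
  same circle and the arcs of \<open>c\<close> and \<open>a\<close> lift to paths. The second claim
  gives the injectivity of \<open>contract\<close> on circles.\<close>

lemma contract_circ:
  assumes "v \<in> Vt"
  shows "contract (circ b v) = circle_through (c \<union> a) (case_sum id id v)"
    and "q \<in> contract (circ b v) \<Longrightarrow> Inl q \<in> circ b v"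
proof -
  let ?\<pi> = "case_sum id id :: nat + nat \<Rightarrow> nat"
  let ?K = "circle_through (c \<union> a) (?\<pi> v)"
  have edge: "circ b x = circ b y" if "{x, y} \<in> stacked c b a b" for x y
    using that by (rule circle_through_edge)
  have vert: "circ b (Inl q) = circ b (Inr q)" if "q \<in> points n" for q
    using that by (intro edge) (simp add: stacked_edge_iff inner_def crossed_all InlI del: Union_iff)
  have "circ b v \<subseteq> {w. ?\<pi> w \<in> ?K}"
  proof (rule circle_through_subset)
    fix x y assume x: "x \<in> {w. ?\<pi> w \<in> ?K}" and xy: "{x, y} \<in> stacked c b a b"
    then have "x \<in> Vt" "y = outer x \<or> y = inner b x" using stacked_edge_iff by auto
    then have "?\<pi> y = ?\<pi> x \<or> {?\<pi> x, ?\<pi> y} \<in> c \<union> a"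
      using B_partner[OF c] B_partner[OF a] by (cases x) (auto simp: outer_def inner_def crossed_all simp del: Union_iff)
    then show "y \<in> {w. ?\<pi> w \<in> ?K}"
      using x circle_through_edge circle_through_eq_iff by (metis mem_Collect_eq)
  qed simp
  then have 1: "contract (circ b v) \<subseteq> ?K" by (auto simp: contract_def)
  have "circ b (Inl (?\<pi> v)) = circ b v" using assms vert by (cases v) auto
  then have 0: "Inl (?\<pi> v) \<in> circ b v" using circle_through_self by metis
  have 2: "?K \<subseteq> {q. q \<in> points n \<and> Inl q \<in> circ b v}"
  proof (rule circle_through_subset)
    show "?\<pi> v \<in> {q. q \<in> points n \<and> Inl q \<in> circ b v}" using 0 assms by (cases v) auto
  next
    fix q r assume q: "q \<in> {q. q \<in> points n \<and> Inl q \<in> circ b v}" and "{q, r} \<in> c \<union> a"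
    then have qr: "{q, r} \<in> c \<or> {q, r} \<in> a" by blast
    then have r: "r \<in> points n" using B_partition(1)[OF c] B_partition(1)[OF a] by blast
    have "circ b (Inl q) = circ b (Inl r)" using qr
    proof
      assume "{q, r} \<in> c"
      then show ?thesis using q B_partner[OF c] by (intro edge) (auto simp: stacked_edge_iff outer_def)
    next
      assume "{q, r} \<in> a"
      then have "circ b (Inr q) = circ b (Inr r)"
        using q B_partner[OF a] by (intro edge) (auto simp: stacked_edge_iff outer_def)
      then show ?thesis using vert q r by simp
    qed
    then show "r \<in> {q. q \<in> points n \<and> Inl q \<in> circ b v}"
      using q r circle_through_eq_iff by (metis (mono_tags, lifting) mem_Collect_eq)
  qed
  have "?K \<subseteq> contract (circ b v)"
  proof
    fix q assume "q \<in> ?K"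
    then have "Inl q \<in> circ b v" using 2 by blast
    then have "?\<pi> (Inl q) \<in> contract (circ b v)" unfolding contract_def by (rule imageI)
    then show "q \<in> contract (circ b v)" by simp
  qed
  with 1 show eq: "contract (circ b v) = ?K" by (rule equalityI)
  show "Inl q \<in> circ b v" if "q \<in> contract (circ b v)" using that 2 unfolding eq by blast
qed

lemma contract_circles: "contract ` stacked_circles n c b a b = circles n c a"
proof -
  have "contract ` stacked_circles n c b a b = (\<lambda>v. circle_through (c \<union> a) (case_sum id id v)) ` Vt"
    unfolding stacked_circles_def circles_of_def image_image
    by (intro image_cong) (auto simp: contract_circ)
  then show ?thesis
    by (simp add: circles_def circles_of_def Plus_def image_Un image_image)
qed

lemma inj_on_contract: "inj_on contract (stacked_circles n c b a b)"
proof (rule inj_onI)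
  fix K L assume KL: "K \<in> stacked_circles n c b a b" "L \<in> stacked_circles n c b a b" "contract K = contract L"
  then obtain v w where vw: "v \<in> Vt" "w \<in> Vt" "K = circ b v" "L = circ b w"
    by (auto simp: stacked_circles_def circles_of_def)
  let ?q = "case_sum id id v :: nat"
  have "?q \<in> contract K" unfolding contract_def vw(3) by (rule imageI) simp
  then have "Inl ?q \<in> circ b v" "Inl ?q \<in> circ b w" using contract_circ(2) vw KL(3) by auto
  then show "K = L" unfolding vw using circle_through_disjoint by metis
qed

end

section \<open>Evaluation of surgeries modulo two\<close>

lemma circle_through_in: "w \<in> circle_through E v \<Longrightarrow> circle_through E w = circle_through E v"
  using circle_through_eq_iff by metis

text \<open>On words with distinct letters both sides are the same product; on the others both
  vanish, by a repeated factor of square zero.\<close>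

lemma ext_subst_word_eval:
  fixes \<rho> :: "'s \<Rightarrow> 'r::comm_ring_1"
  assumes "(2 :: 'r) = 0" "\<And>s. \<rho> s * \<rho> s = 0"
  shows "ext_subst \<rho> (word_eval ext_gen x) = word_eval \<rho> x"
proof -
  have "ext_subst \<rho> (\<Prod>s\<leftarrow>w. ext_gen s) = (\<Prod>s\<leftarrow>w. \<rho> s)" for w
  proof (cases "distinct w")
    case True
    then have "ext_subst \<rho> (\<Prod>s\<leftarrow>w. ext_gen s) = (\<Prod>s\<in>set w. \<rho> s)"
      by (simp add: word_eval_ext_gen ext_subst_prod[OF assms(1)])
    then show ?thesis using True by (simp add: prod.distinct_set_conv_list)
  next
    case False
    then obtain u v v' s where w: "w = u @ [s] @ v @ [s] @ v'" using not_distinct_decomp by blast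
    have "(\<Prod>s\<leftarrow>w. \<rho> s) = (\<Prod>s\<leftarrow>u. \<rho> s) * (\<Prod>s\<leftarrow>v. \<rho> s) * (\<rho> s * \<rho> s) * (\<Prod>s\<leftarrow>v'. \<rho> s)"
      unfolding w
      by (simp only: map_append prod_list.append list.map prod_list.Cons prod_list.Nil mult_1_right mult_1_left mult_ac)
    then show ?thesis using False by (simp add: word_eval_ext_gen assms(2))
  qed
  then show ?thesis by (simp add: word_eval_def ext_subst_lin_ext[OF assms(1)])
qed

lemma ext_subst_label_eval:
  fixes \<rho> :: "'s \<Rightarrow> 'r::comm_ring_1"
  assumes "(2 :: 'r) = 0" "finite S"
  shows "ext_subst \<rho> (label_eval ext_gen S x) = label_eval \<rho> S x"
  using assms by (simp add: label_eval_def ext_subst_lin_ext ext_subst_prod)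

lemma word_eval_map: "word_eval \<theta> (word_map f x) = word_eval (\<lambda>s. \<theta> (f s)) x"
  by (simp add: word_eval_def word_map_def lin_ext_frag_extend comp_def)

text \<open>Letters are exchanged one at a time, \<open>z\<close> being passed along the word. For
  intermediate circles, values are known to be equal only up to such a multiplier.\<close>

lemma word_eval_mult_cong:
  assumes "keys x \<subseteq> lists S" "\<And>s. s \<in> S \<Longrightarrow> z * \<theta> s = z * \<theta>' s"
  shows "z * word_eval \<theta> x = z * word_eval \<theta>' x"
proof -
  have "z * (\<Prod>s\<leftarrow>w. \<theta> s) = z * (\<Prod>s\<leftarrow>w. \<theta>' s)" if "w \<in> lists S" for w
    using that
  proof (induction w)
    case (Cons s w)
    have "z * (\<theta> s * (\<Prod>s\<leftarrow>w. \<theta> s)) = (z * \<theta> s) * (\<Prod>s\<leftarrow>w. \<theta> s)" by (simp add: mult_ac)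
    also have "\<dots> = \<theta>' s * (z * (\<Prod>s\<leftarrow>w. \<theta> s))" using assms(2) Cons.hyps by (simp add: mult_ac)
    also have "\<dots> = z * (\<theta>' s * (\<Prod>s\<leftarrow>w. \<theta>' s))" using Cons.IH by (simp add: mult_ac)
    finally show ?case by simp
  qed simp
  then have "lin_ext (\<lambda>w. z * (\<Prod>s\<leftarrow>w. \<theta> s)) x = lin_ext (\<lambda>w. z * (\<Prod>s\<leftarrow>w. \<theta>' s)) x"
    using assms(1) by (intro lin_ext_cong) auto
  then show ?thesis by (simp add: word_eval_def lin_ext_mult_left)
qed

text \<open>Iteration over arcs in place of points: \<open>new_arcs\<close> extracts the arcs in the
  order in which they are first met, so that later inductions deal with lists without
  repetitions.\<close>

primrec run :: "(nat set set \<Rightarrow> nat set \<Rightarrow> 'x \<Rightarrow> 'x) \<Rightarrow> nat set list \<Rightarrow> nat set set \<Rightarrow> 'x \<Rightarrow> 'x" where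
  "run F [] P x = x"
| "run F (e # es) P x = run F es (insert e P) (F P e x)"

primrec new_arcs :: "matching \<Rightarrow> nat list \<Rightarrow> nat set set \<Rightarrow> nat set list" where
  "new_arcs b [] P = []"
| "new_arcs b (p # ps) P = (if arc_at b p \<in> P then new_arcs b ps P
     else arc_at b p # new_arcs b ps (insert (arc_at b p) P))"

lemma surgeries_eq_run: "surgeries F b ps P x = run F (new_arcs b ps P) P x"
  by (induction ps arbitrary: P x) auto

lemma new_arcs: "distinct (new_arcs b ps P) \<and> set (new_arcs b ps P) = arc_at b ` set ps - P"
  by (induction ps arbitrary: P) auto

text \<open>An intermediate circle may break up into several final ones; the base point picks the
  one whose generator represents it.\<close>

definition basepoint :: "'v set \<Rightarrow> 'v" where
  "basepoint K = (SOME v. v \<in> K)"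

lemma basepoint: "v \<in> K \<Longrightarrow> basepoint K \<in> K"
  unfolding basepoint_def by (rule someI)

text \<open>\<open>\<tau> v\<close> stands for the generator of the final circle through the vertex
  \<open>v\<close>. Being indexed by vertices, it makes sense at every stage.\<close>

locale stack_eval = stack n c b a for n c b a +
  fixes \<tau> :: "nat + nat \<Rightarrow> 'r::comm_ring_1"
  assumes char2: "(2 :: 'r) = 0" and \<tau>_square: "\<And>v. \<tau> v * \<tau> v = 0"
    and \<tau>_final: "\<And>v w. w \<in> circ b v \<Longrightarrow> \<tau> v = \<tau> w"
begin


abbreviation \<theta> :: "(nat + nat) set \<Rightarrow> 'r" where
  "\<theta> K \<equiv> \<tau> (basepoint K)"

text \<open>A circle at stage \<open>P\<close> may be cut into several final circles. The factor \<open>z\<close> contributed by the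
  later splits makes it irrelevant which of them represents it.\<close>

definition compat :: "nat set set \<Rightarrow> 'r \<Rightarrow> bool" where
  "compat P z \<longleftrightarrow> (\<forall>v w. w \<in> circ P v \<longrightarrow> z * \<tau> v = z * \<tau> w)"

definition split_factor :: "nat set set \<Rightarrow> nat set \<Rightarrow> 'r" where
  "split_factor P e = (if circ P (Inl (Min e)) = circ P (Inr (Min e))
     then \<tau> (Inl (Min e)) + \<tau> (Inl (Max e)) else 1)"

primrec order_factor :: "nat set list \<Rightarrow> nat set set \<Rightarrow> 'r" where
  "order_factor [] P = 1"
| "order_factor (e # es) P = order_factor es (insert e P) * split_factor P e"

lemma compatD: "compat P z \<Longrightarrow> w \<in> circ P v \<Longrightarrow> z * \<tau> v = z * \<tau> w"
  by (simp add: compat_def)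

lemma dbl: "x + x = (0 :: 'r)"
  using char2 by (metis mult_2 mult_zero_left)

text \<open>Condition and sum are symmetric in the two ends, so taking \<open>Min e\<close> as the
  first one is immaterial, and so is the orientation of the arc.\<close>

lemma split_factor:
  assumes "P \<subseteq> b" "e \<in> b" "e \<notin> P" "e = {i, j}"
  shows "split_factor P e = (if circ P (Inl i) = circ P (Inr i) then \<tau> (Inl i) + \<tau> (Inl j) else 1)"
proof (cases i j rule: linorder_cases)
  case less
  then have "Min e = i" "Max e = j" using assms(4) by auto
  then show ?thesis by (simp add: split_factor_def)
next
  case greater
  then have "Min e = j" "Max e = i" using assms(4) by auto
  then show ?thesis using circ_ends(1,2)[OF assms] by (simp add: split_factor_def add.commute)
qed (use arc_facts[OF assms] in simp)

lemma arc_ends: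
  assumes "e \<in> b"
  obtains i j where "e = {i, j}" "i \<noteq> j"
  using B_arc_cases[OF b assms] by (metis less_irrefl)

section \<open>Values of circles before and after one surgery\<close>

context
  fixes P e i j z assumes arc: "P \<subseteq> b" "e \<in> b" "e \<notin> P" "e = {i, j}" and z: "compat (insert e P) z"
begin

text \<open>Up to \<open>z\<close>, the value at \<open>v\<close> is that at \<open>i\<close> or
  that at \<open>j\<close>; in either case multiplying by the sum leaves only the product of the
  two, since squares vanish. So the result does not depend on \<open>v\<close>, although the circle
  is cut.\<close>

lemma split_values:
  assumes "circ P (Inl i) = circ P (Inr i)" "v \<in> circ P (Inl i)"
  shows "z * (\<tau> (Inl i) + \<tau> (Inl j)) * \<tau> v = z * \<tau> (Inl i) * \<tau> (Inl j)"
proof -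
  have "v \<in> circ (insert e P) (Inl i) \<or> v \<in> circ (insert e P) (Inl j)"
    using circ_union[OF arc] assms by blast
  then have "z * \<tau> (Inl i) = z * \<tau> v \<or> z * \<tau> (Inl j) = z * \<tau> v"
    using compatD[OF z] by blast
  moreover have "(z * \<tau> (Inl i)) * (\<tau> (Inl i) + \<tau> (Inl j)) = z * (\<tau> (Inl i) * \<tau> (Inl i)) + z * \<tau> (Inl i) * \<tau> (Inl j)"
    "(z * \<tau> (Inl j)) * (\<tau> (Inl i) + \<tau> (Inl j)) = z * (\<tau> (Inl j) * \<tau> (Inl j)) + z * \<tau> (Inl i) * \<tau> (Inl j)"
    by (simp_all add: algebra_simps)
  ultimately have "(z * \<tau> v) * (\<tau> (Inl i) + \<tau> (Inl j)) = z * \<tau> (Inl i) * \<tau> (Inl j)"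
    unfolding \<tau>_square mult_zero_right add_0_left by (elim disjE) (simp_all only:)
  then show ?thesis by (simp only: mult_ac)
qed

text \<open>The two circles become one at the next stage, where \<open>z\<close> already identifies
  all values.\<close>

lemma merge_values:
  assumes "circ P (Inl i) \<noteq> circ P (Inr i)" "v \<in> circ P (Inl i) \<union> circ P (Inr i)"
  shows "z * \<tau> v = z * \<tau> (Inl i)"
proof -
  have "circ (insert e P) (Inl i) = circ (insert e P) (Inl j)" using splits_iff[OF arc] assms(1) by blast
  then have "v \<in> circ (insert e P) (Inl i)" using circ_union[OF arc] assms(2) by blast
  then show ?thesis using compatD[OF z] by metis
qed

text \<open>One step backwards: the later stage identifies values only within each part of a cut
  circle, and the new factor identifies the two parts.\<close>

lemma compat_step: "compat P (z * split_factor P e)"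
  unfolding compat_def
proof (intro allI impI)
  fix v w assume w: "w \<in> circ P v"
  show "z * split_factor P e * \<tau> v = z * split_factor P e * \<tau> w"
  proof (cases "v \<in> circ P (Inl i) \<union> circ P (Inr i)")
    case False
    then have "w \<in> circ (insert e P) v" using circ_other[OF arc] w by simp
    then have "split_factor P e * (z * \<tau> v) = split_factor P e * (z * \<tau> w)" using compatD[OF z] by metis
    then show ?thesis by (simp only: mult_ac)
  next
    case True
    then have "circ P v = circ P (Inl i) \<or> circ P v = circ P (Inr i)"
      by (auto dest: circle_through_in)
    then have wU: "w \<in> circ P (Inl i) \<union> circ P (Inr i)" using w by auto
    show ?thesis
    proof (cases "circ P (Inl i) = circ P (Inr i)")
      case split: True
      then have "v \<in> circ P (Inl i)" "w \<in> circ P (Inl i)" using True wU by auto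
      then show ?thesis
        using split_values[OF split, of v] split_values[OF split, of w] split unfolding split_factor[OF arc] by simp
    next
      case False
      then show ?thesis
        using merge_values[OF False True] merge_values[OF False wU] unfolding split_factor[OF arc] by simp
    qed
  qed
qed

end

lemma compat_order_factor:
  assumes "distinct es" "set es = b - P" "P \<subseteq> b"
  shows "compat P (order_factor es P)"
  using assms
proof (induction es arbitrary: P)
  case Nil
  then have "P = b" by auto
  then show ?case using \<tau>_final by (simp add: compat_def)
next
  case (Cons e es)
  then have e: "e \<in> b" "e \<notin> P" by auto
  obtain i j where ij: "e = {i, j}" using arc_ends[OF e(1)] .
  have "compat (insert e P) (order_factor es (insert e P))" using Cons e by (intro Cons.IH) auto
  then show ?case using compat_step[OF Cons.prems(3) e ij] by simp
qed

text \<open>Here \<open>f\<close> merges after \<open>e\<close> although it would split before: its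
  two copies must lie on the two parts produced by \<open>e\<close>, and joining these makes the
  values at \<open>i\<close> and \<open>j\<close> agree up to \<open>z\<close>. Their sum then
  vanishes in characteristic two.\<close>

lemma swap_same_end:
  assumes "P \<subseteq> b" "e \<in> b" "e \<notin> P" "e = {i, j}" "f \<in> b" "f \<notin> P" "f = {k, l}" "e \<noteq> f"
    and split: "circ P (Inl i) = circ P (Inr i)"
    and "circ P (Inl k) = circ P (Inr k)" "circ (insert e P) (Inl k) \<noteq> circ (insert e P) (Inr k)"
    and z: "compat (insert f (insert e P)) z"
  shows "z * (\<tau> (Inl i) + \<tau> (Inl j)) = 0"
proof -
  note arc = assms(1-4)
  have arc': "insert e P \<subseteq> b" "f \<in> b" "f \<notin> insert e P" "f = {k, l}" using assms by auto
  \<comment> \<open>Otherwise \<open>e\<close> would leave the circle that carries \<open>f\<close>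
    untouched, and \<open>f\<close> would still be a split.\<close>
  have "Inl k \<in> circ P (Inl i)"
  proof (rule ccontr)
    assume "Inl k \<notin> circ P (Inl i)"
    moreover from this have "Inr k \<notin> circ P (Inl i)" using assms(10) circle_through_eq_iff by metis
    ultimately have "circ (insert e P) (Inl k) = circ P (Inl k)" "circ (insert e P) (Inr k) = circ P (Inr k)"
      using circ_other[OF arc] split by simp_all
    then show False using assms(10,11) by simp
  qed
  moreover from this have "Inr k \<in> circ P (Inl i)" using assms(10) circle_through_eq_iff by metis
  ultimately have "Inl k \<in> circ (insert e P) (Inl i) \<union> circ (insert e P) (Inl j)"
    "Inr k \<in> circ (insert e P) (Inl i) \<union> circ (insert e P) (Inl j)"
    using circ_union[OF arc] split by simp_all
  then have ends: "circ (insert e P) (Inl k) = circ (insert e P) (Inl i) \<or> circ (insert e P) (Inl k) = circ (insert e P) (Inl j)"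
    "circ (insert e P) (Inr k) = circ (insert e P) (Inl i) \<or> circ (insert e P) (Inr k) = circ (insert e P) (Inl j)"
    using circle_through_eq_iff by (metis Un_iff)+
  then have "{circ (insert e P) (Inl k), circ (insert e P) (Inr k)} = {circ (insert e P) (Inl i), circ (insert e P) (Inl j)}"
    using assms(11) by auto
  then have U: "circ (insert e P) (Inl k) \<union> circ (insert e P) (Inr k) = circ (insert e P) (Inl i) \<union> circ (insert e P) (Inl j)"
    by (auto simp: doubleton_eq_iff)
  have "z * \<tau> (Inl i) = z * \<tau> (Inl k)" "z * \<tau> (Inl j) = z * \<tau> (Inl k)"
    using merge_values[OF arc' z assms(11)] U by auto
  then show ?thesis using dbl by (simp add: distrib_left)
qed

lemma swap:
  assumes "P \<subseteq> b" "e \<in> b" "e \<notin> P" "f \<in> b" "f \<notin> P" "e \<noteq> f" and z: "compat (insert e (insert f P)) z"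
  shows "z * split_factor (insert e P) f * split_factor P e = z * split_factor (insert f P) e * split_factor P f"
proof -
  obtain i j where ij: "e = {i, j}" using arc_ends[OF assms(2)] .
  obtain k l where kl: "f = {k, l}" using arc_ends[OF assms(4)] .
  have e: "P \<subseteq> b" "e \<in> b" "e \<notin> P" "e = {i, j}" and f: "P \<subseteq> b" "f \<in> b" "f \<notin> P" "f = {k, l}"
    and ef: "insert e P \<subseteq> b" "f \<in> b" "f \<notin> insert e P" "f = {k, l}"
    and fe: "insert f P \<subseteq> b" "e \<in> b" "e \<notin> insert f P" "e = {i, j}"
    using assms ij kl by auto
  define se where "se \<longleftrightarrow> circ P (Inl i) = circ P (Inr i)"
  define sf where "sf \<longleftrightarrow> circ P (Inl k) = circ P (Inr k)"
  define sef where "sef \<longleftrightarrow> circ (insert e P) (Inl k) = circ (insert e P) (Inr k)"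
  define sfe where "sfe \<longleftrightarrow> circ (insert f P) (Inl i) = circ (insert f P) (Inr i)"
  note s_defs = se_def sf_def sef_def sfe_def
  have z': "compat (insert f (insert e P)) z" using z by (simp add: insert_commute)
  have factors: "split_factor P e = (if se then \<tau> (Inl i) + \<tau> (Inl j) else 1)"
    "split_factor P f = (if sf then \<tau> (Inl k) + \<tau> (Inl l) else 1)"
    "split_factor (insert e P) f = (if sef then \<tau> (Inl k) + \<tau> (Inl l) else 1)"
    "split_factor (insert f P) e = (if sfe then \<tau> (Inl i) + \<tau> (Inl j) else 1)"
    unfolding s_defs using split_factor e f ef fe by simp_all
  \<comment> \<open>Both orders end with the same graph, so the total change in the number of
    circles is the same.\<close>
  have count: "(if se then 1 else - 1) + (if sef then 1 else - 1) = (if sf then 1 else - 1) + (if sfe then 1 else - 1 :: int)"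
    using card_stacked_circles_insert[OF e] card_stacked_circles_insert[OF f]
      card_stacked_circles_insert[OF ef] card_stacked_circles_insert[OF fe]
    unfolding s_defs insert_commute[of e f P] by simp
  \<comment> \<open>The pairs of types agree up to order: either neither type depends on the order
    of the surgeries, or both arcs change their type in the same way.\<close>
  consider "se \<longleftrightarrow> sfe" "sf \<longleftrightarrow> sef" | "se" "sf" "\<not> sef" "\<not> sfe" | "\<not> se" "\<not> sf" "sef" "sfe"
    using count by (auto split: if_splits)
  then show ?thesis
  proof cases
    case 1
    then show ?thesis unfolding factors by (simp add: mult_ac)
  next
    case 2
    have "z * (\<tau> (Inl i) + \<tau> (Inl j)) = 0"
      by (rule swap_same_end[OF e f(2-4) assms(6) _ _ _ z']) (use 2 in \<open>simp_all add: s_defs\<close>)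
    moreover have "z * (\<tau> (Inl k) + \<tau> (Inl l)) = 0"
      by (rule swap_same_end[OF f e(2-4) assms(6)[symmetric] _ _ _ z]) (use 2 in \<open>simp_all add: s_defs\<close>)
    ultimately show ?thesis using 2 unfolding factors by simp
  next
    case 3
    let ?Q = "insert f (insert e P)"
    have Q: "?Q = insert e (insert f P)" by (simp add: insert_commute)
    \<comment> \<open>If \<open>f\<close> met neither of the circles merged by \<open>e\<close>, it
      would still be a merge after \<open>e\<close>.\<close>
    have "Inl k \<in> circ P (Inl i) \<union> circ P (Inr i) \<or> Inr k \<in> circ P (Inl i) \<union> circ P (Inr i)"
    proof (rule ccontr)
      assume "\<not> ?thesis"
      then have "circ (insert e P) (Inl k) = circ P (Inl k)" "circ (insert e P) (Inr k) = circ P (Inr k)"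
        using circ_other[OF e] by simp_all
      then show False using 3 unfolding s_defs by simp
    qed
    moreover have ei: "circ (insert e P) (Inl i) = circ (insert e P) (Inl j)"
      using splits_iff[OF e] 3 unfolding s_defs by simp
    ultimately have "Inl k \<in> circ (insert e P) (Inl i) \<or> Inr k \<in> circ (insert e P) (Inl i)"
      using circ_union[OF e] by simp
    then have "circ (insert e P) (Inl i) = circ (insert e P) (Inl k)"
      using 3(3) unfolding s_defs using circle_through_eq_iff by metis
    then have "Inl i \<in> circ (insert e P) (Inl k)" "Inl j \<in> circ (insert e P) (Inl k)"
      using ei circle_through_self by metis+
    then have "Inl i \<in> circ ?Q (Inl k) \<union> circ ?Q (Inl l)" "Inl j \<in> circ ?Q (Inl k) \<union> circ ?Q (Inl l)"
      using circ_union[OF ef] 3(3) unfolding s_defs by simp_all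
    \<comment> \<open>In the other order \<open>e\<close> is the split that comes last, so its ends
      finish on different circles. Hence both splits yield the same pair of circles.\<close>
    moreover have "circ ?Q (Inl i) \<noteq> circ ?Q (Inl j)"
      using splits_iff[OF fe] 3(4) unfolding s_defs Q by simp
    ultimately have "Inl i \<in> circ ?Q (Inl k) \<and> Inl j \<in> circ ?Q (Inl l) \<or> Inl i \<in> circ ?Q (Inl l) \<and> Inl j \<in> circ ?Q (Inl k)"
      by (elim UnE) (auto dest: circle_through_in)
    then have "z * \<tau> (Inl k) = z * \<tau> (Inl i) \<and> z * \<tau> (Inl l) = z * \<tau> (Inl j) \<or>
        z * \<tau> (Inl l) = z * \<tau> (Inl i) \<and> z * \<tau> (Inl k) = z * \<tau> (Inl j)"
      by (elim disjE conjE) (simp_all add: compatD[OF z'])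
    then have "z * (\<tau> (Inl i) + \<tau> (Inl j)) = z * (\<tau> (Inl k) + \<tau> (Inl l))"
      by (elim disjE conjE) (simp_all add: distrib_left add.commute)
    then show ?thesis using 3 unfolding factors by simp
  qed
qed

text \<open>The two lists are compared with lists that start with \<open>e, f\<close> and with
  \<open>f, e\<close> and share the tail \<open>gs\<close>: induction applies to what follows the
  first arc, and \<open>swap\<close> exchanges the first two arcs.\<close>

lemma order_factor_unique:
  assumes "distinct es" "set es = b - P" "distinct fs" "set fs = b - P" "P \<subseteq> b"
  shows "order_factor es P = order_factor fs P"
  using assms
proof (induction "length es" arbitrary: es fs P rule: less_induct)
  case less
  show ?case
  proof (cases es)
    case Nil
    then have "fs = []" using less.prems by auto
    then show ?thesis using Nil by simp
  next
    case (Cons e es')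
    then obtain f fs' where fs: "fs = f # fs'" using less.prems by (cases fs) auto
    have e: "e \<in> b" "e \<notin> P" "distinct es'" "set es' = b - insert e P" "insert e P \<subseteq> b"
      using less.prems Cons by auto
    have f: "f \<in> b" "f \<notin> P" "distinct fs'" "set fs' = b - insert f P" "insert f P \<subseteq> b"
      using less.prems fs by auto
    have len: "length fs = length es" using less.prems by (metis distinct_card)
    show ?thesis
    proof (cases "e = f")
      case True
      have "order_factor es' (insert e P) = order_factor fs' (insert e P)"
        using e f True Cons by (intro less.hyps) auto
      then show ?thesis using True Cons fs by simp
    next
      case False
      have "finite (b - insert e (insert f P))" using e(4) by (metis Diff_insert finite_Diff finite_set insert_commute)
      then obtain gs where gs: "distinct gs" "set gs = b - insert e (insert f P)"
        using finite_distinct_list by metis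
      have "order_factor es' (insert e P) = order_factor (f # gs) (insert e P)"
        using e f gs False Cons by (intro less.hyps) auto
      moreover have "order_factor fs' (insert f P) = order_factor (e # gs) (insert f P)"
        using e f gs False Cons fs len by (intro less.hyps) auto
      moreover have "compat (insert e (insert f P)) (order_factor gs (insert e (insert f P)))"
        using gs e f by (intro compat_order_factor) auto
      then have "order_factor (f # gs) (insert e P) * split_factor P e = order_factor (e # gs) (insert f P) * split_factor P f"
        using swap[OF less.prems(5) e(1,2) f(1,2) False] by (simp add: insert_commute[of f e])
      ultimately show ?thesis using Cons fs by simp
    qed
  qed
qed

end

lemma frag_extend_keys_subset:
  assumes "keys x \<subseteq> K" "\<And>k. k \<in> K \<Longrightarrow> keys (f k) \<subseteq> L"
  shows "keys (frag_extend f x) \<subseteq> L"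
  using keys_frag_extend[of f x] assms by blast

lemma label_prod:
  "finite S \<Longrightarrow> (\<Prod>K\<in>{K \<in> S. l K = T}. \<theta> K) = (\<Prod>K\<in>S. if l K = T then \<theta> K else (1 :: 'r::comm_ring_1))"
  by (simp add: prod.inter_filter)

lemma keys_word_map_lists:
  assumes "keys x \<subseteq> lists S" "f ` S \<subseteq> S'"
  shows "keys (word_map f x) \<subseteq> lists S'"
  using keys_word_map[of f x] assms by fastforce

section \<open>Odd surgeries on words and their compatibility with the exterior relations\<close>

context stack
begin


lemma SC_circ: "v \<in> Vt \<Longrightarrow> circ P v \<in> SC P"
  by (auto simp: stacked_circles_def circles_of_def)

text \<open>Displays a surgery as a renaming of letters, followed for a split by a multiplication
  from the left: the two operations that are known to respect \<open>ext_ideal\<close>.\<close>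

lemma odd_surgery_cases:
  assumes "P \<subseteq> b" "e \<in> b" "e \<notin> P" "e = {i, j}" "ori e = (i, j)"
  defines "f \<equiv> \<lambda>K. if K = circ P (Inl i) \<or> K = circ P (Inr i) then circ (insert e P) (Inl i) else K"
  shows "odd_surgery c b a ori P e x = (if circ P (Inl i) \<noteq> circ P (Inr i) then word_map f x
      else word_mult (as_word (frag_of (circ (insert e P) (Inl i)) - frag_of (circ (insert e P) (Inl j)))) (word_map f x))"
    and "f ` SC P \<subseteq> SC (insert e P)"
    and "keys (as_word (frag_of (circ (insert e P) (Inl i)) - frag_of (circ (insert e P) (Inl j))))
      \<subseteq> lists (SC (insert e P))"
proof -
  note arc = assms(1-4)
  have ends: "circ (insert e P) (Inl i) \<in> SC (insert e P)" "circ (insert e P) (Inl j) \<in> SC (insert e P)"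
    using arc_facts(1,2)[OF arc] by (auto intro!: SC_circ)
  show "odd_surgery c b a ori P e x = (if circ P (Inl i) \<noteq> circ P (Inr i) then word_map f x
      else word_mult (as_word (frag_of (circ (insert e P) (Inl i)) - frag_of (circ (insert e P) (Inl j)))) (word_map f x))"
    unfolding odd_surgery_def assms(5) f_def Let_def by simp
  show "f ` SC P \<subseteq> SC (insert e P)"
  proof (rule image_subsetI)
    fix K assume "K \<in> SC P"
    then have "K \<in> SC (insert e P)" if "K \<noteq> circ P (Inl i)" "K \<noteq> circ P (Inr i)"
      using that stacked_circles_insert[OF arc] by blast
    then show "f K \<in> SC (insert e P)" using ends(1) by (simp add: f_def)
  qed
  have "keys (frag_of (circ (insert e P) (Inl i)) - frag_of (circ (insert e P) (Inl j))) \<subseteq> SC (insert e P)"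
    using ends keys_diff[of "frag_of (circ (insert e P) (Inl i))" "frag_of (circ (insert e P) (Inl j))"] by auto
  then show "keys (as_word (frag_of (circ (insert e P) (Inl i)) - frag_of (circ (insert e P) (Inl j))))
      \<subseteq> lists (SC (insert e P))"
    by (rule keys_as_word)
qed

lemma odd_surgery_keys:
  assumes "P \<subseteq> b" "e \<in> b" "e \<notin> P" "e = {i, j}" "ori e = (i, j)" "keys x \<subseteq> lists (SC P)"
  shows "keys (odd_surgery c b a ori P e x) \<subseteq> lists (SC (insert e P))"
  using keys_word_map_lists[OF assms(6) odd_surgery_cases(2)[where ori = ori, OF assms(1-5)]]
    keys_word_mult[OF odd_surgery_cases(3)[where ori = ori, OF assms(1-5)]]
  unfolding odd_surgery_cases(1)[where ori = ori, OF assms(1-5)]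
  by (split if_split) (intro conjI impI; blast)

lemma odd_surgery_ideal:
  assumes "P \<subseteq> b" "e \<in> b" "e \<notin> P" "e = {i, j}" "ori e = (i, j)" "x \<in> ext_ideal (SC P)"
  shows "odd_surgery c b a ori P e x \<in> ext_ideal (SC (insert e P))"
  using ext_ideal_map[OF assms(6) odd_surgery_cases(2)[where ori = ori, OF assms(1-5)]]
    ext_ideal_mult_left[OF _ odd_surgery_cases(3)[where ori = ori, OF assms(1-5)]]
  unfolding odd_surgery_cases(1)[where ori = ori, OF assms(1-5)]
  by (split if_split) (intro conjI impI; blast)

lemma odd_surgery_diff:
  "odd_surgery c b a ori P e (x - y) = odd_surgery c b a ori P e x - odd_surgery c b a ori P e y"
  unfolding odd_surgery_def Let_def by (simp add: case_prod_unfold)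

lemma run_odd:
  assumes "\<And>e. e \<in> b \<Longrightarrow> case ori e of (i, j) \<Rightarrow> e = {i, j}"
    and "distinct es" "set es = b - P" "P \<subseteq> b" "keys x \<subseteq> lists (SC P)"
  shows "keys (run (odd_surgery c b a ori) es P x) \<subseteq> lists (SC b)"
    and "x \<in> ext_ideal (SC P) \<Longrightarrow> run (odd_surgery c b a ori) es P x \<in> ext_ideal (SC b)"
proof -
  have "keys (run (odd_surgery c b a ori) es P x) \<subseteq> lists (SC b) \<and>
    (x \<in> ext_ideal (SC P) \<longrightarrow> run (odd_surgery c b a ori) es P x \<in> ext_ideal (SC b))"
    using assms(2-5)
  proof (induction es arbitrary: P x)
    case Nil
    then have "P = b" by auto
    then show ?case using Nil by simp
  next
    case (Cons e es)
    have e: "e \<in> b" "e \<notin> P" using Cons.prems(2) by auto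
    obtain i j where ij: "ori e = (i, j)" "e = {i, j}" using assms(1)[OF e(1)] by (cases "ori e") auto
    note arc = Cons.prems(3) e ij(2) ij(1)
    have "keys (odd_surgery c b a ori P e x) \<subseteq> lists (SC (insert e P))"
      by (rule odd_surgery_keys[where ori = ori, OF arc Cons.prems(4)])
    moreover have "distinct es" "set es = b - insert e P" "insert e P \<subseteq> b"
      using Cons.prems e by auto
    ultimately show ?case using Cons.IH[of "insert e P"] odd_surgery_ideal[where ori = ori, OF arc] by simp
  qed
  then show "keys (run (odd_surgery c b a ori) es P x) \<subseteq> lists (SC b)"
    "x \<in> ext_ideal (SC P) \<Longrightarrow> run (odd_surgery c b a ori) es P x \<in> ext_ideal (SC b)"
    by auto
qed

lemma run_odd_diff:
  "run (odd_surgery c b a ori) es P (x - y) = run (odd_surgery c b a ori) es P x - run (odd_surgery c b a ori) es P y"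
  by (induction es arbitrary: P x y) (auto simp: odd_surgery_diff)

lemma arc_at_points: "arc_at b ` points n = b"
proof
  show "arc_at b ` points n \<subseteq> b" using B_arc_at[OF b] by blast
  show "b \<subseteq> arc_at b ` points n"
  proof
    fix e assume e: "e \<in> b"
    then obtain p q where "e = {p, q}" "p \<in> points n" using B_arc_cases[OF b] by metis
    then show "e \<in> arc_at b ` points n" using B_arc_at_eq[OF b e, of p] by auto
  qed
qed

end

section \<open>One surgery acts as multiplication by its split factor\<close>

context stack_eval
begin

lemma basepoint_circ: "basepoint (circ P v) \<in> circ P v"
  by (rule basepoint[OF circle_through_self])

lemma \<theta>_circ:
  assumes "compat P z" "w \<in> circ P v"
  shows "z * \<theta> (circ P v) = z * \<tau> w"
proof -
  have "basepoint (circ P v) \<in> circ P w" using basepoint_circ circle_through_in[OF assms(2)] by simp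
  then show ?thesis using compatD[OF assms(1)] by simp
qed

text \<open>For a merge, \<open>z\<close> does not distinguish the merged circles from the result.
  For a split, the difference of the new circles becomes \<open>split_factor\<close>, and in its
  presence the value of the cut circle may be read off at any of its points, so that replacing it by
  the circle through \<open>i\<close> changes nothing.\<close>

lemma odd_step:
  assumes arc: "P \<subseteq> b" "e \<in> b" "e \<notin> P" "e = {i, j}" "ori e = (i, j)"
    and z: "compat (insert e P) z" and x: "keys x \<subseteq> lists (SC P)"
  shows "z * word_eval \<theta> (odd_surgery c b a ori P e x) = z * split_factor P e * word_eval \<theta> x"
proof -
  let ?e\<^sub>i = "circ (insert e P) (Inl i)" and ?e\<^sub>j = "circ (insert e P) (Inl j)"
  define f where "f = (\<lambda>K. if K = circ P (Inl i) \<or> K = circ P (Inr i) then ?e\<^sub>i else K)"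
  note cases = odd_surgery_cases[where ori = ori, OF arc, folded f_def]
  have z': "compat P (z * split_factor P e)" by (rule compat_step[OF arc(1-4) z])
  have ends: "z * \<theta> ?e\<^sub>i = z * \<tau> (Inl i)" "z * \<theta> ?e\<^sub>j = z * \<tau> (Inl j)"
    using \<theta>_circ[OF z] by simp_all
  show ?thesis
  proof (cases "circ P (Inl i) = circ P (Inr i)")
    case False
    have "z * \<theta> (f K) = z * \<theta> K" if "K \<in> SC P" for K
    proof (cases "K = circ P (Inl i) \<or> K = circ P (Inr i)")
      case True
      then have "basepoint K \<in> circ P (Inl i) \<union> circ P (Inr i)" using basepoint_circ by auto
      then have "z * \<theta> K = z * \<tau> (Inl i)" by (rule merge_values[OF arc(1-4) z False])
      then show ?thesis using True ends by (simp add: f_def)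
    qed (simp add: f_def)
    then have "z * word_eval (\<lambda>K. \<theta> (f K)) x = z * word_eval \<theta> x"
      by (rule word_eval_mult_cong[OF x])
    then show ?thesis using False by (simp add: cases(1) word_eval_map split_factor[OF arc(1-4)])
  next
    case True
    let ?z = "z * split_factor P e"
    have sf: "?z = z * (\<tau> (Inl i) + \<tau> (Inl j))" using True split_factor[OF arc(1-4)] by simp
    have "?z * \<theta> (f K) = ?z * \<theta> K" if "K \<in> SC P" for K
    proof (cases "K = circ P (Inl i)")
      case K: True
      have "?e\<^sub>i \<subseteq> circ P (Inl i)" using circ_union[OF arc(1-4)] True by blast
      then have "basepoint ?e\<^sub>i \<in> circ P (Inl i)" using basepoint_circ by blast
      from split_values[OF arc(1-4) z True this] split_values[OF arc(1-4) z True basepoint_circ]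
      show ?thesis using K unfolding sf f_def by simp
    qed (use True in \<open>simp add: f_def\<close>)
    then have "?z * word_eval (\<lambda>K. \<theta> (f K)) x = ?z * word_eval \<theta> x"
      by (rule word_eval_mult_cong[OF x])
    moreover have "z * word_eval \<theta> (odd_surgery c b a ori P e x) =
        (z * \<theta> ?e\<^sub>i - z * \<theta> ?e\<^sub>j) * word_eval (\<lambda>K. \<theta> (f K)) x"
      using True by (simp add: cases(1) word_eval_map word_eval_mult algebra_simps)
    moreover have "z * \<theta> ?e\<^sub>i - z * \<theta> ?e\<^sub>j = ?z"
      unfolding ends sf by (simp add: char2_diff[OF char2] distrib_left)
    ultimately show ?thesis by simp
  qed
qed

text \<open>The untouched circles contribute a common product. For the others the structure maps of
  \<open>A\<close> match identities among values: \<open>t t = 0\<close> says that a merged value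
  has square zero, the coproduct of \<open>1\<close> is the sum of the two new values, and the
  coproduct of \<open>t\<close> is their product, as in \<open>split_values\<close>.\<close>

lemma even_step:
  assumes arc: "P \<subseteq> b" "e \<in> b" "e \<notin> P" and z: "compat (insert e P) z"
  shows "z * label_eval \<theta> (SC (insert e P)) (even_surgery n c b a P e x) =
    z * split_factor P e * label_eval \<theta> (SC P) x"
proof -
  define i j where "i = Min e" and "j = Max e"
  obtain p q where "e = {p, q}" "p < q" using B_arc_cases[OF b arc(2)] by metis
  then have ij: "e = {i, j}" by (auto simp: i_def j_def)
  note arc = arc ij
  let ?a1 = "circ P (Inl i)" and ?a2 = "circ P (Inr i)"
    and ?e\<^sub>i = "circ (insert e P) (Inl i)" and ?e\<^sub>j = "circ (insert e P) (Inl j)"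
  define R where "R = SC P - {?a1, ?a2}"
  have S2: "SC (insert e P) = R \<union> {?e\<^sub>i, ?e\<^sub>j}" unfolding R_def by (rule stacked_circles_insert[OF arc])
  have S1: "SC P = R \<union> {?a1, ?a2}" using SC_circ arc_facts(1)[OF arc] unfolding R_def by blast
  have R: "finite R" "?a1 \<notin> R" "?a2 \<notin> R" "?e\<^sub>i \<notin> R" "?e\<^sub>j \<notin> R"
    using new_circle_not_old[OF arc] unfolding R_def by simp_all
  have ends: "z * \<theta> ?e\<^sub>i = z * \<tau> (Inl i)" "z * \<theta> ?e\<^sub>j = z * \<tau> (Inl j)"
    using \<theta>_circ[OF z] by simp_all
  define w where "w l K = (if l K = T then \<theta> K else 1)" for l :: "(nat + nat) set \<Rightarrow> gen" and K
  have w_cong: "w l K = w l' K" if "l K = l' K" for l l' K using that by (simp add: w_def)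
  define E where "E l = (\<Prod>K\<in>SC (insert e P). w l K)" for l
  have evE: "label_eval \<theta> (SC (insert e P)) = lin_ext E" "label_eval \<theta> (SC P) = lin_ext (\<lambda>l. \<Prod>K\<in>SC P. w l K)"
    by (simp_all add: label_eval_def label_prod E_def[abs_def] w_def)
  show ?thesis
  proof (cases "?a1 = ?a2")
    case False
    have eij: "?e\<^sub>i = ?e\<^sub>j" using splits_iff[OF arc] False by blast
    have merged: "z * \<theta> ?a1 = z * \<tau> (Inl i)" "z * \<theta> ?a2 = z * \<tau> (Inl i)"
      using basepoint_circ by (auto intro!: merge_values[OF arc z False])
    define L where "L l g = (\<lambda>K\<in>SC (insert e P). if K = ?e\<^sub>i then g else l K)" for l :: "(nat + nat) set \<Rightarrow> gen" and g
    have E_L: "E (L l g) = (if g = T then \<theta> ?e\<^sub>i else 1) * (\<Prod>K\<in>R. w l K)" for l g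
    proof -
      have "(\<Prod>K\<in>R. w (L l g) K) = (\<Prod>K\<in>R. w l K)"
        using R S2 by (intro prod.cong w_cong) (auto simp: L_def)
      moreover have "E (L l g) = w (L l g) ?e\<^sub>i * (\<Prod>K\<in>R. w (L l g) K)"
        unfolding E_def S2 eij using R by simp
      moreover have "w (L l g) ?e\<^sub>i = (if g = T then \<theta> ?e\<^sub>i else 1)"
        using S2 by (simp add: w_def L_def)
      ultimately show ?thesis by simp
    qed
    have S1_prod: "(\<Prod>K\<in>SC P. w l K) = w l ?a1 * w l ?a2 * (\<Prod>K\<in>R. w l K)" for l
      unfolding S1 using R False by (simp add: mult_ac)
    have aa: "z * (\<theta> ?a1 * \<theta> ?a2) = 0"
    proof -
      have "z * (\<theta> ?a1 * \<theta> ?a2) = (z * \<theta> ?a1) * \<theta> ?a2" by (simp add: mult_ac)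
      also have "\<dots> = (z * \<theta> ?a2) * \<theta> ?a2" using merged by simp
      finally show ?thesis by (simp add: mult.assoc \<tau>_square)
    qed
    have *: "z * lin_ext (\<lambda>g. E (L l g)) (A_mult (l ?a1) (l ?a2)) = z * (\<Prod>K\<in>SC P. w l K)" for l
    proof -
      define r where "r = (\<Prod>K\<in>R. w l K)"
      have "z * (\<theta> ?a1 * r) = z * \<theta> ?a1 * r" "z * (\<theta> ?a2 * r) = z * \<theta> ?a2 * r"
        "z * (\<theta> ?e\<^sub>i * r) = z * \<theta> ?e\<^sub>i * r" "z * (\<theta> ?a1 * \<theta> ?a2 * r) = z * (\<theta> ?a1 * \<theta> ?a2) * r"
        by (simp_all only: mult_ac)
      then show ?thesis
        unfolding S1_prod E_L r_def[symmetric]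
        by (cases "l ?a1"; cases "l ?a2") (simp_all add: w_def merged ends aa)
    qed
    have "even_surgery n c b a P e x =
        frag_extend (\<lambda>l. frag_extend (\<lambda>g. frag_of (L l g)) (A_mult (l ?a1) (l ?a2))) x"
      unfolding even_surgery_def Let_def i_def[symmetric] j_def[symmetric] using False by (simp add: L_def)
    then have "z * label_eval \<theta> (SC (insert e P)) (even_surgery n c b a P e x) =
        lin_ext (\<lambda>l. z * lin_ext (\<lambda>g. E (L l g)) (A_mult (l ?a1) (l ?a2))) x"
      by (simp add: evE lin_ext_frag_extend lin_ext_mult_left)
    also have "\<dots> = z * label_eval \<theta> (SC P) x"
      unfolding * evE lin_ext_mult_left ..
    finally show ?thesis using split_factor[OF arc] False by simp
  next
    case True
    have eij: "?e\<^sub>i \<noteq> ?e\<^sub>j" using splits_iff[OF arc] True by blast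
    define L where "L l gh = (\<lambda>K\<in>SC (insert e P). if K = ?e\<^sub>i then fst gh else if K = ?e\<^sub>j then snd gh else l K)"
      for l :: "(nat + nat) set \<Rightarrow> gen" and gh
    have E_L: "E (L l (g, h)) = (if g = T then \<theta> ?e\<^sub>i else 1) * (if h = T then \<theta> ?e\<^sub>j else 1) * (\<Prod>K\<in>R. w l K)" for l g h
    proof -
      have "(\<Prod>K\<in>R. w (L l (g, h)) K) = (\<Prod>K\<in>R. w l K)"
        using R S2 by (intro prod.cong w_cong) (auto simp: L_def)
      moreover have "E (L l (g, h)) = w (L l (g, h)) ?e\<^sub>i * w (L l (g, h)) ?e\<^sub>j * (\<Prod>K\<in>R. w (L l (g, h)) K)"
        unfolding E_def S2 using R eij by (simp add: mult_ac)
      moreover have "w (L l (g, h)) ?e\<^sub>i = (if g = T then \<theta> ?e\<^sub>i else 1)" "w (L l (g, h)) ?e\<^sub>j = (if h = T then \<theta> ?e\<^sub>j else 1)"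
        using S2 eij by (simp_all add: w_def L_def)
      ultimately show ?thesis by simp
    qed
    have S1_prod: "(\<Prod>K\<in>SC P. w l K) = w l ?a1 * (\<Prod>K\<in>R. w l K)" for l
      unfolding S1 True using R by simp
    have sf: "split_factor P e = \<tau> (Inl i) + \<tau> (Inl j)" using True split_factor[OF arc] by simp
    have a1: "z * (\<tau> (Inl i) + \<tau> (Inl j)) * \<theta> ?a1 = z * \<tau> (Inl i) * \<tau> (Inl j)"
      by (rule split_values[OF arc z True basepoint_circ])
    have ee: "z * (\<theta> ?e\<^sub>i * \<theta> ?e\<^sub>j) = z * \<tau> (Inl i) * \<tau> (Inl j)"
    proof -
      have "z * (\<theta> ?e\<^sub>i * \<theta> ?e\<^sub>j) = (z * \<theta> ?e\<^sub>i) * \<theta> ?e\<^sub>j" by (simp add: mult_ac)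
      also have "\<dots> = (z * \<theta> ?e\<^sub>j) * \<tau> (Inl i)" unfolding ends(1) by (simp only: mult_ac)
      also have "\<dots> = z * \<tau> (Inl i) * \<tau> (Inl j)" unfolding ends(2) by (simp only: mult_ac)
      finally show ?thesis .
    qed
    have *: "z * lin_ext (\<lambda>gh. E (L l gh)) (A_comult (l ?a1)) = z * split_factor P e * (\<Prod>K\<in>SC P. w l K)" for l
    proof -
      define r where "r = (\<Prod>K\<in>R. w l K)"
      have 1: "z * (\<theta> ?e\<^sub>i * r) = z * \<theta> ?e\<^sub>i * r" "z * (\<theta> ?e\<^sub>j * r) = z * \<theta> ?e\<^sub>j * r"
        "z * (\<theta> ?e\<^sub>i * \<theta> ?e\<^sub>j * r) = z * (\<theta> ?e\<^sub>i * \<theta> ?e\<^sub>j) * r"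
        by (simp_all only: mult_ac)
      show ?thesis
      proof (cases "l ?a1")
        case Unit
        then have "z * lin_ext (\<lambda>gh. E (L l gh)) (A_comult (l ?a1)) = z * (\<theta> ?e\<^sub>j * r) + z * (\<theta> ?e\<^sub>i * r)"
          by (simp add: E_L r_def distrib_left)
        also have "\<dots> = z * split_factor P e * r" unfolding 1 ends sf by (simp add: algebra_simps)
        finally show ?thesis unfolding S1_prod r_def[symmetric] using Unit by (simp add: w_def)
      next
        case T
        then have "z * lin_ext (\<lambda>gh. E (L l gh)) (A_comult (l ?a1)) = z * (\<theta> ?e\<^sub>i * \<theta> ?e\<^sub>j * r)"
          by (simp add: E_L r_def)
        also have "\<dots> = z * split_factor P e * \<theta> ?a1 * r" unfolding 1 ee sf a1 ..
        finally show ?thesis unfolding S1_prod r_def[symmetric] using T by (simp add: w_def mult_ac)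
      qed
    qed
    have "even_surgery n c b a P e x =
        frag_extend (\<lambda>l. frag_extend (\<lambda>gh. frag_of (L l gh)) (A_comult (l ?a1))) x"
      unfolding even_surgery_def Let_def i_def[symmetric] j_def[symmetric] using True
      by (simp add: L_def case_prod_unfold)
    then have "z * label_eval \<theta> (SC (insert e P)) (even_surgery n c b a P e x) =
        lin_ext (\<lambda>l. z * lin_ext (\<lambda>gh. E (L l gh)) (A_comult (l ?a1))) x"
      by (simp add: evE lin_ext_frag_extend lin_ext_mult_left)
    also have "\<dots> = z * split_factor P e * label_eval \<theta> (SC P) x"
      unfolding * evE lin_ext_mult_left ..
    finally show ?thesis .
  qed
qed

lemma run_odd_eval:
  assumes ori: "\<And>e. e \<in> b \<Longrightarrow> case ori e of (i, j) \<Rightarrow> e = {i, j}"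
    and "distinct es" "set es = b - P" "P \<subseteq> b" "keys x \<subseteq> lists (SC P)"
  shows "word_eval \<theta> (run (odd_surgery c b a ori) es P x) = order_factor es P * word_eval \<theta> x"
  using assms(2-5)
proof (induction es arbitrary: P x)
  case Nil
  then have "P = b" by auto
  then show ?case by simp
next
  case (Cons e es)
  have e: "e \<in> b" "e \<notin> P" using Cons.prems(2) by auto
  obtain i j where ij: "ori e = (i, j)" "e = {i, j}" using ori[OF e(1)] by (cases "ori e") auto
  note arc = Cons.prems(3) e ij(2) ij(1)
  have es: "distinct es" "set es = b - insert e P" "insert e P \<subseteq> b" using Cons.prems e by auto
  have "word_eval \<theta> (run (odd_surgery c b a ori) (e # es) P x) =
      order_factor es (insert e P) * word_eval \<theta> (odd_surgery c b a ori P e x)"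
    using Cons.IH[OF es odd_surgery_keys[where ori = ori, OF arc Cons.prems(4)]] by simp
  then show ?case using odd_step[where ori = ori, OF arc compat_order_factor[OF es] Cons.prems(4)] by simp
qed

lemma run_even_eval:
  assumes "distinct es" "set es = b - P" "P \<subseteq> b"
  shows "label_eval \<theta> (SC b) (run (even_surgery n c b a) es P x) = order_factor es P * label_eval \<theta> (SC P) x"
  using assms
proof (induction es arbitrary: P x)
  case Nil
  then have "P = b" by auto
  then show ?case by simp
next
  case (Cons e es)
  have e: "e \<in> b" "e \<notin> P" using Cons.prems(2) by auto
  have es: "distinct es" "set es = b - insert e P" "insert e P \<subseteq> b" using Cons.prems e by auto
  have "label_eval \<theta> (SC b) (run (even_surgery n c b a) (e # es) P x) =
      order_factor es (insert e P) * label_eval \<theta> (SC (insert e P)) (even_surgery n c b a P e x)"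
    using Cons.IH[OF es] by simp
  then show ?case using even_step[OF Cons.prems(3) e compat_order_factor[OF es]] by simp
qed

end

section \<open>The two products modulo two\<close>

lemma label_eval_labelling_map:
  assumes "finite S" "inj_on f S"
  shows "label_eval \<rho> (f ` S) (labelling_map f S x) = label_eval (\<lambda>K. \<rho> (f K)) S x"
proof -
  have "(\<Prod>L\<in>{L \<in> f ` S. (\<lambda>L\<in>f ` S. l (inv_into S f L)) L = T}. \<rho> L) = (\<Prod>K\<in>{K \<in> S. l K = T}. \<rho> (f K))" for l
  proof -
    have "{L \<in> f ` S. (\<lambda>L\<in>f ` S. l (inv_into S f L)) L = T} = f ` {K \<in> S. l K = T}"
      using assms(2) by (auto simp: inv_into_f_f)
    moreover have "inj_on f {K \<in> S. l K = T}" using assms(2) by (rule inj_on_subset) auto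
    ultimately show ?thesis by (simp add: prod.reindex)
  qed
  then show ?thesis by (simp add: label_eval_def labelling_map_def lin_ext_frag_extend)
qed

lemma keys_labelling_map: "keys (labelling_map f S x) \<subseteq> f ` S \<rightarrow>\<^sub>E UNIV"
  unfolding labelling_map_def by (rule frag_extend_keys_subset[OF subset_UNIV]) auto

definition final_gen :: "matching \<Rightarrow> matching \<Rightarrow> matching \<Rightarrow> nat + nat \<Rightarrow> nat set ext2" where
  "final_gen c b a v = ext_gen (contract (circle_through (stacked c b a b) v))"

text \<open>The common reduced product. It has to be a function of the reduced arguments alone, so
  \<open>ext_subst\<close> carries them from the circles of the two factors to the final circles;
  the surgery factor is the one for the order from left to right.\<close>

definition product2 :: "nat \<Rightarrow> matching \<Rightarrow> matching \<Rightarrow> matching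
    \<Rightarrow> nat set ext2 \<Rightarrow> nat set ext2 \<Rightarrow> nat set ext2" where
  "product2 n c b a X Y =
     stack_eval.order_factor c b a (final_gen c b a) (new_arcs b [1..<2 * n + 1] {}) {}
     * (ext_subst (\<lambda>K. final_gen c b a (basepoint (Inl ` K))) X
      * ext_subst (\<lambda>K. final_gen c b a (basepoint (Inr ` K))) Y)"

lemma product2_add:
  "product2 n c b a (X + X') Y = product2 n c b a X Y + product2 n c b a X' Y"
  "product2 n c b a X (Y + Y') = product2 n c b a X Y + product2 n c b a X Y'"
  by (simp_all add: product2_def ext_subst_add[OF ext2_char2] algebra_simps)

lemma finite_circles [simp]: "finite (circles n b a)"
  by (simp add: circles_def circles_of_def points_def)

lemma points_upto: "set [1..<2 * n + 1] = points n"
  by (auto simp: points_def)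

context stack
begin

sublocale ev: stack_eval n c b a "final_gen c b a"
proof
  show "(2 :: nat set ext2) = 0" by (rule ext2_char2)
  show "final_gen c b a v * final_gen c b a v = 0" for v by (simp add: final_gen_def ext_gen_square)
  show "final_gen c b a v = final_gen c b a w" if "w \<in> circ b v" for v w
    using circle_through_in[OF that] by (simp add: final_gen_def)
qed

text \<open>The order prescribed by a multiplication rule is traded here for the one from left to
  right.\<close>

lemma order_factor_new_arcs:
  assumes "set ps = points n"
  shows "ev.order_factor (new_arcs b ps {}) {} = ev.order_factor (new_arcs b [1..<2 * n + 1] {}) {}"
  using new_arcs[of b ps "{}"] new_arcs[of b "[1..<2 * n + 1]" "{}"] assms arc_at_points points_upto
  by (intro ev.order_factor_unique) auto

lemma ev_\<theta>: "K \<in> SC b \<Longrightarrow> ev.\<theta> K = ext_gen (contract K)"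
proof -
  assume "K \<in> SC b"
  then obtain v where v: "K = circ b v" by (auto simp: stacked_circles_def circles_of_def)
  have "circ b (basepoint K) = K" unfolding v by (rule circle_through_in[OF ev.basepoint_circ])
  then show ?thesis by (simp add: final_gen_def)
qed

lemma label_eval_stack_labellings:
  "label_eval ev.\<theta> (SC {}) (stack_labellings n c b a x y) =
    label_eval (\<lambda>K. ev.\<theta> (Inl ` K)) (circles n c b) x * label_eval (\<lambda>K. ev.\<theta> (Inr ` K)) (circles n b a) y"
proof -
  let ?l = "\<lambda>l m. \<lambda>K\<in>SC {}. if K \<in> (`) Inl ` circles n c b then l (Inl -` K) else m (Inr -` K)"
  have ne: "K \<noteq> {}" if "K \<in> circles n d d'" for K d d'
  proof -
    obtain v where "K = circle_through (d \<union> d') v" using \<open>K \<in> _\<close> by (auto simp: circles_def circles_of_def)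
    then show ?thesis using circle_through_self[of v "d \<union> d'"] by (metis empty_iff)
  qed
  \<comment> \<open>Circles are nonempty, so an upper circle is never a lower one.\<close>
  have disj: "(`) Inl ` circles n c b \<inter> (`) Inr ` circles n b a = {}"
    using ne by blast
  have inj: "inj_on ((`) Inl) X" "inj_on ((`) Inr) X" for X :: "nat set set"
    by (auto intro!: inj_onI simp: inj_image_eq_iff)
  have "(\<Prod>K\<in>SC {}. if ?l l m K = T then ev.\<theta> K else 1) =
      (\<Prod>K\<in>circles n c b. if l K = T then ev.\<theta> (Inl ` K) else 1) *
      (\<Prod>K\<in>circles n b a. if m K = T then ev.\<theta> (Inr ` K) else 1)" for l m :: "nat set \<Rightarrow> gen"
  proof -
    have "(\<Prod>K\<in>SC {}. if ?l l m K = T then ev.\<theta> K else 1) =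
      (\<Prod>K\<in>(`) Inl ` circles n c b. if ?l l m K = T then ev.\<theta> K else 1) *
      (\<Prod>K\<in>(`) Inr ` circles n b a. if ?l l m K = T then ev.\<theta> K else 1)"
      using disj by (subst (1) stacked_circles_empty) (rule prod.union_disjoint; simp)
    moreover have "(\<Prod>K\<in>(`) Inl ` circles n c b. if ?l l m K = T then ev.\<theta> K else 1) =
        (\<Prod>K\<in>circles n c b. if l K = T then ev.\<theta> (Inl ` K) else 1)"
      unfolding prod.reindex[OF inj(1)]
      by (intro prod.cong) (auto simp: stacked_circles_empty inj_vimage_image_eq)
    moreover have "(\<Prod>K\<in>(`) Inr ` circles n b a. if ?l l m K = T then ev.\<theta> K else 1) =
        (\<Prod>K\<in>circles n b a. if m K = T then ev.\<theta> (Inr ` K) else 1)"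
      unfolding prod.reindex[OF inj(2)]
    proof (intro prod.cong refl)
      fix K assume K: "K \<in> circles n b a"
      then have "Inr ` K \<notin> (`) Inl ` circles n c b" using disj by blast
      then have "?l l m (Inr ` K) = m K" using K by (simp add: stacked_circles_empty inj_vimage_image_eq)
      then show "((\<lambda>K. if ?l l m K = T then ev.\<theta> K else 1) \<circ> (`) Inr) K = (if m K = T then ev.\<theta> (Inr ` K) else 1)"
        by simp
    qed
    ultimately show ?thesis by simp
  qed
  then show ?thesis
    unfolding label_eval_def stack_labellings_def lin_ext_frag_extend lin_ext_frag_of
    by (simp add: label_prod lin_ext_mult_left lin_ext_mult_right)
qed

lemma even_product_eval:
  "label_eval ext_gen (circles n c a) (even_product n c b a x y) =
    product2 n c b a (label_eval ext_gen (circles n c b) x) (label_eval ext_gen (circles n b a) y)"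
proof -
  let ?es = "new_arcs b [1..<2 * n + 1] {}"
  let ?r = "run (even_surgery n c b a) ?es {} (stack_labellings n c b a x y)"
  have es: "distinct ?es" "set ?es = b - {}" "{} \<subseteq> b"
    using new_arcs[of b "[1..<2 * n + 1]" "{}"] arc_at_points points_upto by auto
  have "label_eval ext_gen (circles n c a) (even_product n c b a x y) =
      label_eval (\<lambda>K. ext_gen (contract K)) (SC b) ?r"
    unfolding even_product_def surgeries_eq_run contract_circles[symmetric]
    by (rule label_eval_labelling_map) (simp_all add: inj_on_contract)
  also have "\<dots> = label_eval ev.\<theta> (SC b) ?r"
    unfolding label_eval_def by (intro lin_ext_cong prod.cong refl) (simp add: ev_\<theta>)
  also have "\<dots> = ev.order_factor ?es {} * label_eval ev.\<theta> (SC {}) (stack_labellings n c b a x y)"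
    by (rule ev.run_even_eval[OF es])
  finally show ?thesis
    by (simp add: product2_def label_eval_stack_labellings ext_subst_label_eval ext2_char2)
qed

lemma even_product_keys: "keys (even_product n c b a x y) \<subseteq> circles n c a \<rightarrow>\<^sub>E UNIV"
  unfolding even_product_def contract_circles[symmetric] by (rule keys_labelling_map)

lemma stack_words_keys:
  assumes "keys x \<subseteq> lists (circles n c b)" "keys y \<subseteq> lists (circles n b a)"
  shows "keys (word_map ((`) Inl) x) \<subseteq> lists (SC {})"
    "keys (word_map ((`) Inr) y) \<subseteq> lists (SC {})"
    "keys (word_mult (word_map ((`) Inl) x) (word_map ((`) Inr) y)) \<subseteq> lists (SC {})"
proof -
  show "keys (word_map ((`) Inl) x) \<subseteq> lists (SC {})"
    "keys (word_map ((`) Inr) y) \<subseteq> lists (SC {})"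
    by (rule keys_word_map_lists[OF assms(1)] keys_word_map_lists[OF assms(2)];
        simp add: stacked_circles_empty)+
  then show "keys (word_mult (word_map ((`) Inl) x) (word_map ((`) Inr) y)) \<subseteq> lists (SC {})"
    by (rule keys_word_mult)
qed

section \<open>Products for a given multiplication rule\<close>

context
  fixes C assumes C: "multiplication_rule n C"
begin

lemma rule_facts: "set (point_order C c b a) = points n"
  "e \<in> b \<Longrightarrow> case orientation C c b a e of (i, j) \<Rightarrow> e = {i, j}"
  using C a b c unfolding multiplication_rule_def by auto

lemma new_arcs_rule:
  "distinct (new_arcs b (point_order C c b a) {})" "set (new_arcs b (point_order C c b a) {}) = b - {}"
  using new_arcs[of b "point_order C c b a" "{}"] arc_at_points rule_facts(1) by auto

lemmas run_rule = run_odd[OF rule_facts(2) new_arcs_rule empty_subsetI]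

lemma odd_product_keys:
  assumes "keys x \<subseteq> lists (circles n c b)" "keys y \<subseteq> lists (circles n b a)"
  shows "keys (odd_product C c b a x y) \<subseteq> lists (circles n c a)"
  unfolding odd_product_def surgeries_eq_run
  by (rule keys_word_map_lists[OF run_rule(1)[OF _ stack_words_keys(3)[OF assms]]])
    (simp_all add: contract_circles)

lemma odd_product_eval:
  assumes "keys x \<subseteq> lists (circles n c b)" "keys y \<subseteq> lists (circles n b a)"
  shows "word_eval ext_gen (odd_product C c b a x y) = product2 n c b a (word_eval ext_gen x) (word_eval ext_gen y)"
proof -
  let ?es = "new_arcs b (point_order C c b a) {}"
  let ?x = "word_mult (word_map ((`) Inl) x) (word_map ((`) Inr) y)"
  let ?r = "run (odd_surgery c b a (orientation C c b a)) ?es {} ?x"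
  \<comment> \<open>The factor 1 serves as the multiplier in \<open>word_eval_mult_cong\<close>:
    after the last surgery the values of circles agree without a correction.\<close>
  have "word_eval ext_gen (odd_product C c b a x y) = 1 * word_eval (\<lambda>K. ext_gen (contract K)) ?r"
    unfolding odd_product_def surgeries_eq_run by (simp add: word_eval_map)
  also have "\<dots> = 1 * word_eval ev.\<theta> ?r"
    by (rule word_eval_mult_cong[OF run_rule(1)[OF _ stack_words_keys(3)[OF assms]]]) (simp_all add: ev_\<theta>)
  also have "\<dots> = ev.order_factor ?es {} * word_eval ev.\<theta> ?x"
    using ev.run_odd_eval[OF rule_facts(2) new_arcs_rule empty_subsetI stack_words_keys(3)[OF assms]] by simp
  also have "ev.order_factor ?es {} = ev.order_factor (new_arcs b [1..<2 * n + 1] {}) {}"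
    by (rule order_factor_new_arcs[OF rule_facts(1)])
  finally show ?thesis
    by (simp add: product2_def word_eval_mult word_eval_map ext_subst_word_eval ext2_char2 ev.\<tau>_square)
qed

lemma odd_product_diff:
  "odd_product C c b a (x - x') y = odd_product C c b a x y - odd_product C c b a x' y"
  "odd_product C c b a x (y - y') = odd_product C c b a x y - odd_product C c b a x y'"
  by (simp_all add: odd_product_def surgeries_eq_run run_odd_diff)

lemma odd_product_ideal:
  assumes "keys x \<subseteq> lists (circles n c b)" "keys y \<subseteq> lists (circles n b a)"
    and "x \<in> ext_ideal (circles n c b) \<or> y \<in> ext_ideal (circles n b a)"
  shows "odd_product C c b a x y \<in> ext_ideal (circles n c a)"
proof -
  have "word_mult (word_map ((`) Inl) x) (word_map ((`) Inr) y) \<in> ext_ideal (SC {})"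
    using assms(3)
  proof
    assume "x \<in> ext_ideal (circles n c b)"
    then have "word_map ((`) Inl) x \<in> ext_ideal (SC {})"
      by (rule ext_ideal_map) (simp add: stacked_circles_empty)
    then show ?thesis by (rule ext_ideal_mult_right[OF _ stack_words_keys(2)[OF assms(1,2)]])
  next
    assume "y \<in> ext_ideal (circles n b a)"
    then have "word_map ((`) Inr) y \<in> ext_ideal (SC {})"
      by (rule ext_ideal_map) (simp add: stacked_circles_empty)
    then show ?thesis by (rule ext_ideal_mult_left[OF _ stack_words_keys(1)[OF assms(1,2)]])
  qed
  then show ?thesis
    unfolding odd_product_def surgeries_eq_run
    by (intro ext_ideal_map[OF run_rule(2)[OF _ stack_words_keys(3)[OF assms(1,2)]]])
      (simp_all add: contract_circles)
qed

lemma odd_product_class: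
  assumes x: "keys x \<subseteq> lists (circles n c b)" and y: "keys y \<subseteq> lists (circles n b a)"
  shows "(\<Union>x'\<in>ext_class (circles n c b) x. \<Union>y'\<in>ext_class (circles n b a) y.
    ext_class (circles n c a) (odd_product C c b a x' y')) = ext_class (circles n c a) (odd_product C c b a x y)"
proof (rule UN_UN_eq[where x = x and y = y])
  fix x' y' assume "x' \<in> ext_class (circles n c b) x" "y' \<in> ext_class (circles n b a) y"
  then have d: "x' - x \<in> ext_ideal (circles n c b)" "y' - y \<in> ext_ideal (circles n b a)"
    by (simp_all add: in_ext_class_iff)
  note k = ext_ideal_keys[OF d(1)] ext_ideal_keys[OF d(2)]
  have "keys y' \<subseteq> lists (circles n b a)"
    using keys_add[of "y' - y" y] k(2) y by auto
  \<comment> \<open>The difference of the two products, written as two terms that each have one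
    factor in an ideal.\<close>
  then have "odd_product C c b a (x' - x) y' + odd_product C c b a x (y' - y) \<in> ext_ideal (circles n c a)"
    using k x d by (intro ext_ideal_add odd_product_ideal) auto
  then show "ext_class (circles n c a) (odd_product C c b a x' y') = ext_class (circles n c a) (odd_product C c b a x y)"
    by (simp add: ext_class_eq_iff odd_product_diff)
qed (simp_all add: in_ext_class_iff ext_ideal_0)

end

end

section \<open>The isomorphism\<close>

text \<open>Taken as a predicate on the number \<open>m\<close> of circles in a monomial, it fits
  the parameter \<open>P\<close> of \<open>label_eval_image_eq_ext_eval_image\<close>.\<close>

definition degree_condition :: "nat \<Rightarrow> 's set \<Rightarrow> int \<Rightarrow> nat \<Rightarrow> bool" where
  "degree_condition n S k m \<longleftrightarrow> 2 * int m + int n - int (card S) = k"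

lemma H_degree_part:
  "{x \<in> carrier (A_power (circles n b a)). \<forall>l\<in>keys x. (\<Sum>K\<in>circles n b a. gen_deg (l K)) + int n = k} =
   {x. keys x \<subseteq> {l \<in> circles n b a \<rightarrow>\<^sub>E UNIV.
     degree_condition n (circles n b a) k (card {K \<in> circles n b a. l K = T})}}"
  by (auto simp: A_power_def label_degree degree_condition_def)

lemma OH_degree_part:
  "{x \<in> carrier (free_Abelian_group (lists (circles n b a))).
      \<forall>w\<in>keys x. 2 * int (length w) + int n - int (card (circles n b a)) = k} =
   {x. keys x \<subseteq> {w \<in> lists (circles n b a). degree_condition n (circles n b a) k (length w)}}"
  by (auto simp: degree_condition_def)

lemma subgroup_A_power:
  assumes "X \<subseteq> S \<rightarrow>\<^sub>E UNIV"
  shows "subgroup {x. keys x \<subseteq> X} (A_power S)"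
proof (rule group.subgroupI)
  show "group (A_power S)" by (simp add: A_power_def)
  show "{x. keys x \<subseteq> X} \<subseteq> carrier (A_power S)" using assms by (auto simp: A_power_def)
  show "{x. keys x \<subseteq> X} \<noteq> {}" by (auto intro: exI[of _ 0])
  show "inv\<^bsub>A_power S\<^esub> x \<in> {x. keys x \<subseteq> X}" if "x \<in> {x. keys x \<subseteq> X}" for x
  proof -
    have "x \<in> carrier (free_Abelian_group (S \<rightarrow>\<^sub>E (UNIV :: gen set)))" using that assms by auto
    from inv_free[OF this] show ?thesis using that by (simp add: A_power_def)
  qed
  show "x \<otimes>\<^bsub>A_power S\<^esub> y \<in> {x. keys x \<subseteq> X}"
    if "x \<in> {x. keys x \<subseteq> X}" "y \<in> {x. keys x \<subseteq> X}" for x y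
    using that keys_add[of x y] by (auto simp: A_power_def)
qed

lemma subgroup_exterior:
  assumes "X \<subseteq> lists S"
  shows "subgroup (ext_class S ` {x. keys x \<subseteq> X}) (exterior S)"
proof (rule group.subgroupI)
  interpret E: comm_group "exterior S" by (rule comm_group_exterior)
  show "group (exterior S)" by unfold_locales
  show "ext_class S ` {x. keys x \<subseteq> X} \<subseteq> carrier (exterior S)"
    using assms by (auto simp: carrier_exterior)
  show "ext_class S ` {x. keys x \<subseteq> X} \<noteq> {}" by (auto intro: exI[of _ 0])
  have one: "\<one>\<^bsub>exterior S\<^esub> = ext_class S 0"
    using in_ext_class_iff[of _ S 0] by (auto simp: exterior_def)
  show "inv\<^bsub>exterior S\<^esub> U \<in> ext_class S ` {x. keys x \<subseteq> X}"
    if "U \<in> ext_class S ` {x. keys x \<subseteq> X}" for U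
  proof -
    obtain x where x: "U = ext_class S x" "keys x \<subseteq> X" using \<open>U \<in> _\<close> by blast
    then have k: "keys x \<subseteq> lists S" "keys (- x) \<subseteq> lists S" using assms by auto
    have "ext_class S (- x) \<otimes>\<^bsub>exterior S\<^esub> ext_class S x = \<one>\<^bsub>exterior S\<^esub>"
      by (simp add: mult_exterior[OF k(2,1)] one)
    then have "inv\<^bsub>exterior S\<^esub> U = ext_class S (- x)"
      unfolding x(1) by (rule E.inv_equality) (use k in \<open>auto simp: carrier_exterior\<close>)
    then show ?thesis using x(2) by auto
  qed
  show "U \<otimes>\<^bsub>exterior S\<^esub> V \<in> ext_class S ` {x. keys x \<subseteq> X}"
    if "U \<in> ext_class S ` {x. keys x \<subseteq> X}" "V \<in> ext_class S ` {x. keys x \<subseteq> X}" for U V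
  proof -
    obtain x y where "U = ext_class S x" "V = ext_class S y" "keys x \<subseteq> X" "keys y \<subseteq> X"
      using \<open>U \<in> _\<close> \<open>V \<in> _\<close> by blast
    moreover from this have "keys (x + y) \<subseteq> X" using keys_add[of x y] by auto
    ultimately show ?thesis using assms by (auto simp: mult_exterior)
  qed
qed

lemma H_mod2:
  "arc_ring_mod2 n (\<lambda>b a. A_power (circles n b a)) (even_product n)
     (\<lambda>a. frag_of (\<lambda>K\<in>circles n a a. Unit))
     (\<lambda>b a k. {x \<in> carrier (A_power (circles n b a)).
        \<forall>l\<in>keys x. (\<Sum>K\<in>circles n b a. gen_deg (l K)) + int n = k})
     (\<lambda>b a. label_eval ext_gen (circles n b a)) (product2 n)"
proof (rule arc_ring_mod2.intro)
  show "(2 :: nat set ext2) = 0" by (rule ext2_char2)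
  show "comm_group (A_power (circles n b a))" for b a by (simp add: A_power_def abelian_free_Abelian_group)
  show "even_product n c b a x y \<in> carrier (A_power (circles n c a))"
    if "c \<in> B n" "b \<in> B n" "a \<in> B n" for c b a x y
    using stack.even_product_keys[OF stack.intro[OF that]] by (simp add: A_power_def)
  show "frag_of (\<lambda>K\<in>circles n a a. Unit) \<in> carrier (A_power (circles n a a))" for a
    by (simp add: A_power_def)
  show "subgroup {x \<in> carrier (A_power (circles n b a)).
        \<forall>l\<in>keys x. (\<Sum>K\<in>circles n b a. gen_deg (l K)) + int n = k} (A_power (circles n b a))" for b a k
    unfolding H_degree_part by (rule subgroup_A_power) auto
  show "label_eval ext_gen (circles n b a) (x \<otimes>\<^bsub>A_power (circles n b a)\<^esub> y) =
      label_eval ext_gen (circles n b a) x + label_eval ext_gen (circles n b a) y" for b a x y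
    by (simp add: label_eval_def A_power_def)
  show "\<exists>y\<in>carrier (A_power (circles n b a)). x = y \<otimes>\<^bsub>A_power (circles n b a)\<^esub> y"
    if "x \<in> carrier (A_power (circles n b a))" "label_eval ext_gen (circles n b a) x = 0" for b a x
    by (rule label_eval_kernel[OF finite_circles that])
  show "label_eval ext_gen (circles n c a) (even_product n c b a x y) =
      product2 n c b a (label_eval ext_gen (circles n c b) x) (label_eval ext_gen (circles n b a) y)"
    if "c \<in> B n" "b \<in> B n" "a \<in> B n" for c b a x y
    by (rule stack.even_product_eval[OF stack.intro[OF that]])
qed (rule product2_add)+

lemma OH_mod2:
  assumes C: "multiplication_rule n C"
  shows "arc_ring_mod2 n (\<lambda>b a. exterior (circles n b a))
     (\<lambda>c b a U V. \<Union>x\<in>U. \<Union>y\<in>V. ext_class (circles n c a) (odd_product C c b a x y))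
     (\<lambda>a. ext_class (circles n a a) (frag_of []))
     (\<lambda>b a k. ext_class (circles n b a) `
        {x \<in> carrier (free_Abelian_group (lists (circles n b a))).
           \<forall>w\<in>keys x. 2 * int (length w) + int n - int (card (circles n b a)) = k})
     (\<lambda>b a. ext_eval) (product2 n)"
proof (rule arc_ring_mod2.intro)
  show "(2 :: nat set ext2) = 0" by (rule ext2_char2)
  show "comm_group (exterior (circles n b a))" for b a by (rule comm_group_exterior)
  show "ext_class (circles n a a) (frag_of []) \<in> carrier (exterior (circles n a a))" for a
    by (auto simp: carrier_exterior)
  show "subgroup (ext_class (circles n b a) ` {x \<in> carrier (free_Abelian_group (lists (circles n b a))).
      \<forall>w\<in>keys x. 2 * int (length w) + int n - int (card (circles n b a)) = k}) (exterior (circles n b a))" for b a k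
    unfolding OH_degree_part by (rule subgroup_exterior) auto
  show "ext_eval (U \<otimes>\<^bsub>exterior (circles n b a)\<^esub> V) = ext_eval U + ext_eval V"
    if "U \<in> carrier (exterior (circles n b a))" "V \<in> carrier (exterior (circles n b a))" for b a U V
    using that by (auto simp: carrier_exterior mult_exterior ext_eval_class)
  show "\<exists>V\<in>carrier (exterior (circles n b a)). U = V \<otimes>\<^bsub>exterior (circles n b a)\<^esub> V"
    if "U \<in> carrier (exterior (circles n b a))" "ext_eval U = 0" for b a U
    by (rule ext_eval_kernel[OF finite_circles that])
  fix c b a U V assume *: "c \<in> B n" "b \<in> B n" "a \<in> B n"
    "U \<in> carrier (exterior (circles n c b))" "V \<in> carrier (exterior (circles n b a))"
  interpret stack n c b a using * by (intro stack.intro)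
  obtain x y where x: "U = ext_class (circles n c b) x" "keys x \<subseteq> lists (circles n c b)"
    and y: "V = ext_class (circles n b a) y" "keys y \<subseteq> lists (circles n b a)"
    using *(4,5) unfolding carrier_exterior by blast
  have eq: "(\<Union>x\<in>U. \<Union>y\<in>V. ext_class (circles n c a) (odd_product C c b a x y)) =
      ext_class (circles n c a) (odd_product C c b a x y)"
    unfolding x(1) y(1) by (rule odd_product_class[OF C x(2) y(2)])
  show "(\<Union>x\<in>U. \<Union>y\<in>V. ext_class (circles n c a) (odd_product C c b a x y)) \<in> carrier (exterior (circles n c a))"
    unfolding eq carrier_exterior using odd_product_keys[OF C x(2) y(2)] by blast
  show "ext_eval (\<Union>x\<in>U. \<Union>y\<in>V. ext_class (circles n c a) (odd_product C c b a x y)) =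
      product2 n c b a (ext_eval U) (ext_eval V)"
    unfolding eq unfolding x(1) y(1) ext_eval_class by (rule odd_product_eval[OF C x(2) y(2)])
qed (rule product2_add)+

theorem proposition2p44:
  fixes n :: nat and C :: mult_rule
  assumes "multiplication_rule n C"
  shows "\<exists>h. h \<in> graded_ring_iso
    (tensor_ring (H n) (residue_ring 2)) (tensor_ring (OH n C) (residue_ring 2))"
proof -
  note H = H_mod2[of n] and OH = OH_mod2[OF assms]
  \<comment> \<open>\<open>P\<close> constantly true gives the carriers,
    \<open>degree_condition\<close> the homogeneous parts.\<close>
  have image: "label_eval ext_gen (circles n b a) ` {x. keys x \<subseteq> {l \<in> circles n b a \<rightarrow>\<^sub>E UNIV. P (card {K \<in> circles n b a. l K = T})}}
    = ext_eval ` ext_class (circles n b a) ` {x. keys x \<subseteq> {w \<in> lists (circles n b a). P (length w)}}" for b a P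
    by (rule label_eval_image_eq_ext_eval_image) simp
  have carrier: "label_eval ext_gen (circles n b a) ` carrier (A_power (circles n b a)) = ext_eval ` carrier (exterior (circles n b a))" for b a
  proof -
    have "carrier (A_power (circles n b a)) = {x. keys x \<subseteq> circles n b a \<rightarrow>\<^sub>E UNIV}"
      by (simp add: A_power_def set_eq_iff)
    then show ?thesis using image[of b a "\<lambda>_. True"] by (simp add: carrier_exterior)
  qed
  show ?thesis
    unfolding H_def OH_def
    by (rule graded_ring_iso_arc_rings[OF H OH carrier])
      (simp_all only: H_degree_part OH_degree_part image, simp add: label_eval_def ext_eval_class)
qed

end
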